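(* Let $\mathbf{R}$, $u_0$ and $\mathbf{F}_G$ be as in the context, and let $u$ be a global variational solution to the $TV^\alpha_G$-denoising flow. Then: (i) $\partial_tu\in L^2(\Omega_T)$ and $u\in C^{0,1/2}([0,T];L^2(\Omega))$ for every $T>0$; (ii) $\int_0^T\int_\Omega|\partial_tu|^2\,dx\,dt\le\mathbf{F}_G(u_0)$ for every $T>0$; (iii) $\frac{1}{t_2-t_1}\int_{t_1}^{t_2}\mathbf{F}_G(u(t))\,dt\le\mathbf{F}_G(u_0)$ for all $0\le t_1<t_2<\infty$.
   Context: Let $N\ge1$, let $\Omega\subset\mathbb{R}^N$ be a bounded open set, $\alpha\in(0,1)$, and for $T\in(0,\infty)$ write $\Omega_T=\Omega\times(0,T)$. For a measurable $F:\mathbb{R}^N\times\mathbb{R}^N\to\mathbb{R}$ its Gagliardo divergence is $\operatorname{div}^\alpha_G F(x)=-\int_{\mathbb{R}^N}\frac{F(x,y)-F(y,x)}{|x-y|^{N+\alpha}}\,dy$. For $f\in L^1_{loc}(\mathbb{R}^N)$ set $TV^\alpha_G(f;\mathbb{R}^N)=\sup\{\int_{\mathbb{R}^N}f\,\operatorname{div}^\alpha_G\Phi\,dx:\Phi\in C^\infty_c(\mathbb{R}^N\times\mathbb{R}^N),\ \|\Phi\|_{L^\infty}\le1\}$, and let $BV^\alpha_G(\mathbb{R}^N)=\{f\in L^1(\mathbb{R}^N):TV^\alpha_G(f;\mathbb{R}^N)<\infty\}$ with norm $\|f\|_{L^1}+TV^\alpha_G(f;\mathbb{R}^N)$ (it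 is known that $TV^\alpha_G(f;\mathbb{R}^N)=\iint_{\mathbb{R}^N\times\mathbb{R}^N}\frac{|f(x)-f(y)|}{|x-y|^{N+\alpha}}\,dy\,dx$). For $w\in BV^\alpha_G(\mathbb{R}^N)$ let $BV^\alpha_G(\Omega;w)=\{u\in BV^\alpha_G(\mathbb{R}^N):u=w\text{ a.e. on }\mathbb{R}^N\setminus\Omega\}$. The space $L^1_w(0,T;BV^\alpha_G(\Omega;w))$ consists of maps $v:[0,T]\to BV^\alpha_G(\Omega;w)$ with $v\in L^1(\mathbb{R}^N\times(0,T))$, such that for every $\Phi\in C^1_c(\mathbb{R}^N\times\mathbb{R}^N)$ the map $t\mapsto\int_{\mathbb{R}^N}v(t)\operatorname{div}^\alpha_G\Phi\,dx$ is measurable on $[0,T]$, and $\int_0^T TV^\alpha_G(v(t);\mathbb{R}^N)\,dt<\infty$. Time derivatives $\partial_t$ are weak derivatives. Let $\mathbf{R}:\Omega\times\mathbb{R}\to[0,\infty)$ be a Carathéodory integrand such that $u\mapsto\mathbf{R}(x,u)$ is convex for a.e. $x\in\Omega$. Define $\mathbf{F}_G(u)=TV^\alpha_G(u;\mathbb{R}^N)+\int_\Omega\mathbf{R}(x,u(x))\,dx$. Let $u_0\in BV^\alpha_G(\mathbb{R}^N)$ with $u_0|_\Omega\in L^2(\Omega)$ and $\int_\Omega\mathbf{R}(x,u_0(x))\,dx<\infty$. A function $u:\mathbb{R}^N\times[0,T]\to\mathbb{R}$ is a variational solution in $\Omega_T$ of the $TV^\alpha_G$-denoising flow if $u\in L^1_w(0,T;BV^\alpha_G(\Omega;u_0))\cap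 C^0([0,T];L^2(\Omega))$ and $\int_0^T\mathbf{F}_G(u(t))\,dt\le\int_0^T\int_\Omega\partial_tv\,(v-u)\,dx\,dt+\int_0^T\mathbf{F}_G(v(t))\,dt-\frac12\|(v-u)(T)\|^2_{L^2(\Omega)}+\frac12\|v(0)-u_0\|^2_{L^2(\Omega)}$ for every $v\in L^1_w(0,T;BV^\alpha_G(\Omega;u_0))$ with $\partial_tv\in L^2(\Omega_T)$ and $v(0)\in L^2(\Omega)$. It is a global variational solution if it is a variational solution in $\Omega_T$ for every $T>0$. *)

theory Defs
  imports "HOL-Analysis.Analysis"
begin

fun Ck :: "nat \<Rightarrow> ('a::euclidean_space \<Rightarrow> real) \<Rightarrow> bool" where
  "Ck 0 f = continuous_on UNIV f"
| "Ck (Suc k) f = (f differentiable_on UNIV \<and>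
      (\<forall>i\<in>Basis. Ck k (\<lambda>x. frechet_derivative f (at x) i)))"

definition smooth :: "('a::euclidean_space \<Rightarrow> real) \<Rightarrow> bool" where
  "smooth f \<longleftrightarrow> (\<forall>k. Ck k f)"

definition supp :: "('a::euclidean_space \<Rightarrow> real) \<Rightarrow> 'a set" where
  "supp f = closure {x. f x \<noteq> 0}"

definition Cinf_c :: "('a::euclidean_space \<Rightarrow> real) \<Rightarrow> bool" where
  "Cinf_c f \<longleftrightarrow> smooth f \<and> compact (supp f)"

definition C1_c :: "('a::euclidean_space \<Rightarrow> real) \<Rightarrow> bool" where
  "C1_c f \<longleftrightarrow> Ck 1 f \<and> compact (supp f)"

definition divG :: "real \<Rightarrow> ('a::euclidean_space \<times> 'a \<Rightarrow> real) \<Rightarrow> 'a \<Rightarrow> real" where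
  "divG \<alpha> \<Phi> x = - (\<integral>y. (\<Phi> (x, y) - \<Phi> (y, x)) / norm (x - y) powr (real DIM('a) + \<alpha>) \<partial>lebesgue)"

definition TVG :: "real \<Rightarrow> ('a::euclidean_space \<Rightarrow> real) \<Rightarrow> ennreal" where
  "TVG \<alpha> f = (SUP \<Phi> \<in> {\<Phi>. Cinf_c \<Phi> \<and> (\<forall>p. \<bar>\<Phi> p\<bar> \<le> 1)}.
                 ennreal (\<integral>x. f x * divG \<alpha> \<Phi> x \<partial>lebesgue))"

definition BVG :: "real \<Rightarrow> ('a::euclidean_space \<Rightarrow> real) \<Rightarrow> bool" where
  "BVG \<alpha> f \<longleftrightarrow> integrable lebesgue f \<and> TVG \<alpha> f < \<infinity>"

definition BVG_bc :: "real \<Rightarrow> 'a set \<Rightarrow> ('a::euclidean_space \<Rightarrow> real) \<Rightarrow> ('a \<Rightarrow> real) \<Rightarrow> bool" where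
  "BVG_bc \<alpha> \<Omega> w f \<longleftrightarrow> BVG \<alpha> f \<and> (AE x in lebesgue. x \<notin> \<Omega> \<longrightarrow> f x = w x)"

definition L1w :: "real \<Rightarrow> 'a set \<Rightarrow> ('a::euclidean_space \<Rightarrow> real) \<Rightarrow> real \<Rightarrow> (real \<Rightarrow> 'a \<Rightarrow> real) \<Rightarrow> bool" where
  "L1w \<alpha> \<Omega> w T v \<longleftrightarrow>
     (\<forall>t\<in>{0..T}. BVG_bc \<alpha> \<Omega> w (v t)) \<and>
     integrable (lebesgue_on (UNIV \<times> {0<..<T})) (\<lambda>p. v (snd p) (fst p)) \<and>
     (\<forall>\<Phi>. C1_c \<Phi> \<longrightarrow>
        (\<lambda>t. \<integral>x. v t x * divG \<alpha> \<Phi> x \<partial>lebesgue) \<in> borel_measurable (lebesgue_on {0..T})) \<and>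
     (\<integral>\<^sup>+ t\<in>{0..T}. TVG \<alpha> (v t) \<partial>lebesgue) < \<infinity>"

definition FG :: "real \<Rightarrow> ('a::euclidean_space \<Rightarrow> real \<Rightarrow> real) \<Rightarrow> 'a set \<Rightarrow> ('a \<Rightarrow> real) \<Rightarrow> ennreal" where
  "FG \<alpha> R \<Omega> u = TVG \<alpha> u + (\<integral>\<^sup>+ x\<in>\<Omega>. ennreal (R x (u x)) \<partial>lebesgue)"

definition caratheodory :: "'a set \<Rightarrow> ('a::euclidean_space \<Rightarrow> real \<Rightarrow> real) \<Rightarrow> bool" where
  "caratheodory \<Omega> R \<longleftrightarrow> (\<forall>s. (\<lambda>x. R x s) \<in> borel_measurable (lebesgue_on \<Omega>)) \<and>
                          (AE x in lebesgue_on \<Omega>. continuous_on UNIV (R x))"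

definition L2on :: "'b set \<Rightarrow> ('b::euclidean_space \<Rightarrow> real) \<Rightarrow> bool" where
  "L2on S f \<longleftrightarrow> f \<in> borel_measurable (lebesgue_on S) \<and> integrable (lebesgue_on S) (\<lambda>x. (f x)\<^sup>2)"

definition L2dist2 :: "'b set \<Rightarrow> ('b::euclidean_space \<Rightarrow> real) \<Rightarrow> ('b \<Rightarrow> real) \<Rightarrow> real" where
  "L2dist2 S f g = (\<integral>x. (f x - g x)\<^sup>2 \<partial>lebesgue_on S)"

definition C0L2 :: "'a set \<Rightarrow> real \<Rightarrow> (real \<Rightarrow> 'a::euclidean_space \<Rightarrow> real) \<Rightarrow> bool" where
  "C0L2 \<Omega> T v \<longleftrightarrow> (\<forall>t\<in>{0..T}. L2on \<Omega> (v t)) \<and>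
     (\<forall>t\<in>{0..T}. ((\<lambda>s. L2dist2 \<Omega> (v s) (v t)) \<longlongrightarrow> 0) (at t within {0..T}))"

definition C012L2 :: "'a set \<Rightarrow> real \<Rightarrow> (real \<Rightarrow> 'a::euclidean_space \<Rightarrow> real) \<Rightarrow> bool" where
  "C012L2 \<Omega> T v \<longleftrightarrow> (\<forall>t\<in>{0..T}. L2on \<Omega> (v t)) \<and>
     (\<exists>C. \<forall>s\<in>{0..T}. \<forall>t\<in>{0..T}. sqrt (L2dist2 \<Omega> (v s) (v t)) \<le> C * \<bar>s - t\<bar> powr (1/2))"

definition dtime :: "('a::euclidean_space \<times> real \<Rightarrow> real) \<Rightarrow> 'a \<times> real \<Rightarrow> real" where
  "dtime \<phi> p = deriv (\<lambda>s. \<phi> (fst p, s)) (snd p)"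

definition weak_dt :: "'a set \<Rightarrow> real \<Rightarrow> (real \<Rightarrow> 'a::euclidean_space \<Rightarrow> real) \<Rightarrow> ('a \<times> real \<Rightarrow> real) \<Rightarrow> bool" where
  "weak_dt \<Omega> T v g \<longleftrightarrow>
     (\<forall>K. compact K \<and> K \<subseteq> \<Omega> \<times> {0<..<T} \<longrightarrow>
         integrable (lebesgue_on K) (\<lambda>p. v (snd p) (fst p)) \<and> integrable (lebesgue_on K) g) \<and>
     (\<forall>\<phi>. Cinf_c \<phi> \<and> supp \<phi> \<subseteq> \<Omega> \<times> {0<..<T} \<longrightarrow>
         (\<integral>p. v (snd p) (fst p) * dtime \<phi> p \<partial>lebesgue_on (\<Omega> \<times> {0<..<T}))
           = - (\<integral>p. g p * \<phi> p \<partial>lebesgue_on (\<Omega> \<times> {0<..<T})))"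

definition var_sol :: "real \<Rightarrow> ('a::euclidean_space \<Rightarrow> real \<Rightarrow> real) \<Rightarrow> 'a set \<Rightarrow> ('a \<Rightarrow> real)
    \<Rightarrow> real \<Rightarrow> (real \<Rightarrow> 'a \<Rightarrow> real) \<Rightarrow> bool" where
  "var_sol \<alpha> R \<Omega> u0 T u \<longleftrightarrow>
     L1w \<alpha> \<Omega> u0 T u \<and> C0L2 \<Omega> T u \<and>
     (\<forall>v g. L1w \<alpha> \<Omega> u0 T v \<and> weak_dt \<Omega> T v g \<and> L2on (\<Omega> \<times> {0<..<T}) g \<and>
            L2on \<Omega> (v 0) \<and> C0L2 \<Omega> T v \<longrightarrow>
        enn2ereal (\<integral>\<^sup>+ t\<in>{0..T}. FG \<alpha> R \<Omega> (u t) \<partial>lebesgue)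
          \<le> ereal (\<integral>p. g p * (v (snd p) (fst p) - u (snd p) (fst p)) \<partial>lebesgue_on (\<Omega> \<times> {0<..<T}))
             + enn2ereal (\<integral>\<^sup>+ t\<in>{0..T}. FG \<alpha> R \<Omega> (v t) \<partial>lebesgue)
             - ereal (1/2 * L2dist2 \<Omega> (v T) (u T))
             + ereal (1/2 * L2dist2 \<Omega> (v 0) u0))"

definition global_var_sol :: "real \<Rightarrow> ('a::euclidean_space \<Rightarrow> real \<Rightarrow> real) \<Rightarrow> 'a set \<Rightarrow> ('a \<Rightarrow> real)
    \<Rightarrow> (real \<Rightarrow> 'a \<Rightarrow> real) \<Rightarrow> bool" where
  "global_var_sol \<alpha> R \<Omega> u0 u \<longleftrightarrow> (\<forall>T>0. var_sol \<alpha> R \<Omega> u0 T u)"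

end

theory Submission
  imports Defs
begin

text \<open>
  Fix times $0 = a_0 < \dots < a_{n+1} = T$ and test the variational inequality with functions that
  equal $w_0 = u_0$ on $[a_0, a_1]$ and $w_k = u(a_k)$ on $[a_k, a_{k+1}]$, up to short linear ramps.
  Since the energy is convex, letting the ramps shrink gives
  \[ \int_0^T F(u) + \frac12 \sum_{k<n} \|w_{k+1} - w_k\|^2 \le \sum_{k \le n} (a_{k+1} - a_k)\, F(w_k). \]
  On an equidistant grid of width $\tau$ that is shifted by $\theta \in (0, \tau)$, the average of the
  right-hand side over $\theta$ is at most $\tau F(u_0)/2 + \int_0^T F(u)$. Hence some shifted grid
  satisfies $\sum_k \|u(a_{k+1}) - u(a_k)\|^2 \le \tau (F(u_0) + \delta)$. As $\tau \to 0$ this bounds the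
  quadratic variation on every grid, which yields the Hoelder estimate and the weak derivative
  together with its sharp energy bound. Extending the last value $w_n$ up to time $T$ instead
  shows that the mean of $F(u)$ over $[s, T]$ does not increase in $s$.
\<close>

subsection \<open>Square integrable functions\<close>

text \<open>The obstacle is that \<open>u\<close> cannot serve as its own competitor: at the start
  no time derivative is known, and F(u(t)) is only lower semicontinuous in t and may be infinite at
  single times, so the energies on one fixed grid are out of control. Averaging over \<theta> turns
  these point values into the integral of F(u), which is finite and cancels against the left-hand
  side. Only F(u_0) on the first cell survives; the mean length \<tau>/2 of that cell matches the
  factor 1/2 in front of the squares, and this is why the bound is F(u_0) without loss. The good
  shift is not explicit. A prescribed grid is reached by splitting its cells into many small steps,
  applying the Cauchy-Schwarz inequality to them, and letting the shift tend to 0 by continuity of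
  \<open>u\<close> in L2. On dyadic grids the difference quotients have orthogonal increments, so
  their bounded norms force strong convergence. The energy bound concerns every weak derivative;
  this calls for uniqueness, and thus for smooth bump functions.\<close>

definition sq_int :: "'b measure \<Rightarrow> ('b \<Rightarrow> real) \<Rightarrow> bool" where
  "sq_int M f \<longleftrightarrow> f \<in> borel_measurable M \<and> integrable M (\<lambda>x. (f x)\<^sup>2)"

text \<open>A seminorm on functions instead of a norm on classes, because \<open>u t\<close> is a
  function at every single time. If the square is not integrable, the Bochner integral has its
  default value 0, so norm estimates carry \<open>sq_int\<close> as a hypothesis. The measure is a
  parameter because both \<Omega> and the space-time cylinder occur.\<close>

definition nrm2 :: "'b measure \<Rightarrow> ('b \<Rightarrow> real) \<Rightarrow> real" where
  "nrm2 M f = sqrt (\<integral>x. (f x)\<^sup>2 \<partial>M)"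

lemma sq_int_measurable[measurable_dest]: "sq_int M f \<Longrightarrow> f \<in> borel_measurable M"
  by (simp add: sq_int_def)

lemma sq_int_prod:
  assumes "sq_int M f" "sq_int M g"
  shows "integrable M (\<lambda>x. f x * g x)"
proof (rule Bochner_Integration.integrable_bound)
  show "integrable M (\<lambda>x. (f x)\<^sup>2 + (g x)\<^sup>2)"
    using assms by (auto simp: sq_int_def)
  show "(\<lambda>x. f x * g x) \<in> borel_measurable M"
    using assms by (auto simp: sq_int_def)
  have "\<bar>f x * g x\<bar> \<le> (f x)\<^sup>2 + (g x)\<^sup>2" for x
  proof -
    have "2 * \<bar>f x\<bar> * \<bar>g x\<bar> \<le> \<bar>f x\<bar>\<^sup>2 + \<bar>g x\<bar>\<^sup>2" by (rule sum_squares_bound)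
    moreover have "0 \<le> \<bar>f x\<bar> * \<bar>g x\<bar>" by simp
    ultimately show ?thesis unfolding abs_mult power2_abs by linarith
  qed
  then show "AE x in M. norm (f x * g x) \<le> norm ((f x)\<^sup>2 + (g x)\<^sup>2)"
    by (auto intro!: AE_I2)
qed

lemma sq_int_cmult: "sq_int M f \<Longrightarrow> sq_int M (\<lambda>x. c * f x)"
  by (auto simp: sq_int_def power_mult_distrib)

lemma sq_int_add:
  assumes "sq_int M f" "sq_int M g"
  shows "sq_int M (\<lambda>x. f x + g x)"
  using assms sq_int_prod[OF assms]
  by (auto simp: sq_int_def power2_sum mult.assoc)

lemma sq_int_diff:
  assumes "sq_int M f" "sq_int M g"
  shows "sq_int M (\<lambda>x. f x - g x)"
  using sq_int_add[OF assms(1) sq_int_cmult[OF assms(2), of "-1"]] by simp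

lemma sq_int_zero: "sq_int M (\<lambda>x. 0)"
  by (simp add: sq_int_def)

lemma sq_int_sum:
  assumes "\<And>i. i \<in> I \<Longrightarrow> sq_int M (f i)"
  shows "sq_int M (\<lambda>x. \<Sum>i\<in>I. f i x)"
  using assms by (induction I rule: infinite_finite_induct) (auto intro: sq_int_add sq_int_zero)

lemma nrm2_sq: "(nrm2 M f)\<^sup>2 = (\<integral>x. (f x)\<^sup>2 \<partial>M)"
  unfolding nrm2_def by simp

lemma nrm2_nonneg: "0 \<le> nrm2 M f"
  unfolding nrm2_def by simp

lemma nrm2_minus: "nrm2 M (\<lambda>x. f x - g x) = nrm2 M (\<lambda>x. g x - f x)"
  unfolding nrm2_def by (simp add: power2_commute)

lemma nrm2_cmult: "nrm2 M (\<lambda>x. c * f x) = \<bar>c\<bar> * nrm2 M f"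
  unfolding nrm2_def by (simp add: power_mult_distrib real_sqrt_mult)

lemma L2_Cauchy_Schwarz:
  assumes f: "sq_int M f" and g: "sq_int M g"
  shows "\<bar>\<integral>x. f x * g x \<partial>M\<bar> \<le> nrm2 M f * nrm2 M g"
proof -
  let ?a = "\<integral>x. (f x)\<^sup>2 \<partial>M" and ?b = "\<integral>x. f x * g x \<partial>M" and ?c = "\<integral>x. (g x)\<^sup>2 \<partial>M"
  have q: "0 \<le> ?a + 2 * t * ?b + t\<^sup>2 * ?c" for t
  proof -
    have "0 \<le> (\<integral>x. (f x + t * g x)\<^sup>2 \<partial>M)" by simp
    also have "(\<lambda>x. (f x + t * g x)\<^sup>2) = (\<lambda>x. (f x)\<^sup>2 + 2 * t * (f x * g x) + t\<^sup>2 * (g x)\<^sup>2)"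
      by (auto simp: power2_eq_square algebra_simps)
    also have "(\<integral>x. (f x)\<^sup>2 + 2 * t * (f x * g x) + t\<^sup>2 * (g x)\<^sup>2 \<partial>M) = ?a + 2 * t * ?b + t\<^sup>2 * ?c"
      using f g sq_int_prod[OF f g] by (simp add: sq_int_def)
    finally show ?thesis .
  qed
  have c0: "0 \<le> ?c" and a0: "0 \<le> ?a" by simp_all
  have "?b\<^sup>2 \<le> ?a * ?c"
  proof (cases "?c = 0")
    case True
    have "?b = 0"
    proof (rule ccontr)
      assume nz: "?b \<noteq> 0"
      \<comment> \<open>With \<open>?c = 0\<close> the quadratic is affine in \<open>t\<close>, and
        this \<open>t\<close> gives it the value -1.\<close>
      have "2 * (-(?a + 1) / (2 * ?b)) * ?b = -(?a + 1)" using nz by (simp add: field_simps)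
      with q[of "-(?a + 1) / (2 * ?b)"] True show False by simp
    qed
    with True show ?thesis by simp
  next
    case False
    then have c: "0 < ?c" using c0 by linarith
    have "0 \<le> ?a + 2 * (-?b/?c) * ?b + (-?b/?c)\<^sup>2 * ?c" by (rule q)
    also have "\<dots> = ?a - ?b\<^sup>2 / ?c" using c by (simp add: power2_eq_square field_simps)
    finally show ?thesis using c by (simp add: field_simps)
  qed
  then have "sqrt (?b\<^sup>2) \<le> sqrt (?a * ?c)" by (rule real_sqrt_le_mono)
  then show ?thesis unfolding nrm2_def by (simp add: real_sqrt_mult)
qed

lemma nrm2_triangle:
  assumes f: "sq_int M f" and g: "sq_int M g"
  shows "nrm2 M (\<lambda>x. f x + g x) \<le> nrm2 M f + nrm2 M g"
proof (rule power2_le_imp_le)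
  have "(nrm2 M (\<lambda>x. f x + g x))\<^sup>2 = (\<integral>x. (f x)\<^sup>2 + 2 * (f x * g x) + (g x)\<^sup>2 \<partial>M)"
    unfolding nrm2_sq by (rule Bochner_Integration.integral_cong) (auto simp: power2_eq_square algebra_simps)
  also have "\<dots> = (nrm2 M f)\<^sup>2 + 2 * (\<integral>x. f x * g x \<partial>M) + (nrm2 M g)\<^sup>2"
    unfolding nrm2_sq using f g sq_int_prod[OF f g] by (simp add: sq_int_def)
  also have "\<dots> \<le> (nrm2 M f + nrm2 M g)\<^sup>2"
    using L2_Cauchy_Schwarz[OF f g] by (simp add: power2_eq_square algebra_simps)
  finally show "(nrm2 M (\<lambda>x. f x + g x))\<^sup>2 \<le> (nrm2 M f + nrm2 M g)\<^sup>2" .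
qed (simp add: nrm2_nonneg)

lemma nrm2_triangle_diff:
  assumes f: "sq_int M f" and g: "sq_int M g" and h: "sq_int M h"
  shows "nrm2 M (\<lambda>x. f x - h x) \<le> nrm2 M (\<lambda>x. f x - g x) + nrm2 M (\<lambda>x. g x - h x)"
  using nrm2_triangle[OF sq_int_diff[OF f g] sq_int_diff[OF g h]] by simp

lemma nrm2_dist_tendsto:
  assumes "\<And>i. sq_int M (f i)" "\<And>i. sq_int M (g i)" "sq_int M a" "sq_int M b"
    and "((\<lambda>i. nrm2 M (\<lambda>x. f i x - a x)) \<longlongrightarrow> 0) F" "((\<lambda>i. nrm2 M (\<lambda>x. g i x - b x)) \<longlongrightarrow> 0) F"
  shows "((\<lambda>i. nrm2 M (\<lambda>x. f i x - g i x)) \<longlongrightarrow> nrm2 M (\<lambda>x. a x - b x)) F"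
proof (rule Lim_null_comparison[THEN LIM_zero_cancel])
  show "((\<lambda>i. nrm2 M (\<lambda>x. f i x - a x) + nrm2 M (\<lambda>x. g i x - b x)) \<longlongrightarrow> 0) F"
    using tendsto_add[OF assms(5,6)] by simp
  have "norm (nrm2 M (\<lambda>x. f i x - g i x) - nrm2 M (\<lambda>x. a x - b x))
      \<le> nrm2 M (\<lambda>x. f i x - a x) + nrm2 M (\<lambda>x. g i x - b x)" for i
    using nrm2_triangle_diff[OF assms(1)[of i] assms(3) assms(2)[of i]]
      nrm2_triangle_diff[OF assms(3,4) assms(2)[of i]]
      nrm2_triangle_diff[OF assms(3) assms(1)[of i] assms(4)]
      nrm2_triangle_diff[OF assms(1)[of i] assms(2)[of i] assms(4)]
      nrm2_minus[of M a "f i"] nrm2_minus[of M b "g i"]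
    unfolding real_norm_def by linarith
  then show "\<forall>\<^sub>F i in F. norm (nrm2 M (\<lambda>x. f i x - g i x) - nrm2 M (\<lambda>x. a x - b x))
      \<le> nrm2 M (\<lambda>x. f i x - a x) + nrm2 M (\<lambda>x. g i x - b x)" by simp
qed

lemma nrm2_diff_sq:
  assumes "sq_int M f" "sq_int M g"
  shows "(nrm2 M (\<lambda>x. f x - g x))\<^sup>2 = (nrm2 M f)\<^sup>2 - 2 * (\<integral>x. f x * g x \<partial>M) + (nrm2 M g)\<^sup>2"
proof -
  have "(nrm2 M (\<lambda>x. f x - g x))\<^sup>2 = (\<integral>x. (f x)\<^sup>2 - 2 * (f x * g x) + (g x)\<^sup>2 \<partial>M)"
    unfolding nrm2_sq by (rule Bochner_Integration.integral_cong) (auto simp: power2_eq_square algebra_simps)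
  also have "\<dots> = (nrm2 M f)\<^sup>2 - 2 * (\<integral>x. f x * g x \<partial>M) + (nrm2 M g)\<^sup>2"
    unfolding nrm2_sq using assms sq_int_prod[OF assms] by (simp add: sq_int_def)
  finally show ?thesis .
qed

lemma L2_inner_tendsto:
  assumes "\<And>i. sq_int M (f i)" "sq_int M a" "sq_int M h"
    and "((\<lambda>i. nrm2 M (\<lambda>x. f i x - a x)) \<longlongrightarrow> 0) F"
  shows "((\<lambda>i. \<integral>x. h x * f i x \<partial>M) \<longlongrightarrow> (\<integral>x. h x * a x \<partial>M)) F"
proof (rule Lim_null_comparison[THEN LIM_zero_cancel])
  show "((\<lambda>i. nrm2 M h * nrm2 M (\<lambda>x. f i x - a x)) \<longlongrightarrow> 0) F"
    using tendsto_mult_left[OF assms(4), of "nrm2 M h"] by simp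
  have "norm ((\<integral>x. h x * f i x \<partial>M) - (\<integral>x. h x * a x \<partial>M)) \<le> nrm2 M h * nrm2 M (\<lambda>x. f i x - a x)" for i
  proof -
    have "(\<integral>x. h x * f i x \<partial>M) - (\<integral>x. h x * a x \<partial>M) = (\<integral>x. h x * (f i x - a x) \<partial>M)"
      using sq_int_prod[OF assms(3) assms(1)] sq_int_prod[OF assms(3,2)]
      by (simp add: right_diff_distrib)
    then show ?thesis using L2_Cauchy_Schwarz[OF assms(3) sq_int_diff[OF assms(1,2)]] by simp
  qed
  then show "\<forall>\<^sub>F i in F. norm ((\<integral>x. h x * f i x \<partial>M) - (\<integral>x. h x * a x \<partial>M)) \<le> nrm2 M h * nrm2 M (\<lambda>x. f i x - a x)"
    by simp
qed

lemma (in finite_measure) sq_int_const: "sq_int M (\<lambda>x. c)"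
  by (simp add: sq_int_def)

lemma (in finite_measure) sq_int_integrable:
  "sq_int M f \<Longrightarrow> integrable M f"
  using sq_int_prod[OF _ sq_int_const[of 1]] by simp

lemma (in finite_measure) L1_le_nrm2:
  assumes "sq_int M f"
  shows "(\<integral>x. \<bar>f x\<bar> \<partial>M) \<le> sqrt (measure M (space M)) * nrm2 M f"
proof -
  have a: "sq_int M (\<lambda>x. \<bar>f x\<bar>)" using assms by (auto simp: sq_int_def)
  have "(\<integral>x. 1 * \<bar>f x\<bar> \<partial>M) \<le> nrm2 M (\<lambda>x. 1) * nrm2 M (\<lambda>x. \<bar>f x\<bar>)"
    using L2_Cauchy_Schwarz[OF sq_int_const[of 1] a] by simp
  then show ?thesis by (simp add: nrm2_def)
qed

lemma nrm2_le_if_nn_integral_le: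
  assumes "f \<in> borel_measurable M" "(\<integral>\<^sup>+x. ennreal ((f x)\<^sup>2) \<partial>M) \<le> ennreal (c\<^sup>2)" "0 \<le> c"
  shows "sq_int M f" "nrm2 M f \<le> c"
proof -
  have i: "integrable M (\<lambda>x. (f x)\<^sup>2)"
    using assms by (intro integrableI_bounded) (auto simp: less_top[symmetric] top_unique intro: le_less_trans)
  then show "sq_int M f" using assms by (simp add: sq_int_def)
  have "ennreal (\<integral>x. (f x)\<^sup>2 \<partial>M) \<le> ennreal (c\<^sup>2)"
    using assms(2) nn_integral_eq_integral[OF i] by simp
  then have "(\<integral>x. (f x)\<^sup>2 \<partial>M) \<le> c\<^sup>2" by (simp add: ennreal_le_iff)
  then show "nrm2 M f \<le> c" unfolding nrm2_def using assms(3) by (simp add: real_le_lsqrt)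
qed

lemma nn_integral_sq_eq_nrm2:
  assumes "sq_int M f"
  shows "(\<integral>\<^sup>+x. ennreal ((f x)\<^sup>2) \<partial>M) = ennreal ((nrm2 M f)\<^sup>2)"
  unfolding nrm2_sq using assms by (intro nn_integral_eq_integral) (auto simp: sq_int_def)

text \<open>Riesz-Fischer: along a subsequence the increments are geometrically small in L2, hence
  in L1 since the measure is finite, so they are summable almost everywhere. Fatou's lemma along
  that subsequence then bounds the distance of every term of the whole sequence to the
  limit.\<close>

lemma (in finite_measure) L2_complete:
  assumes s: "\<And>n. sq_int M (f n)"
    and c: "\<And>e. 0 < e \<Longrightarrow> \<exists>N. \<forall>m\<ge>N. \<forall>n\<ge>N. nrm2 M (\<lambda>x. f m x - f n x) \<le> e"
  obtains g where "sq_int M g" "(\<lambda>n. nrm2 M (\<lambda>x. f n x - g x)) \<longlonglongrightarrow> 0"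
proof -
  have "\<forall>k. \<exists>N. \<forall>m\<ge>N. \<forall>n\<ge>N. nrm2 M (\<lambda>x. f m x - f n x) \<le> (1/2)^k"
    using c by simp
  then obtain N where N: "\<And>k m n. m \<ge> N k \<Longrightarrow> n \<ge> N k \<Longrightarrow> nrm2 M (\<lambda>x. f m x - f n x) \<le> (1/2)^k"
    by metis
  \<comment> \<open>The partial sum dominates \<open>N k\<close>, and the summand \<open>k\<close>
    forces the index to infinity even where \<open>N\<close> vanishes.\<close>
  define r where "r k = (\<Sum>i\<le>k. N i) + k" for k
  have rN: "N k \<le> r k" for k
    unfolding r_def using member_le_sum[of k "{..k}" N] by simp
  have rS: "r k \<le> r (Suc k)" for k unfolding r_def by simp
  have rk: "k \<le> r k" for k unfolding r_def by simp
  let ?d = "\<lambda>k x. f (r (Suc k)) x - f (r k) x"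
  have sd: "sq_int M (?d k)" for k by (intro sq_int_diff s)
  have dle: "nrm2 M (?d k) \<le> (1/2)^k" for k
    using N[of k "r (Suc k)" "r k"] rN[of k] rS[of k] by simp
  have id: "integrable M (?d k)" for k by (rule sq_int_integrable[OF sd])
  have [measurable]: "?d k \<in> borel_measurable M" for k using sd by (simp add: sq_int_def)
  let ?m = "sqrt (measure M (space M))"
  have "(\<integral>\<^sup>+x. (\<Sum>k. ennreal \<bar>?d k x\<bar>) \<partial>M) = (\<Sum>k. \<integral>\<^sup>+x. ennreal \<bar>?d k x\<bar> \<partial>M)"
    by (intro nn_integral_suminf) simp
  also have "\<dots> = (\<Sum>k. ennreal (\<integral>x. \<bar>?d k x\<bar> \<partial>M))"
    using id by (simp add: nn_integral_eq_integral)
  also have "\<dots> \<le> (\<Sum>k. ennreal (?m * (1/2)^k))"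
  proof (rule suminf_le)
    show "ennreal (\<integral>x. \<bar>?d k x\<bar> \<partial>M) \<le> ennreal (?m * (1/2)^k)" for k
      by (intro ennreal_leI order_trans[OF L1_le_nrm2[OF sd]] mult_left_mono dle) simp
  qed simp_all
  also have "\<dots> = ennreal (\<Sum>k. ?m * (1/2)^k)"
    by (intro suminf_ennreal2 summable_mult) (auto simp: summable_geometric)
  also have "\<dots> < \<infinity>" by simp
  finally have "(\<integral>\<^sup>+x. (\<Sum>k. ennreal \<bar>?d k x\<bar>) \<partial>M) \<noteq> \<infinity>" by simp
  then have "AE x in M. (\<Sum>k. ennreal \<bar>?d k x\<bar>) \<noteq> \<infinity>"
    by (intro nn_integral_PInf_AE) simp
  then have ae: "AE x in M. (\<lambda>k. f (r k) x) \<longlonglongrightarrow> lim (\<lambda>k. f (r k) x)"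
  proof (rule AE_mp, intro AE_I2 impI)
    fix x assume "(\<Sum>k. ennreal \<bar>?d k x\<bar>) \<noteq> \<infinity>"
    then have "summable (\<lambda>k. \<bar>?d k x\<bar>)"
      by (intro summable_suminf_not_top) auto
    then have "summable (\<lambda>k. ?d k x)" by (rule summable_rabs_cancel)
    then have "convergent (\<lambda>n. \<Sum>k<n. ?d k x)" by (simp add: summable_iff_convergent)
    then have "convergent (\<lambda>n. (\<Sum>k<n. ?d k x) + f (r 0) x)"
      by (intro convergent_add convergent_const)
    then have "convergent (\<lambda>n. f (r n) x)"
      by (simp add: sum_lessThan_telescope[where f="\<lambda>k. f (r k) x"])
    then show "(\<lambda>k. f (r k) x) \<longlonglongrightarrow> lim (\<lambda>k. f (r k) x)"
      by (simp add: convergent_LIMSEQ_iff)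
  qed
  define g where "g x = lim (\<lambda>k. f (r k) x)" for x
  have [measurable]: "f n \<in> borel_measurable M" for n using s by (simp add: sq_int_def)
  have gm[measurable]: "g \<in> borel_measurable M"
    unfolding g_def by (rule borel_measurable_lim_metric) simp
  have fat: "sq_int M (\<lambda>x. f n x - g x) \<and> nrm2 M (\<lambda>x. f n x - g x) \<le> e"
    if e: "0 < e" and n: "\<And>m. n0 \<le> m \<Longrightarrow> nrm2 M (\<lambda>x. f n x - f m x) \<le> e" for n n0 e
  proof -
    have "(\<integral>\<^sup>+x. ennreal ((f n x - g x)\<^sup>2) \<partial>M) = (\<integral>\<^sup>+x. liminf (\<lambda>k. ennreal ((f n x - f (r k) x)\<^sup>2)) \<partial>M)"
    proof (rule nn_integral_cong_AE, rule AE_mp[OF ae], intro AE_I2 impI)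
      fix x assume "(\<lambda>k. f (r k) x) \<longlonglongrightarrow> lim (\<lambda>k. f (r k) x)"
      then have "(\<lambda>k. ennreal ((f n x - f (r k) x)\<^sup>2)) \<longlonglongrightarrow> ennreal ((f n x - g x)\<^sup>2)"
        unfolding g_def by (intro tendsto_ennrealI tendsto_intros)
      then show "ennreal ((f n x - g x)\<^sup>2) = liminf (\<lambda>k. ennreal ((f n x - f (r k) x)\<^sup>2))"
        by (intro lim_imp_Liminf[symmetric]) simp_all
    qed
    also have "\<dots> \<le> liminf (\<lambda>k. \<integral>\<^sup>+x. ennreal ((f n x - f (r k) x)\<^sup>2) \<partial>M)"
      by (rule nn_integral_liminf) simp
    also have "\<dots> \<le> ennreal (e\<^sup>2)"
    proof (rule Liminf_le)
      show "\<forall>\<^sub>F k in sequentially. (\<integral>\<^sup>+x. ennreal ((f n x - f (r k) x)\<^sup>2) \<partial>M) \<le> ennreal (e\<^sup>2)"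
        using eventually_ge_at_top[of n0]
      proof eventually_elim
        case (elim k)
        then have "nrm2 M (\<lambda>x. f n x - f (r k) x) \<le> e" using n[of "r k"] rk[of k] by simp
        then show ?case
          unfolding nn_integral_sq_eq_nrm2[OF sq_int_diff[OF s s]]
          by (intro ennreal_leI power_mono nrm2_nonneg)
      qed
    qed simp
    finally show ?thesis using nrm2_le_if_nn_integral_le[of "\<lambda>x. f n x - g x" M e] e by simp
  qed
  have gs: "sq_int M g"
  proof -
    from c[of 1] obtain n0 where "\<forall>m\<ge>n0. nrm2 M (\<lambda>x. f n0 x - f m x) \<le> 1" by auto
    with fat[of 1 n0 n0] have "sq_int M (\<lambda>x. f n0 x - g x)" by auto
    from sq_int_diff[OF s[of n0] this] show ?thesis by simp
  qed
  have "(\<lambda>n. nrm2 M (\<lambda>x. f n x - g x)) \<longlonglongrightarrow> 0"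
  proof (rule LIMSEQ_I)
    fix e :: real assume e: "0 < e"
    from c[of "e/2"] e obtain n0 where "\<forall>m\<ge>n0. \<forall>n\<ge>n0. nrm2 M (\<lambda>x. f m x - f n x) \<le> e/2" by auto
    then have "nrm2 M (\<lambda>x. f n x - g x) \<le> e/2" if "n \<ge> n0" for n
      using fat[of "e/2" n0 n] e that by auto
    then have "norm (nrm2 M (\<lambda>x. f n x - g x) - 0) < e" if "n \<ge> n0" for n
      using that e nrm2_nonneg[of M "\<lambda>x. f n x - g x"] by fastforce
    then show "\<exists>no. \<forall>n\<ge>no. norm (nrm2 M (\<lambda>x. f n x - g x) - 0) < e" by blast
  qed
  with gs show thesis by (rule that)
qed

subsection \<open>Tonelli and Fubini for Lebesgue measure on a product\<close>

text \<open>A Borel map need not be measurable between completions; it is as soon as preimages of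
  null sets are null. The two coordinate projections are the intended instances.\<close>

lemma lebesgue_measurable_compose:
  fixes \<pi> :: "'c::euclidean_space \<Rightarrow> 'd::euclidean_space" and f :: "'d \<Rightarrow> 'e::topological_space"
  assumes \<pi>: "\<pi> \<in> borel_measurable borel"
    and null: "\<And>A. A \<in> null_sets lborel \<Longrightarrow> \<pi> -` A \<in> null_sets lborel"
    and f: "f \<in> borel_measurable lebesgue"
  shows "(\<lambda>p. f (\<pi> p)) \<in> borel_measurable lebesgue"
proof -
  have "\<pi> \<in> lebesgue \<rightarrow>\<^sub>M lebesgue"
  proof (rule completion.measurable_completion2)
    show m: "\<pi> \<in> lebesgue \<rightarrow>\<^sub>M lborel" using \<pi> by (intro measurable_completion) simp
    show "null_sets lborel \<subseteq> null_sets (distr lebesgue lborel \<pi>)"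
    proof
      fix A :: "'d set" assume A: "A \<in> null_sets lborel"
      then have "\<pi> -` A \<in> null_sets lebesgue" by (intro null_sets_completionI null)
      with A show "A \<in> null_sets (distr lebesgue lborel \<pi>)"
        using m by (auto simp: null_sets_def emeasure_distr)
    qed
  qed
  from measurable_compose[OF this f] show ?thesis .
qed

lemma
  fixes f :: "'a::euclidean_space \<Rightarrow> 'c::topological_space"
  assumes "f \<in> borel_measurable lebesgue"
  shows lebesgue_measurable_vimage_fst:
      "(\<lambda>p. f (fst p)) \<in> borel_measurable (lebesgue :: ('a::euclidean_space \<times> 'b::euclidean_space) measure)"
    and lebesgue_measurable_vimage_snd:
      "(\<lambda>p. f (snd p)) \<in> borel_measurable (lebesgue :: ('b::euclidean_space \<times> 'a::euclidean_space) measure)"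
proof -
  have "A \<times> (UNIV :: 'b set) \<in> null_sets (lborel \<Otimes>\<^sub>M lborel)"
    "(UNIV :: 'b set) \<times> A \<in> null_sets (lborel \<Otimes>\<^sub>M lborel)" if "A \<in> null_sets lborel" for A :: "'a set"
    using that lborel.emeasure_pair_measure_Times[of A lborel "UNIV::'b set"]
      lborel.emeasure_pair_measure_Times[of "UNIV::'b set" lborel A]
    by (auto simp: null_sets_def)
  then have n: "A \<times> (UNIV :: 'b set) \<in> null_sets lborel" "(UNIV :: 'b set) \<times> A \<in> null_sets lborel"
    if "A \<in> null_sets lborel" for A :: "'a set"
    using that unfolding lborel_prod by blast+
  have v: "fst -` A = A \<times> (UNIV :: 'b set)" "snd -` A = (UNIV :: 'b set) \<times> A" for A :: "'a set" by auto
  show "(\<lambda>p. f (fst p)) \<in> borel_measurable (lebesgue :: ('a \<times> 'b) measure)"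
    "(\<lambda>p. f (snd p)) \<in> borel_measurable (lebesgue :: ('b \<times> 'a) measure)"
    by (rule lebesgue_measurable_compose[OF _ _ assms];
        simp add: v n borel_measurable_continuous_onI continuous_on_fst continuous_on_snd continuous_on_id)+
qed

text \<open>The product rule for almost-everywhere statements yields the other order of the two
  quantifiers. Enlarging the exceptional set to a Borel null set makes the predicate measurable, as
  exchanging them requires.\<close>

lemma AE_lborel_sections:
  fixes P :: "'a::euclidean_space \<times> 'b::euclidean_space \<Rightarrow> bool"
  assumes "AE p in lborel. P p"
  shows "AE y in lborel. AE x in lborel. P (x, y)"
proof -
  from assms obtain N where N: "{p. \<not> P p} \<subseteq> N" "N \<in> null_sets lborel"
    by (auto simp: eventually_ae_filter)
  have Ns: "N \<in> sets (lborel \<Otimes>\<^sub>M lborel)" using N unfolding lborel_prod null_sets_def by simp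
  have "AE p in (lborel \<Otimes>\<^sub>M lborel). p \<notin> N"
    using N by (simp add: lborel_prod AE_not_in)
  then have "AE x in lborel. AE y in lborel. (x, y) \<notin> N" by (rule lborel_pair.AE_pair)
  moreover have "{p \<in> space (lborel \<Otimes>\<^sub>M lborel). (fst p, snd p) \<notin> N} \<in> sets (lborel \<Otimes>\<^sub>M lborel)"
  proof -
    have "{p \<in> space (lborel \<Otimes>\<^sub>M lborel). (fst p, snd p) \<notin> N} = space (lborel \<Otimes>\<^sub>M lborel) - N" by auto
    then show ?thesis using sets.compl_sets[OF Ns] by simp
  qed
  ultimately have "AE y in lborel. AE x in lborel. (x, y) \<notin> N"
    using lborel_pair.AE_commute[of "\<lambda>x y. (x, y) \<notin> N"] by simp
  then show ?thesis
  proof eventually_elim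
    case (elim y)
    then show ?case by eventually_elim (use N(1) in auto)
  qed
qed

text \<open>Lebesgue measure on a product is the completion of the product measure, so a section of
  \<open>h\<close> can fail to be measurable for exceptional \<open>y\<close>. The product theorem
  is applied to a Borel representative \<open>H\<close>, whose sections agree with those of
  \<open>h\<close> for almost every \<open>y\<close>.\<close>

lemma lebesgue_Tonelli:
  fixes h :: "'a::euclidean_space \<times> 'b::euclidean_space \<Rightarrow> ennreal"
  assumes h: "h \<in> borel_measurable lebesgue"
  shows "(\<integral>\<^sup>+p. h p \<partial>lebesgue) = (\<integral>\<^sup>+y. (\<integral>\<^sup>+x. h (x, y) \<partial>lebesgue) \<partial>lebesgue)"
proof -
  from completion_ex_borel_measurable[OF h] obtain H where
    H: "H \<in> borel_measurable lborel" and ae: "AE p in lborel. h p = H p" by auto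
  have H': "H \<in> borel_measurable (lborel \<Otimes>\<^sub>M lborel)" using H by (simp add: lborel_prod)
  have eq: "AE y in lborel. (\<integral>\<^sup>+x. H (x, y) \<partial>lborel) = (\<integral>\<^sup>+x. h (x, y) \<partial>lebesgue)"
    using AE_lborel_sections[OF ae]
  proof eventually_elim
    case (elim y)
    then have "AE x in lborel. H (x, y) = h (x, y)" by eventually_elim simp
    then show ?case unfolding nn_integral_completion by (rule nn_integral_cong_AE)
  qed
  have "(\<integral>\<^sup>+p. h p \<partial>lebesgue) = (\<integral>\<^sup>+p. H p \<partial>lborel)"
    unfolding nn_integral_completion by (rule nn_integral_cong_AE[OF ae])
  also have "\<dots> = (\<integral>\<^sup>+p. H p \<partial>(lborel \<Otimes>\<^sub>M lborel))" by (simp add: lborel_prod)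
  also have "\<dots> = (\<integral>\<^sup>+y. (\<integral>\<^sup>+x. H (x, y) \<partial>lborel) \<partial>lborel)"
    by (rule lborel_pair.nn_integral_snd[OF H', symmetric])
  also have "\<dots> = (\<integral>\<^sup>+y. (\<integral>\<^sup>+x. h (x, y) \<partial>lebesgue) \<partial>lebesgue)"
    unfolding nn_integral_completion[of lborel "\<lambda>y. \<integral>\<^sup>+x. h (x, y) \<partial>lebesgue"]
    by (rule nn_integral_cong_AE[OF eq])
  finally show ?thesis .
qed

lemma iterated_integral_completion:
  fixes k K :: "'a::euclidean_space \<Rightarrow> 'b::euclidean_space \<Rightarrow> real"
  assumes eq: "AE x in lborel. AE y in lborel. k x y = K x y"
    and K: "\<And>x. K x \<in> borel_measurable lborel" "integrable lborel (\<lambda>x. \<integral>y. K x y \<partial>lborel)"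
  shows "(\<integral>x. (\<integral>y. k x y \<partial>lebesgue) \<partial>lebesgue) = (\<integral>x. (\<integral>y. K x y \<partial>lborel) \<partial>lborel)"
proof -
  have "AE x in lborel. (\<integral>y. K x y \<partial>lborel) = (\<integral>y. k x y \<partial>lebesgue)"
    using eq
  proof eventually_elim
    case (elim x)
    then have "AE y in lborel. K x y = k x y" by eventually_elim simp
    then have e: "AE y in lebesgue. K x y = k x y" by (rule AE_completion)
    have "(\<integral>y. K x y \<partial>lborel) = (\<integral>y. K x y \<partial>lebesgue)"
      by (rule integral_completion[symmetric, OF K(1)])
    also have "\<dots> = (\<integral>y. k x y \<partial>lebesgue)"
      by (rule integral_cong_AE[OF measurable_completion[OF K(1)] borel_measurable_AE[OF measurable_completion[OF K(1)] e] e])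
    finally show ?case .
  qed
  then have ae: "AE x in lebesgue. (\<integral>y. K x y \<partial>lborel) = (\<integral>y. k x y \<partial>lebesgue)" by (rule AE_completion)
  have m: "(\<lambda>x. \<integral>y. K x y \<partial>lborel) \<in> borel_measurable lborel" using K(2) by simp
  have "(\<integral>x. (\<integral>y. K x y \<partial>lborel) \<partial>lborel) = (\<integral>x. (\<integral>y. K x y \<partial>lborel) \<partial>lebesgue)"
    by (rule integral_completion[symmetric, OF m])
  also have "\<dots> = (\<integral>x. (\<integral>y. k x y \<partial>lebesgue) \<partial>lebesgue)"
    by (rule integral_cong_AE[OF measurable_completion[OF m] borel_measurable_AE[OF measurable_completion[OF m] ae] ae])
  finally show ?thesis ..
qed

lemma
  fixes h :: "'a::euclidean_space \<times> 'b::euclidean_space \<Rightarrow> real"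
  assumes h: "integrable lebesgue h"
  shows lebesgue_Fubini: "(\<integral>p. h p \<partial>lebesgue) = (\<integral>y. (\<integral>x. h (x, y) \<partial>lebesgue) \<partial>lebesgue)"
    and lebesgue_Fubini_swap: "(\<integral>p. h p \<partial>lebesgue) = (\<integral>x. (\<integral>y. h (x, y) \<partial>lebesgue) \<partial>lebesgue)"
proof -
  from h have "h \<in> borel_measurable lebesgue" by simp
  from completion_ex_borel_measurable_real[OF this] obtain H where
    H: "H \<in> borel_measurable lborel" and ae: "AE p in lborel. h p = H p" by auto
  have ae': "AE p in lebesgue. h p = H p" by (rule AE_completion[OF ae])
  have "integrable lebesgue H"
    using h measurable_completion[OF H] ae' by (rule integrable_cong_AE_imp)
  then have "integrable lborel H" by (simp add: integrable_completion[OF H])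
  then have Hi: "integrable (lborel \<Otimes>\<^sub>M lborel) H" by (simp add: lborel_prod)
  then have Hi': "integrable (lborel \<Otimes>\<^sub>M lborel) (\<lambda>(x, y). H (x, y))" by simp
  have Hm: "H \<in> borel_measurable (lborel \<Otimes>\<^sub>M lborel)" using H by (simp add: lborel_prod)
  have sec: "(\<lambda>x. H (x, y)) \<in> borel_measurable lborel" "(\<lambda>y. H (x, y)) \<in> borel_measurable lborel" for x y
    using measurable_compose[OF measurable_Pair2' Hm] measurable_compose[OF measurable_Pair1' Hm] by simp_all
  have "AE p in (lborel \<Otimes>\<^sub>M lborel). h p = H p" unfolding lborel_prod by (rule ae)
  then have aex: "AE x in lborel. AE y in lborel. h (x, y) = H (x, y)" by (rule lborel_pair.AE_pair)
  have "(\<integral>p. h p \<partial>lebesgue) = (\<integral>p. H p \<partial>lebesgue)"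
    using h measurable_completion[OF H] ae' by (intro integral_cong_AE) auto
  also have "\<dots> = (\<integral>p. H p \<partial>lborel)" by (rule integral_completion[OF H])
  also have "\<dots> = (\<integral>p. H p \<partial>(lborel \<Otimes>\<^sub>M lborel))" by (simp add: lborel_prod)
  finally have e: "(\<integral>p. h p \<partial>lebesgue) = (\<integral>p. H p \<partial>(lborel \<Otimes>\<^sub>M lborel))" .
  show "(\<integral>p. h p \<partial>lebesgue) = (\<integral>y. (\<integral>x. h (x, y) \<partial>lebesgue) \<partial>lebesgue)"
    unfolding e iterated_integral_completion[OF AE_lborel_sections[OF ae] sec(1) lborel_pair.integrable_snd[OF Hi']]
    using lborel_pair.integral_snd[OF Hi'] by simp
  show "(\<integral>p. h p \<partial>lebesgue) = (\<integral>x. (\<integral>y. h (x, y) \<partial>lebesgue) \<partial>lebesgue)"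
    unfolding e iterated_integral_completion[OF aex sec(2) lborel_pair.integrable_fst'[OF Hi]]
    by (rule lborel_pair.integral_fst'[OF Hi, symmetric])
qed

subsection \<open>The Gagliardo divergence of a test function\<close>

text \<open>Dyadic shells: for distances between r/2^(k+1) and r/2^k the kernel |x-y|^(1-N-\<alpha>)
  is largest at the inner radius, its exponent being nonpositive since N \<ge> 1. Multiplied by the
  volume of the outer ball this gives a geometric series of ratio 2^(-(1-\<alpha>)), which converges
  because \<alpha> < 1. The bound does not see the centre \<open>x\<close>.\<close>

lemma nn_integral_singular_kernel_finite:
  fixes x :: "'a::euclidean_space"
  assumes \<alpha>: "0 < \<alpha>" "\<alpha> < 1" and r: "0 < r"
  shows "\<exists>C. \<forall>x::'a. (\<integral>\<^sup>+y. ennreal (norm (x - y) / norm (x - y) powr (real DIM('a) + \<alpha>) * indicator (ball x r) y) \<partial>lborel)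
      \<le> ennreal C"
proof -
  let ?N = "real DIM('a)"
  let ?c = "\<lambda>k::nat. (r / 2 ^ Suc k) powr (1 - \<alpha> - ?N)"
  let ?V = "unit_ball_vol ?N"
  have N1: "1 \<le> ?N" using DIM_positive[where 'a='a] by linarith
  have pw: "norm (x - y) / norm (x - y) powr (?N + \<alpha>) * indicator (ball x r) y
      \<le> (if \<exists>k. y \<in> ball x (r / 2 ^ k) \<and> norm (x - y) / norm (x - y) powr (?N + \<alpha>) \<le> ?c k then
          norm (x - y) / norm (x - y) powr (?N + \<alpha>) else 0)" for x y :: 'a
  proof (cases "y \<in> ball x r \<and> y \<noteq> x")
    case True
    define d where "d = norm (x - y)"
    have d: "0 < d" "d < r" using True by (auto simp: d_def dist_norm)
    have "\<exists>k. r / 2 ^ Suc k \<le> d \<and> d < r / 2 ^ k"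
    proof -
      have "\<exists>n. r / 2 ^ n \<le> d"
      proof -
        obtain n where "r / d < 2 ^ n" using real_arch_pow[of 2 "r/d"] by auto
        then show ?thesis using d by (intro exI[of _ n]) (simp add: field_simps)
      qed
      \<comment> \<open>The least such \<open>n\<close> is positive because d < r, so its
        predecessor is the index of the shell that contains \<open>y\<close>.\<close>
      then obtain n where n: "r / 2 ^ n \<le> d" and nl: "\<And>m. m < n \<Longrightarrow> \<not> r / 2 ^ m \<le> d"
        using exists_least_iff[of "\<lambda>n. r / 2 ^ n \<le> d"] by blast
      have "n \<noteq> 0" using n d by (intro notI) simp
      then obtain k where "n = Suc k" using not0_implies_Suc by blast
      with n nl[of k] show ?thesis by (intro exI[of _ k]) auto
    qed
    then obtain k where k: "r / 2 ^ Suc k \<le> d" "d < r / 2 ^ k" by blast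
    have "d / d powr (?N + \<alpha>) = d powr (1 - \<alpha> - ?N)"
      using d powr_diff[of d 1 "?N + \<alpha>"] by (simp add: algebra_simps)
    also have "\<dots> \<le> ?c k"
    proof (rule powr_mono2')
      show "1 - \<alpha> - ?N \<le> 0" using N1 \<alpha> by linarith
    qed (use k r in auto)
    finally have "\<exists>k. y \<in> ball x (r / 2 ^ k) \<and> norm (x - y) / norm (x - y) powr (?N + \<alpha>) \<le> ?c k"
      using k by (intro exI[of _ k]) (simp add: d_def dist_norm)
    then show ?thesis by (simp add: indicator_def)
  qed (auto simp: indicator_def)
  have "(\<integral>\<^sup>+y. ennreal (norm (x - y) / norm (x - y) powr (?N + \<alpha>) * indicator (ball x r) y) \<partial>lborel)
      \<le> ennreal (\<Sum>k. ?c k * (?V * (r / 2 ^ k) ^ DIM('a)))" for x :: 'a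
  proof -
    have "(\<integral>\<^sup>+y. ennreal (norm (x - y) / norm (x - y) powr (?N + \<alpha>) * indicator (ball x r) y) \<partial>lborel)
       \<le> (\<integral>\<^sup>+y. (\<Sum>k. ennreal (?c k) * indicator (ball x (r / 2 ^ k)) y) \<partial>lborel)"
    proof (rule nn_integral_mono)
      fix y
      show "ennreal (norm (x - y) / norm (x - y) powr (?N + \<alpha>) * indicator (ball x r) y)
        \<le> (\<Sum>k. ennreal (?c k) * indicator (ball x (r / 2 ^ k)) y)"
      proof (cases "\<exists>k. y \<in> ball x (r / 2 ^ k) \<and> norm (x - y) / norm (x - y) powr (?N + \<alpha>) \<le> ?c k")
        case True
        then obtain k where k: "y \<in> ball x (r / 2 ^ k)" "norm (x - y) / norm (x - y) powr (?N + \<alpha>) \<le> ?c k" by blast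
        have "ennreal (norm (x - y) / norm (x - y) powr (?N + \<alpha>) * indicator (ball x r) y) \<le> ennreal (?c k) * indicator (ball x (r / 2 ^ k)) y"
          using order_trans[OF pw[of x y]] True k by (auto intro!: ennreal_leI)
        also have "\<dots> \<le> (\<Sum>k. ennreal (?c k) * indicator (ball x (r / 2 ^ k)) y)"
        proof -
          have "F k \<le> suminf F" for F :: "nat \<Rightarrow> ennreal"
            using sum_le_suminf[of F "{k}"] by simp
          from this[of "\<lambda>k. ennreal (?c k) * indicator (ball x (r / 2 ^ k)) y"] show ?thesis .
        qed
        finally show ?thesis .
      next
        case False
        with pw[of x y] have "norm (x - y) / norm (x - y) powr (?N + \<alpha>) * indicator (ball x r) y \<le> 0"
          by (simp only: if_False)
        then have "ennreal (norm (x - y) / norm (x - y) powr (?N + \<alpha>) * indicator (ball x r) y) = 0"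
          by (rule ennreal_neg)
        then show ?thesis by (simp only: zero_le)
      qed
    qed
    also have "\<dots> = (\<Sum>k. \<integral>\<^sup>+y. ennreal (?c k) * indicator (ball x (r / 2 ^ k)) y \<partial>lborel)"
      by (intro nn_integral_suminf borel_measurable_times_ennreal borel_measurable_const borel_measurable_indicator) simp
    also have "\<dots> = (\<Sum>k. ennreal (?c k * (?V * (r / 2 ^ k) ^ DIM('a))))"
    proof (rule suminf_cong)
      fix k
      have "(\<integral>\<^sup>+y. ennreal (?c k) * indicator (ball x (r / 2 ^ k)) y \<partial>lborel) = ennreal (?c k) * emeasure lborel (ball x (r / 2 ^ k))"
        by (rule nn_integral_cmult_indicator) simp
      also have "emeasure lborel (ball x (r / 2 ^ k)) = ennreal (?V * (r / 2 ^ k) ^ DIM('a))"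
        using r by (intro emeasure_ball) simp
      finally show "(\<integral>\<^sup>+y. ennreal (?c k) * indicator (ball x (r / 2 ^ k)) y \<partial>lborel) = ennreal (?c k * (?V * (r / 2 ^ k) ^ DIM('a)))"
        using r by (simp add: ennreal_mult unit_ball_vol_nonneg)
    qed
    also have "\<dots> = ennreal (\<Sum>k. ?c k * (?V * (r / 2 ^ k) ^ DIM('a)))"
    proof (rule suminf_ennreal2)
      show "0 \<le> ?c k * (?V * (r / 2 ^ k) ^ DIM('a))" for k
        using r by (simp add: unit_ball_vol_nonneg)
      have "?c k * (?V * (r / 2 ^ k) ^ DIM('a)) = (?V * r powr (1 - \<alpha>) * (1/2) powr (1 - \<alpha> - ?N)) * ((1/2) powr (1 - \<alpha>)) ^ k" for k
      proof -
        define p where "p = (1/2::real) ^ k"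
        have p: "0 < p" by (simp add: p_def)
        have rk: "r / 2 ^ k = r * p" and rs: "r / 2 ^ Suc k = r * p * (1/2)"
          by (simp_all add: p_def power_divide)
        have "p powr (1 - \<alpha>) = ((1/2) powr real k) powr (1 - \<alpha>)"
          by (simp only: p_def powr_realpow zero_less_divide_1_iff zero_less_numeral)
        also have "\<dots> = ((1/2) powr (1 - \<alpha>)) powr real k" by (simp only: powr_powr mult.commute)
        also have "\<dots> = ((1/2) powr (1 - \<alpha>)) ^ k" by (rule powr_realpow) simp
        finally have pk: "p powr (1 - \<alpha>) = ((1/2) powr (1 - \<alpha>)) ^ k" .
        have e1: "?c k = r powr (1 - \<alpha> - ?N) * p powr (1 - \<alpha> - ?N) * (1/2) powr (1 - \<alpha> - ?N)"
          unfolding rs using r p by (simp only: powr_mult)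
        have e2: "(r / 2 ^ k) ^ DIM('a) = r powr ?N * p powr ?N"
          unfolding rk using r p by (simp add: powr_realpow power_mult_distrib)
        have e3: "r powr (1 - \<alpha> - ?N) * r powr ?N = r powr (1 - \<alpha>)"
          "p powr (1 - \<alpha> - ?N) * p powr ?N = p powr (1 - \<alpha>)"
          by (simp_all add: powr_add[symmetric])
        have "?c k * (?V * (r / 2 ^ k) ^ DIM('a))
          = ?V * (r powr (1 - \<alpha> - ?N) * r powr ?N) * (1/2) powr (1 - \<alpha> - ?N) * (p powr (1 - \<alpha> - ?N) * p powr ?N)"
          unfolding e1 e2 by (simp only: mult_ac)
        then show ?thesis unfolding e3 pk .
      qed
      moreover have "norm ((1/2::real) powr (1 - \<alpha>)) < 1"
        using \<alpha> powr_less_mono2[of "1-\<alpha>" "1/2" 1] by simp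
      ultimately show "summable (\<lambda>k. ?c k * (?V * (r / 2 ^ k) ^ DIM('a)))"
        by (simp only:) (intro summable_mult summable_geometric)
    qed
    finally show ?thesis .
  qed
  then show ?thesis by blast
qed

lemma Cinf_c_C1_c: "Cinf_c \<Phi> \<Longrightarrow> C1_c \<Phi>"
  by (simp add: Cinf_c_def C1_c_def smooth_def)

lemma C1_c_continuous: "C1_c \<Phi> \<Longrightarrow> continuous_on UNIV \<Phi>"
  unfolding C1_c_def by (auto intro: differentiable_imp_continuous_on simp: One_nat_def)

text \<open>\<open>Ck 1\<close> provides continuity of the partial derivatives only. On a closed
  ball these are bounded, and the ball is convex, so the mean value inequality applies.\<close>

lemma C1_c_locally_Lipschitz:
  fixes \<Phi> :: "'b::euclidean_space \<Rightarrow> real"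
  assumes "C1_c \<Phi>"
  obtains L where "0 \<le> L" "\<And>p q. p \<in> cball 0 K \<Longrightarrow> q \<in> cball 0 K \<Longrightarrow> \<bar>\<Phi> p - \<Phi> q\<bar> \<le> L * norm (p - q)"
proof -
  let ?D = "\<lambda>p. frechet_derivative \<Phi> (at p)"
  have dif: "\<Phi> differentiable (at p)" for p
    using assms unfolding C1_c_def by (auto simp: One_nat_def differentiable_on_def)
  have cont: "continuous_on UNIV (\<lambda>p. ?D p i)" if "i \<in> Basis" for i
    using assms that unfolding C1_c_def by (auto simp: One_nat_def)
  have "\<exists>B. \<forall>p\<in>cball 0 K. \<bar>?D p i\<bar> \<le> B" if "i \<in> Basis" for i
  proof -
    have "compact ((\<lambda>p. ?D p i) ` cball 0 K)"
      by (intro compact_continuous_image compact_cball continuous_on_subset[OF cont[OF that]]) simp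
    from compact_imp_bounded[OF this] show ?thesis unfolding bounded_iff by auto
  qed
  then obtain B where B: "\<And>i p. i \<in> Basis \<Longrightarrow> p \<in> cball 0 K \<Longrightarrow> \<bar>?D p i\<bar> \<le> B i" by metis
  define L where "L = (\<Sum>i\<in>Basis. \<bar>B i\<bar>)"
  have "\<bar>\<Phi> p - \<Phi> q\<bar> \<le> L * norm (p - q)" if "p \<in> cball 0 K" "q \<in> cball 0 K" for p q
  proof -
    have "norm (\<Phi> p - \<Phi> q) \<le> L * norm (p - q)"
    proof (rule differentiable_bound[of "cball 0 K" \<Phi> ?D])
      fix z :: 'b assume z: "z \<in> cball 0 K"
      have hd: "(\<Phi> has_derivative ?D z) (at z)" using dif[of z] by (simp add: frechet_derivative_works)
      then show "(\<Phi> has_derivative ?D z) (at z within cball 0 K)" by (rule has_derivative_at_withinI)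
      from hd have lin: "linear (?D z)" by (rule has_derivative_linear)
      show "onorm (?D z) \<le> L"
      proof (rule onorm_le)
        fix v :: 'b
        have "?D z v = ?D z (\<Sum>i\<in>Basis. (v \<bullet> i) *\<^sub>R i)" by (simp add: euclidean_representation)
        also have "\<dots> = (\<Sum>i\<in>Basis. (v \<bullet> i) * ?D z i)"
          using lin by (simp add: linear_sum linear_scale)
        finally have "\<bar>?D z v\<bar> \<le> (\<Sum>i\<in>Basis. \<bar>v \<bullet> i\<bar> * \<bar>?D z i\<bar>)"
          using sum_abs[of "\<lambda>i. (v \<bullet> i) * ?D z i" Basis] by (simp add: abs_mult)
        also have "\<dots> \<le> (\<Sum>i\<in>Basis. norm v * \<bar>B i\<bar>)"
          using order_trans[OF B[OF _ z] abs_ge_self] by (intro sum_mono mult_mono) (auto simp: Basis_le_norm)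
        finally show "norm (?D z v) \<le> L * norm v" by (simp add: L_def sum_distrib_left mult.commute)
      qed
    qed (use that in auto)
    then show ?thesis by simp
  qed
  moreover have "0 \<le> L" by (simp add: L_def sum_nonneg)
  ultimately show thesis using that by blast
qed

text \<open>The antisymmetric numerator vanishes on the diagonal and is Lipschitz, which removes one
  power of |x-y| from the singularity; compact support restricts the integral to a ball of fixed
  radius. Boundedness is what makes \<open>f x * divG \<alpha> \<Phi> x\<close> integrable for every
  integrable \<open>f\<close>. Otherwise the integral inside \<open>TVG\<close> could be the default
  value 0 and would not depend linearly on \<open>f\<close>.\<close>

lemma divG_bounded:
  fixes \<Phi> :: "'a::euclidean_space \<times> 'a \<Rightarrow> real"
  assumes \<Phi>: "C1_c \<Phi>" and \<alpha>: "0 < \<alpha>" "\<alpha> < 1"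
  obtains C where "0 \<le> C" "\<And>x. \<bar>divG \<alpha> \<Phi> x\<bar> \<le> C"
proof -
  let ?N = "real DIM('a)"
  let ?k = "\<lambda>x y::'a. norm (x - y) / norm (x - y) powr (?N + \<alpha>)"
  let ?f = "\<lambda>x y. (\<Phi> (x, y) - \<Phi> (y, x)) / norm (x - y) powr (?N + \<alpha>)"
  have "bounded (supp \<Phi>)" using \<Phi> by (simp add: C1_c_def compact_imp_bounded)
  then obtain K0 where K0: "\<And>p. p \<in> supp \<Phi> \<Longrightarrow> norm p \<le> K0" unfolding bounded_iff by blast
  define K where "K = max K0 1"
  have K: "K > 0" "\<And>p. \<Phi> p \<noteq> 0 \<Longrightarrow> norm p \<le> K"
    using K0 closure_subset[of "{x. \<Phi> x \<noteq> 0}"] by (auto simp: K_def supp_def intro: max.coboundedI1)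
  \<comment> \<open>The radius is \<open>2*K\<close> because a pair of points of norm at most
    \<open>K\<close> has norm at most \<open>2*K\<close>.\<close>
  obtain L where L: "0 \<le> L" "\<And>p q. p \<in> cball 0 (2*K) \<Longrightarrow> q \<in> cball 0 (2*K) \<Longrightarrow> \<bar>\<Phi> p - \<Phi> q\<bar> \<le> L * norm (p - q)"
    using C1_c_locally_Lipschitz[OF \<Phi>] by metis
  obtain C0 where C0: "\<And>x::'a. (\<integral>\<^sup>+y. ennreal (?k x y * indicator (ball x (2*K+1)) y) \<partial>lborel) \<le> ennreal C0"
    using nn_integral_singular_kernel_finite[OF \<alpha>, of "2*K+1"] K(1) by auto
  have [measurable]: "\<Phi> \<in> borel_measurable borel"
    using C1_c_continuous[OF \<Phi>] by (rule borel_measurable_continuous_onI)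
  have num: "\<bar>\<Phi> (x, y) - \<Phi> (y, x)\<bar> \<le> 2 * L * norm (x - y) * indicator (ball x (2*K+1)) y" for x y :: 'a
  proof (cases "norm x \<le> K \<and> norm y \<le> K")
    case True
    have nle: "norm (a, b) \<le> norm a + norm b" for a b :: 'a by (rule norm_Pair_le)
    have "\<bar>\<Phi> (x, y) - \<Phi> (y, x)\<bar> \<le> L * norm ((x, y) - (y, x))"
      by (rule L(2)) (use True nle[of x y] nle[of y x] in auto)
    also have "\<dots> \<le> L * (2 * norm (x - y))"
      using L(1) nle[of "x - y" "y - x"] by (intro mult_left_mono) (auto simp: norm_minus_commute)
    finally have "\<bar>\<Phi> (x, y) - \<Phi> (y, x)\<bar> \<le> 2 * L * norm (x - y)" by simp
    moreover have "y \<in> ball x (2*K+1)"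
      using True norm_triangle_ineq4[of x y] by (simp add: dist_norm)
    ultimately show ?thesis by simp
  next
    case False
    have "norm x \<le> norm (x, y)" "norm y \<le> norm (x, y)" "norm x \<le> norm (y, x)" "norm y \<le> norm (y, x)"
      by (simp_all add: norm_fst_le[of "(x, y)", simplified] norm_snd_le[of "(x, y)", simplified]
           norm_fst_le[of "(y, x)", simplified] norm_snd_le[of "(y, x)", simplified] 
           norm_Pair real_sqrt_sum_squares_ge1 real_sqrt_sum_squares_ge2)
    with False K(2)[of "(x, y)"] K(2)[of "(y, x)"] have "\<Phi> (x, y) = 0" "\<Phi> (y, x) = 0" by force+
    then show ?thesis using L(1) by simp
  qed
  have fb: "norm (?f x y) \<le> 2 * L * (?k x y * indicator (ball x (2*K+1)) y)" for x y
    using divide_right_mono[OF num[of x y], of "norm (x - y) powr (?N + \<alpha>)"] by (simp add: mult_ac)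
  have [measurable]: "ball x (2*K+1) \<in> sets borel" for x :: 'a by simp
  have fm: "(\<lambda>y. ?f x y) \<in> borel_measurable lborel" for x by measurable
  have "\<bar>divG \<alpha> \<Phi> x\<bar> \<le> 2 * L * max C0 0" for x
  proof -
    have "(\<integral>\<^sup>+y. ennreal (norm (?f x y)) \<partial>lborel) \<le> (\<integral>\<^sup>+y. ennreal (2*L) * ennreal (?k x y * indicator (ball x (2*K+1)) y) \<partial>lborel)"
      using fb L(1) by (intro nn_integral_mono) (simp add: ennreal_mult'[symmetric] ennreal_leI)
    also have "\<dots> = ennreal (2*L) * (\<integral>\<^sup>+y. ennreal (?k x y * indicator (ball x (2*K+1)) y) \<partial>lborel)"
      by (rule nn_integral_cmult) measurable
    also have "\<dots> \<le> ennreal (2*L) * ennreal (max C0 0)"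
      using C0[of x] by (intro mult_left_mono) (auto intro: order_trans ennreal_leI)
    also have "\<dots> = ennreal (2 * L * max C0 0)" using L(1) by (simp add: ennreal_mult)
    finally have b: "(\<integral>\<^sup>+y. ennreal (norm (?f x y)) \<partial>lborel) \<le> ennreal (2 * L * max C0 0)" .
    then have i: "integrable lborel (?f x)"
      by (intro integrableI_bounded fm) (auto intro: le_less_trans)
    have "divG \<alpha> \<Phi> x = - (\<integral>y. ?f x y \<partial>lborel)"
      unfolding divG_def by (subst integral_completion) auto
    then have "\<bar>divG \<alpha> \<Phi> x\<bar> \<le> (\<integral>y. norm (?f x y) \<partial>lborel)"
      using integral_norm_bound[of lborel "?f x"] by simp
    moreover have "ennreal (\<integral>y. norm (?f x y) \<partial>lborel) \<le> ennreal (2 * L * max C0 0)"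
      using b nn_integral_eq_integral[OF integrable_norm[OF i]] by simp
    then have "(\<integral>y. norm (?f x y) \<partial>lborel) \<le> 2 * L * max C0 0"
      using L(1) by (subst (asm) ennreal_le_iff) auto
    ultimately show ?thesis by simp
  qed
  with L(1) show thesis by (intro that[of "2 * L * max C0 0"]) auto
qed

lemma divG_measurable:
  fixes \<Phi> :: "'a::euclidean_space \<times> 'a \<Rightarrow> real"
  assumes "continuous_on UNIV \<Phi>"
  shows "divG \<alpha> \<Phi> \<in> borel_measurable lebesgue"
proof -
  have [measurable]: "\<Phi> \<in> borel_measurable borel"
    using assms by (rule borel_measurable_continuous_onI)
  have "divG \<alpha> \<Phi> = (\<lambda>x. - (\<integral>y. (\<Phi> (x, y) - \<Phi> (y, x)) / norm (x - y) powr (real DIM('a) + \<alpha>) \<partial>lborel))"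
    unfolding divG_def by (intro ext arg_cong[of _ _ uminus] integral_completion) measurable
  moreover have "(\<lambda>x. - (\<integral>y. (\<Phi> (x, y) - \<Phi> (y, x)) / norm (x - y) powr (real DIM('a) + \<alpha>) \<partial>lborel)) \<in> borel_measurable lborel"
    by measurable
  ultimately show ?thesis by (simp add: measurable_completion)
qed

lemma integrable_mult_divG:
  fixes \<Phi> :: "'a::euclidean_space \<times> 'a \<Rightarrow> real"
  assumes "C1_c \<Phi>" "0 < \<alpha>" "\<alpha> < 1" "integrable lebesgue f"
  shows "integrable lebesgue (\<lambda>x. f x * divG \<alpha> \<Phi> x)"
proof -
  from divG_bounded[OF assms(1-3)] obtain C where C: "0 \<le> C" "\<And>x. \<bar>divG \<alpha> \<Phi> x\<bar> \<le> C" by metis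
  note m = divG_measurable[OF C1_c_continuous[OF assms(1)], of \<alpha>]
  show ?thesis
  proof (rule Bochner_Integration.integrable_bound)
    show "integrable lebesgue (\<lambda>x. C * f x)" using assms(4) by simp
    show "(\<lambda>x. f x * divG \<alpha> \<Phi> x) \<in> borel_measurable lebesgue"
      using borel_measurable_integrable[OF assms(4)] m by (rule borel_measurable_times)
    show "AE x in lebesgue. norm (f x * divG \<alpha> \<Phi> x) \<le> norm (C * f x)"
    proof (intro AE_I2)
      fix x
      have "\<bar>f x\<bar> * \<bar>divG \<alpha> \<Phi> x\<bar> \<le> \<bar>f x\<bar> * C" by (intro mult_left_mono C) simp
      then show "norm (f x * divG \<alpha> \<Phi> x) \<le> norm (C * f x)"
        using C(1) by (simp add: abs_mult mult.commute)
    qed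
  qed
qed

subsection \<open>The energy\<close>

text \<open>Only an inequality, since \<open>ennreal\<close> sends negative numbers to 0 and the
  pairing of a function with a test field may be negative.\<close>

lemma ennreal_sum_le: "ennreal (\<Sum>i\<in>I. a i) \<le> (\<Sum>i\<in>I. ennreal (a i))"
proof (induction I rule: infinite_finite_induct)
  case (insert i I)
  have "ennreal (a i + sum a I) \<le> ennreal (max (a i) 0 + max (sum a I) 0)"
    by (rule ennreal_leI) simp
  also have "\<dots> = ennreal (a i) + ennreal (sum a I)"
    by (simp add: ennreal_plus max_def ennreal_neg)
  finally show ?case using insert by (simp add: add_left_mono order_trans)
qed auto

lemma TVG_sum_le:
  fixes w :: "'i \<Rightarrow> 'a::euclidean_space \<Rightarrow> real"
  assumes \<alpha>: "0 < \<alpha>" "\<alpha> < 1"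
    and w: "\<And>i. i \<in> I \<Longrightarrow> integrable lebesgue (w i)" and c: "\<And>i. i \<in> I \<Longrightarrow> 0 \<le> c i"
  shows "TVG \<alpha> (\<lambda>x. \<Sum>i\<in>I. c i * w i x) \<le> (\<Sum>i\<in>I. ennreal (c i) * TVG \<alpha> (w i))"
  unfolding TVG_def[of \<alpha> "\<lambda>x. \<Sum>i\<in>I. c i * w i x"]
proof (rule SUP_least)
  fix \<Phi> :: "'a \<times> 'a \<Rightarrow> real" assume \<Phi>: "\<Phi> \<in> {\<Phi>. Cinf_c \<Phi> \<and> (\<forall>p. \<bar>\<Phi> p\<bar> \<le> 1)}"
  then have "C1_c \<Phi>" by (simp add: Cinf_c_C1_c)
  note int = integrable_mult_divG[OF this \<alpha> w]
  have "(\<integral>x. (\<Sum>i\<in>I. c i * w i x) * divG \<alpha> \<Phi> x \<partial>lebesgue)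
      = (\<integral>x. (\<Sum>i\<in>I. c i * (w i x * divG \<alpha> \<Phi> x)) \<partial>lebesgue)"
    by (simp add: sum_distrib_right mult.assoc)
  also have "\<dots> = (\<Sum>i\<in>I. c i * (\<integral>x. w i x * divG \<alpha> \<Phi> x \<partial>lebesgue))"
    using int by (subst Bochner_Integration.integral_sum) auto
  finally have "ennreal (\<integral>x. (\<Sum>i\<in>I. c i * w i x) * divG \<alpha> \<Phi> x \<partial>lebesgue)
      \<le> (\<Sum>i\<in>I. ennreal (c i * (\<integral>x. w i x * divG \<alpha> \<Phi> x \<partial>lebesgue)))"
    by (simp only: ennreal_sum_le)
  also have "\<dots> \<le> (\<Sum>i\<in>I. ennreal (c i) * TVG \<alpha> (w i))"
  proof (rule sum_mono)
    fix i assume i: "i \<in> I"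
    show "ennreal (c i * (\<integral>x. w i x * divG \<alpha> \<Phi> x \<partial>lebesgue)) \<le> ennreal (c i) * TVG \<alpha> (w i)"
      unfolding TVG_def ennreal_mult'[OF c[OF i]] by (intro mult_left_mono SUP_upper \<Phi>) simp
  qed
  finally show "ennreal (\<integral>x. (\<Sum>i\<in>I. c i * w i x) * divG \<alpha> \<Phi> x \<partial>lebesgue) \<le> (\<Sum>i\<in>I. ennreal (c i) * TVG \<alpha> (w i))" .
qed

lemma borel_measurable_lebesgue_on_AE_cong:
  fixes f g :: "'a::euclidean_space \<Rightarrow> real"
  assumes S: "S \<in> sets lebesgue" and f: "f \<in> borel_measurable (lebesgue_on S)"
    and ae: "AE x in lebesgue_on S. f x = g x"
  shows "g \<in> borel_measurable (lebesgue_on S)"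
proof -
  have "(\<lambda>x. if x \<in> S then f x else 0) \<in> borel_measurable lebesgue"
    using f S by (simp add: borel_measurable_if)
  moreover have "AE x in lebesgue. (if x \<in> S then f x else 0) = (if x \<in> S then g x else 0)"
    using ae S by (simp add: AE_restrict_space_iff)
  ultimately have "(\<lambda>x. if x \<in> S then g x else 0) \<in> borel_measurable lebesgue"
    by (rule borel_measurable_AE)
  then show ?thesis using S by (simp add: borel_measurable_if)
qed

text \<open>The Caratheodory condition gives measurability for constant second arguments, hence for
  countably many values. The function is therefore rounded down to multiples of 1/(n+1), and
  continuity in the second argument recovers the composition almost everywhere in the limit.\<close>

lemma caratheodory_measurable:
  fixes f :: "'a::euclidean_space \<Rightarrow> real"
  assumes R: "caratheodory S R" and S: "S \<in> sets lebesgue"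
    and f: "f \<in> borel_measurable (lebesgue_on S)"
  shows "(\<lambda>x. R x (f x)) \<in> borel_measurable (lebesgue_on S)"
proof (rule borel_measurable_lebesgue_on_AE_cong[OF S])
  let ?f = "\<lambda>n x. of_int \<lfloor>real (Suc n) * f x\<rfloor> / real (Suc n)"
  have m: "(\<lambda>x. R x (?f n x)) \<in> borel_measurable (lebesgue_on S)" for n
  proof -
    have fl: "(\<lambda>x. \<lfloor>real (Suc n) * f x\<rfloor>) \<in> measurable (lebesgue_on S) (count_space UNIV)"
      using f by measurable
    have "(\<lambda>x. R x (of_int i / real (Suc n))) \<in> borel_measurable (lebesgue_on S)" for i
      using R by (simp add: caratheodory_def)
    from measurable_compose_countable[OF this fl] show ?thesis .
  qed
  show "(\<lambda>x. lim (\<lambda>n. R x (?f n x))) \<in> borel_measurable (lebesgue_on S)"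
    by (rule borel_measurable_lim_metric[OF m])
  have fl: "(\<lambda>n. ?f n x) \<longlonglongrightarrow> f x" for x
  proof (rule LIM_zero_cancel, rule Lim_null_comparison)
    show "\<forall>\<^sub>F n in sequentially. norm (?f n x - f x) \<le> 1 / real (Suc n)"
    proof (intro always_eventually allI)
      fix n
      have "norm (?f n x - f x) = \<bar>of_int \<lfloor>real (Suc n) * f x\<rfloor> - real (Suc n) * f x\<bar> / real (Suc n)"
        by (simp add: field_simps abs_divide del: of_nat_Suc)
      also have "\<dots> \<le> 1 / real (Suc n)"
        by (intro divide_right_mono) linarith+
      finally show "norm (?f n x - f x) \<le> 1 / real (Suc n)" .
    qed
    show "(\<lambda>n. 1 / real (Suc n)) \<longlonglongrightarrow> 0" by (rule lim_1_over_n[THEN LIMSEQ_Suc])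
  qed
  have "AE x in lebesgue_on S. continuous_on UNIV (R x)" using R by (simp add: caratheodory_def)
  then show "AE x in lebesgue_on S. lim (\<lambda>n. R x (?f n x)) = R x (f x)"
  proof (rule AE_mp, intro AE_I2 impI)
    fix x assume "continuous_on UNIV (R x)"
    then have "isCont (R x) (f x)" by (simp add: continuous_on_eq_continuous_at)
    from isCont_tendsto_compose[OF this fl] show "lim (\<lambda>n. R x (?f n x)) = R x (f x)" by (rule limI)
  qed
qed

section \<open>The admissible states and the energy on them\<close>

locale denoising =
  fixes \<Omega> :: "'a::euclidean_space set" and \<alpha> :: real and R :: "'a \<Rightarrow> real \<Rightarrow> real" and u0 :: "'a \<Rightarrow> real"
  assumes open_\<Omega>: "open \<Omega>" and bounded_\<Omega>: "bounded \<Omega>"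
    and \<alpha>: "0 < \<alpha>" "\<alpha> < 1"
    and carath: "caratheodory \<Omega> R"
    and R_nonneg: "\<And>x s. x \<in> \<Omega> \<Longrightarrow> 0 \<le> R x s"
    and R_convex: "AE x in lebesgue_on \<Omega>. convex_on UNIV (R x)"
    and BVG_u0: "BVG \<alpha> u0" and L2_u0: "L2on \<Omega> u0"
    and R_u0: "(\<integral>\<^sup>+ x\<in>\<Omega>. ennreal (R x (u0 x)) \<partial>lebesgue) < \<infinity>"
begin

abbreviation M :: "'a measure" where "M \<equiv> lebesgue_on \<Omega>"

abbreviation F :: "('a \<Rightarrow> real) \<Rightarrow> ennreal" where "F \<equiv> FG \<alpha> R \<Omega>"

abbreviation dst :: "('a \<Rightarrow> real) \<Rightarrow> ('a \<Rightarrow> real) \<Rightarrow> real" where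
  "dst f g \<equiv> nrm2 M (\<lambda>x. f x - g x)"

text \<open>The common home of \<open>u0\<close>, of every \<open>u t\<close> and of every value of
  a test function. Square integrability on \<Omega> is added to the boundary class because distances
  are measured there.\<close>

definition state :: "('a \<Rightarrow> real) \<Rightarrow> bool" where
  "state w \<longleftrightarrow> BVG_bc \<alpha> \<Omega> u0 w \<and> L2on \<Omega> w"

lemma \<Omega>_lebesgue[measurable]: "\<Omega> \<in> sets lebesgue"
  using open_\<Omega> by simp

lemma finite_M: "finite_measure M"
proof
  have "emeasure lborel \<Omega> < \<infinity>" by (rule emeasure_bounded_finite[OF bounded_\<Omega>])
  then show "emeasure M (space M) \<noteq> \<infinity>"
    using open_\<Omega> by (simp add: emeasure_restrict_space)
qed

lemma L2on_sq_int: "L2on \<Omega> f \<longleftrightarrow> sq_int M f"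
  by (simp add: L2on_def sq_int_def)

lemma L2dist2_dst: "L2dist2 \<Omega> f g = (dst f g)\<^sup>2"
  by (simp add: L2dist2_def nrm2_sq)

lemma state_u0: "state u0"
  using BVG_u0 L2_u0 by (simp add: state_def BVG_bc_def)

lemma state_integrable: "state w \<Longrightarrow> integrable lebesgue w"
  by (simp add: state_def BVG_bc_def BVG_def)

lemma state_sq_int: "state w \<Longrightarrow> sq_int M w"
  by (simp add: state_def L2on_sq_int)

lemma state_TVG: "state w \<Longrightarrow> TVG \<alpha> w < \<infinity>"
  by (simp add: state_def BVG_bc_def BVG_def)

lemma state_outside: "state w \<Longrightarrow> AE x in lebesgue. x \<notin> \<Omega> \<longrightarrow> w x = u0 x"
  by (simp add: state_def BVG_bc_def)

lemma nn_integral_M: "(\<integral>\<^sup>+x\<in>\<Omega>. f x \<partial>lebesgue) = (\<integral>\<^sup>+x. f x \<partial>M)"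
  by (simp add: nn_integral_restrict_space)

lemma F_eq: "F w = TVG \<alpha> w + (\<integral>\<^sup>+x. ennreal (R x (w x)) \<partial>M)"
  by (simp add: FG_def nn_integral_M)

lemma F_u0_finite: "F u0 < \<infinity>"
  using R_u0 state_TVG[OF state_u0] by (simp add: FG_def)

text \<open>The exterior values survive because the weights have total mass 1; this is why test
  functions are built from partitions of unity in time.\<close>

lemma state_convex:
  assumes I: "finite I" and w: "\<And>i. i \<in> I \<Longrightarrow> state (w i)" and c: "\<And>i. i \<in> I \<Longrightarrow> 0 \<le> c i" and s: "sum c I = 1"
  shows "state (\<lambda>x. \<Sum>i\<in>I. c i * w i x)"
proof -
  have "TVG \<alpha> (\<lambda>x. \<Sum>i\<in>I. c i * w i x) \<le> (\<Sum>i\<in>I. ennreal (c i) * TVG \<alpha> (w i))"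
    by (rule TVG_sum_le[OF \<alpha> state_integrable[OF w] c])
  also have "\<dots> < \<infinity>"
    using I state_TVG[OF w] by (auto simp: ennreal_mult_less_top less_top)
  finally have 1: "TVG \<alpha> (\<lambda>x. \<Sum>i\<in>I. c i * w i x) < \<infinity>" .
  have "AE x in lebesgue. \<forall>i\<in>I. x \<notin> \<Omega> \<longrightarrow> w i x = u0 x"
    by (rule AE_finite_allI[OF I state_outside[OF w]])
  then have 2: "AE x in lebesgue. x \<notin> \<Omega> \<longrightarrow> (\<Sum>i\<in>I. c i * w i x) = u0 x"
  proof (rule AE_mp, intro AE_I2 impI)
    fix x assume h: "\<forall>i\<in>I. x \<notin> \<Omega> \<longrightarrow> w i x = u0 x" "x \<notin> \<Omega>"
    then have "(\<Sum>i\<in>I. c i * w i x) = (\<Sum>i\<in>I. c i * u0 x)" by (intro sum.cong) auto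
    then show "(\<Sum>i\<in>I. c i * w i x) = u0 x" using s by (simp add: sum_distrib_right[symmetric])
  qed
  have 3: "integrable lebesgue (\<lambda>x. \<Sum>i\<in>I. c i * w i x)"
    using state_integrable[OF w] by auto
  have 4: "sq_int M (\<lambda>x. \<Sum>i\<in>I. c i * w i x)"
    by (intro sq_int_sum sq_int_cmult state_sq_int w)
  show ?thesis using 1 2 3 4 by (simp add: state_def BVG_bc_def BVG_def L2on_sq_int)
qed

lemma R_measurable:
  "f \<in> borel_measurable M \<Longrightarrow> (\<lambda>x. R x (f x)) \<in> borel_measurable M"
  by (rule caratheodory_measurable[OF carath \<Omega>_lebesgue])

lemma state_R_measurable: "state w \<Longrightarrow> (\<lambda>x. ennreal (R x (w x))) \<in> borel_measurable M"
  by (intro measurable_compose[OF _ measurable_ennreal] R_measurable sq_int_measurable state_sq_int)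

lemma F_convex:
  assumes I: "finite I" and w: "\<And>i. i \<in> I \<Longrightarrow> state (w i)" and c: "\<And>i. i \<in> I \<Longrightarrow> 0 \<le> c i" and s: "sum c I = 1"
  shows "F (\<lambda>x. \<Sum>i\<in>I. c i * w i x) \<le> (\<Sum>i\<in>I. ennreal (c i) * F (w i))"
proof -
  have "(\<integral>\<^sup>+x. ennreal (R x (\<Sum>i\<in>I. c i * w i x)) \<partial>M) \<le> (\<integral>\<^sup>+x. (\<Sum>i\<in>I. ennreal (c i) * ennreal (R x (w i x))) \<partial>M)"
  proof (rule nn_integral_mono_AE, rule AE_mp[OF R_convex], intro AE_I2 impI)
    fix x assume x: "x \<in> space M" "convex_on UNIV (R x)"
    have ne: "I \<noteq> {}" using s by auto
    have "R x (\<Sum>i\<in>I. c i *\<^sub>R w i x) \<le> (\<Sum>i\<in>I. c i * R x (w i x))"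
      by (rule convex_on_sum[OF I ne x(2) s c]) auto
    then have "ennreal (R x (\<Sum>i\<in>I. c i * w i x)) \<le> ennreal (\<Sum>i\<in>I. c i * R x (w i x))"
      by (intro ennreal_leI) simp
    also have "\<dots> = (\<Sum>i\<in>I. ennreal (c i * R x (w i x)))"
      using c R_nonneg x by (subst sum_ennreal) auto
    also have "\<dots> = (\<Sum>i\<in>I. ennreal (c i) * ennreal (R x (w i x)))"
      using c by (intro sum.cong) (auto simp: ennreal_mult')
    finally show "ennreal (R x (\<Sum>i\<in>I. c i * w i x)) \<le> (\<Sum>i\<in>I. ennreal (c i) * ennreal (R x (w i x)))" .
  qed
  also have "\<dots> = (\<Sum>i\<in>I. ennreal (c i) * (\<integral>\<^sup>+x. ennreal (R x (w i x)) \<partial>M))"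
    using state_R_measurable[OF w] by (subst nn_integral_sum) (auto intro!: sum.cong nn_integral_cmult)
  finally show ?thesis
    unfolding F_eq distrib_left sum.distrib
    by (intro add_mono TVG_sum_le[OF \<alpha> state_integrable[OF w] c])
qed

text \<open>Two states agree almost everywhere outside \<Omega>, and \<Omega> has finite measure, so
  L2 convergence on \<Omega> is L1 convergence on the whole space. \<open>divG\<close> is bounded,
  so the pairing passes to the limit.\<close>

lemma divG_pairing_continuous:
  assumes \<Phi>: "C1_c \<Phi>" and f: "\<And>i. state (f i)" and g: "state g"
    and lim: "((\<lambda>i. dst (f i) g) \<longlongrightarrow> 0) G"
  shows "((\<lambda>i. \<integral>x. f i x * divG \<alpha> \<Phi> x \<partial>lebesgue) \<longlongrightarrow> (\<integral>x. g x * divG \<alpha> \<Phi> x \<partial>lebesgue)) G"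
proof -
  from divG_bounded[OF \<Phi> \<alpha>] obtain C where C: "0 \<le> C" "\<And>x. \<bar>divG \<alpha> \<Phi> x\<bar> \<le> C" by metis
  interpret finite_measure M by (rule finite_M)
  let ?m = "sqrt (measure M (space M))"
  have l0: "((\<lambda>i. C * (?m * dst (f i) g)) \<longlongrightarrow> 0) G"
    using tendsto_mult_left[OF tendsto_mult_left[OF lim], of C ?m] by simp
  have bd: "\<forall>\<^sub>F i in G. norm ((\<integral>x. f i x * divG \<alpha> \<Phi> x \<partial>lebesgue) - (\<integral>x. g x * divG \<alpha> \<Phi> x \<partial>lebesgue)) \<le> C * (?m * dst (f i) g)"
  proof (intro always_eventually allI)
    fix i
    note ii = integrable_mult_divG[OF \<Phi> \<alpha> state_integrable]
    have id: "integrable lebesgue (\<lambda>x. f i x - g x)" using state_integrable f g by auto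
    have ae: "AE x in lebesgue. \<bar>f i x - g x\<bar> = \<bar>f i x - g x\<bar> * indicator \<Omega> x"
      using state_outside[OF f[of i]] state_outside[OF g] by eventually_elim (auto simp: indicator_def)
    have "norm ((\<integral>x. f i x * divG \<alpha> \<Phi> x \<partial>lebesgue) - (\<integral>x. g x * divG \<alpha> \<Phi> x \<partial>lebesgue))
        = norm (\<integral>x. (f i x - g x) * divG \<alpha> \<Phi> x \<partial>lebesgue)"
      using ii[OF f[of i]] ii[OF g] by (simp add: left_diff_distrib)
    also have "\<dots> \<le> (\<integral>x. norm ((f i x - g x) * divG \<alpha> \<Phi> x) \<partial>lebesgue)"
      by (rule integral_norm_bound)
    also have "\<dots> \<le> (\<integral>x. C * \<bar>f i x - g x\<bar> \<partial>lebesgue)"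
    proof (rule integral_mono)
      show "integrable lebesgue (\<lambda>x. norm ((f i x - g x) * divG \<alpha> \<Phi> x))"
        by (intro integrable_norm integrable_mult_divG[OF \<Phi> \<alpha>] id)
      show "integrable lebesgue (\<lambda>x. C * \<bar>f i x - g x\<bar>)" using id by auto
      show "norm ((f i x - g x) * divG \<alpha> \<Phi> x) \<le> C * \<bar>f i x - g x\<bar>" for x
        using mult_left_mono[OF C(2)[of x], of "\<bar>f i x - g x\<bar>"] by (simp add: abs_mult mult.commute)
    qed
    also have "\<dots> = C * (\<integral>x. \<bar>f i x - g x\<bar> * indicator \<Omega> x \<partial>lebesgue)"
    proof -
      have "(\<lambda>x. \<bar>f i x - g x\<bar> * indicator \<Omega> x) \<in> borel_measurable lebesgue"
        using id by measurable
      then show ?thesis using integral_cong_AE[OF _ _ ae] id by simp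
    qed
    also have "(\<integral>x. \<bar>f i x - g x\<bar> * indicator \<Omega> x \<partial>lebesgue) = (\<integral>x. \<bar>f i x - g x\<bar> \<partial>M)"
      by (subst integral_restrict_space) (auto simp: mult.commute)
    also have "C * \<dots> \<le> C * (?m * dst (f i) g)"
      by (intro mult_left_mono C L1_le_nrm2 sq_int_diff state_sq_int f g)
    finally show "norm ((\<integral>x. f i x * divG \<alpha> \<Phi> x \<partial>lebesgue) - (\<integral>x. g x * divG \<alpha> \<Phi> x \<partial>lebesgue)) \<le> C * (?m * dst (f i) g)" .
  qed
  show ?thesis by (rule LIM_zero_cancel, rule Lim_null_comparison[OF bd l0])
qed

text \<open>A supremum of continuous functionals is lower semicontinuous. The formulation by
  sublevels is the one from which measurability in time is read off.\<close>

lemma TVG_closed_sublevel: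
  assumes f: "\<And>i::nat. state (f i)" and g: "state g"
    and lim: "(\<lambda>i. dst (f i) g) \<longlonglongrightarrow> 0" and le: "\<And>i. TVG \<alpha> (f i) \<le> c"
  shows "TVG \<alpha> g \<le> c"
  unfolding TVG_def
proof (rule SUP_least)
  fix \<Phi> :: "'a \<times> 'a \<Rightarrow> real" assume \<Phi>: "\<Phi> \<in> {\<Phi>. Cinf_c \<Phi> \<and> (\<forall>p. \<bar>\<Phi> p\<bar> \<le> 1)}"
  then have "C1_c \<Phi>" by (simp add: Cinf_c_C1_c)
  from divG_pairing_continuous[OF this f g lim]
  have "(\<lambda>i. ennreal (\<integral>x. f i x * divG \<alpha> \<Phi> x \<partial>lebesgue)) \<longlonglongrightarrow> ennreal (\<integral>x. g x * divG \<alpha> \<Phi> x \<partial>lebesgue)"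
    by (rule tendsto_ennrealI)
  moreover have "ennreal (\<integral>x. f i x * divG \<alpha> \<Phi> x \<partial>lebesgue) \<le> c" for i
    using le[of i] \<Phi> unfolding TVG_def by (auto simp: SUP_le_iff)
  ultimately show "ennreal (\<integral>x. g x * divG \<alpha> \<Phi> x \<partial>lebesgue) \<le> c"
    by (intro LIMSEQ_le_const2) auto
qed

text \<open>A subsequence converges almost everywhere, continuity of \<open>R x\<close> carries this
  over to the integrands, and Fatou's lemma concludes. Passing to a subsequence is harmless since
  \<open>c\<close> bounds every term.\<close>

lemma R_closed_sublevel:
  assumes f: "\<And>i::nat. sq_int M (f i)" and g: "sq_int M g"
    and lim: "(\<lambda>i. dst (f i) g) \<longlonglongrightarrow> 0" and le: "\<And>i. (\<integral>\<^sup>+x. ennreal (R x (f i x)) \<partial>M) \<le> c"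
  shows "(\<integral>\<^sup>+x. ennreal (R x (g x)) \<partial>M) \<le> c"
proof -
  interpret finite_measure M by (rule finite_M)
  let ?m = "sqrt (measure M (space M))"
  have "(\<lambda>i. \<integral>x. norm (f i x - g x) \<partial>M) \<longlonglongrightarrow> 0"
  proof (rule Lim_null_comparison)
    show "(\<lambda>i. ?m * dst (f i) g) \<longlonglongrightarrow> 0" using tendsto_mult_left[OF lim, of ?m] by simp
    show "\<forall>\<^sub>F i in sequentially. norm (\<integral>x. norm (f i x - g x) \<partial>M) \<le> ?m * dst (f i) g"
      using L1_le_nrm2[OF sq_int_diff[OF f g]] by (auto intro!: always_eventually)
  qed
  from tendsto_L1_AE_subseq[OF sq_int_integrable[OF sq_int_diff[OF f g]] this]
  obtain r where r: "strict_mono r" "AE x in M. (\<lambda>i. f (r i) x - g x) \<longlonglongrightarrow> 0"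
    by (elim exE conjE)
  have "(\<integral>\<^sup>+x. ennreal (R x (g x)) \<partial>M) = (\<integral>\<^sup>+x. liminf (\<lambda>i. ennreal (R x (f (r i) x))) \<partial>M)"
  proof (rule nn_integral_cong_AE)
    have "AE x in M. continuous_on UNIV (R x)" using carath by (simp add: caratheodory_def)
    with r(2) show "AE x in M. ennreal (R x (g x)) = liminf (\<lambda>i. ennreal (R x (f (r i) x)))"
    proof eventually_elim
      case (elim x)
      from LIM_zero_cancel[OF elim(1)] have fl: "(\<lambda>i. f (r i) x) \<longlonglongrightarrow> g x" .
      have "isCont (R x) (g x)" using elim(2) by (simp add: continuous_on_eq_continuous_at)
      from isCont_tendsto_compose[OF this fl]
      have "(\<lambda>i. ennreal (R x (f (r i) x))) \<longlonglongrightarrow> ennreal (R x (g x))" by (rule tendsto_ennrealI)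
      then show ?case by (intro lim_imp_Liminf[symmetric]) simp_all
    qed
  qed
  also have "\<dots> \<le> liminf (\<lambda>i. \<integral>\<^sup>+x. ennreal (R x (f (r i) x)) \<partial>M)"
    by (intro nn_integral_liminf measurable_compose[OF _ measurable_ennreal] R_measurable sq_int_measurable f)
  also have "\<dots> \<le> c"
    by (rule Liminf_le) (use le in auto)
  finally show ?thesis .
qed

text \<open>The averaging argument adds and splits integrals of F(u), and \<open>nn_integral\<close>
  is additive for measurable integrands. Lower semicontinuity of each summand along a continuous
  curve makes its sublevel sets in \<open>S\<close> closed; \<open>S\<close> has to be closed so
  that limits of times stay in it.\<close>

lemma F_measurable_along:
  fixes S :: "real set"
  assumes st: "\<And>t. t \<in> S \<Longrightarrow> state (u t)" and S: "closed S"
    and cont: "\<And>t. t \<in> S \<Longrightarrow> ((\<lambda>s. dst (u s) (u t)) \<longlongrightarrow> 0) (at t within S)"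
  shows "(\<lambda>t. F (u t)) \<in> borel_measurable (restrict_space borel S)"
proof -
  have seq: "(\<lambda>i. dst (u (t i)) (u l)) \<longlonglongrightarrow> 0" if t: "\<And>i. t i \<in> S" "t \<longlonglongrightarrow> l" for t :: "nat \<Rightarrow> real" and l
  proof -
    have l: "l \<in> S" using t S closed_sequentially by blast
    have c: "continuous (at l within S) (\<lambda>s. dst (u s) (u l))"
      using cont[OF l] by (simp add: continuous_within nrm2_def)
    show ?thesis
      using c[unfolded continuous_within_sequentially] t by (auto simp: o_def nrm2_def)
  qed
  have cl: "closed {t\<in>S. G (u t) \<le> y}"
    if G: "\<And>f g. (\<And>i::nat. state (f i)) \<Longrightarrow> state g \<Longrightarrow> (\<lambda>i. dst (f i) g) \<longlonglongrightarrow> 0 \<Longrightarrow> (\<And>i. G (f i) \<le> y) \<Longrightarrow> G g \<le> y"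
    for G :: "('a \<Rightarrow> real) \<Rightarrow> ennreal" and y
    unfolding closed_sequential_limits
  proof (intro allI impI)
    fix t l assume tl: "(\<forall>n. t n \<in> {t\<in>S. G (u t) \<le> y}) \<and> t \<longlonglongrightarrow> l"
    then have l: "l \<in> S" using S closed_sequentially[of S t l] by blast
    have "G (u l) \<le> y"
      by (rule G[of "\<lambda>i. u (t i)"]) (use tl st l seq[of t l] in auto)
    with l show "l \<in> {t\<in>S. G (u t) \<le> y}" by simp
  qed
  have meas: "(\<lambda>t. G (u t)) \<in> borel_measurable (restrict_space borel S)"
    if "\<And>y. closed {t\<in>S. G (u t) \<le> y}" for G :: "('a \<Rightarrow> real) \<Rightarrow> ennreal"
  proof (rule borel_measurableI_le)
    fix y
    have "{t \<in> space (restrict_space borel S). G (u t) \<le> y} = S \<inter> {t\<in>S. G (u t) \<le> y}"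
      by (auto simp: space_restrict_space)
    then show "{t \<in> space (restrict_space borel S). G (u t) \<le> y} \<in> sets (restrict_space borel S)"
      using that[of y] by (auto simp: sets_restrict_space intro!: image_eqI[of _ _ "{t\<in>S. G (u t) \<le> y}"])
  qed
  show ?thesis
    unfolding F_eq
  proof (rule borel_measurable_add)
    show "(\<lambda>t. TVG \<alpha> (u t)) \<in> borel_measurable (restrict_space borel S)"
    proof (rule meas, rule cl)
      fix f g y assume "\<And>i::nat. state (f i)" "state g" "(\<lambda>i. dst (f i) g) \<longlonglongrightarrow> 0" "\<And>i. TVG \<alpha> (f i) \<le> y"
      then show "TVG \<alpha> g \<le> y" by (rule TVG_closed_sublevel)
    qed
    show "(\<lambda>t. \<integral>\<^sup>+x. ennreal (R x (u t x)) \<partial>M) \<in> borel_measurable (restrict_space borel S)"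
    proof (rule meas[where G="\<lambda>w. \<integral>\<^sup>+x. ennreal (R x (w x)) \<partial>M"], rule cl)
      fix f g y assume a: "\<And>i::nat. state (f i)" "state g" "(\<lambda>i. dst (f i) g) \<longlonglongrightarrow> 0"
        "\<And>i. (\<integral>\<^sup>+x. ennreal (R x (f i x)) \<partial>M) \<le> y"
      show "(\<integral>\<^sup>+x. ennreal (R x (g x)) \<partial>M) \<le> y"
        by (rule R_closed_sublevel[OF state_sq_int[OF a(1)] state_sq_int[OF a(2)] a(3,4)])
    qed
  qed
qed

end

subsection \<open>Piecewise continuously differentiable functions of time\<close>

text \<open>Ramps have corners, so the derivative is supplied as a second function, bounded and
  Borel everywhere but correct only off a finite set. In this form the class is stable under sums
  and products, and the product of a ramp with a test function obeys the fundamental theorem of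
  calculus.\<close>

definition pwC1 :: "(real \<Rightarrow> real) \<Rightarrow> (real \<Rightarrow> real) \<Rightarrow> bool" where
  "pwC1 c d \<longleftrightarrow> continuous_on UNIV c \<and> d \<in> borel_measurable borel \<and> (\<exists>B. \<forall>t. \<bar>c t\<bar> \<le> B \<and> \<bar>d t\<bar> \<le> B)
     \<and> (\<exists>E. finite E \<and> (\<forall>t. t \<notin> E \<longrightarrow> (c has_real_derivative d t) (at t)))"

lemma pwC1_measurable[measurable_dest]:
  assumes "pwC1 c d" shows "c \<in> borel_measurable borel" "d \<in> borel_measurable borel"
  using assms by (auto simp: pwC1_def borel_measurable_continuous_onI)

lemma pwC1_bound:
  assumes "pwC1 c d" obtains B where "0 \<le> B" "\<And>t. \<bar>c t\<bar> \<le> B" "\<And>t. \<bar>d t\<bar> \<le> B"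
proof -
  from assms obtain B where B: "\<And>t. \<bar>c t\<bar> \<le> B \<and> \<bar>d t\<bar> \<le> B" unfolding pwC1_def by blast
  show thesis by (rule that[of B]) (use B abs_ge_zero[of "c 0"] order_trans in \<open>blast+\<close>)
qed

lemma pwC1_const: "pwC1 (\<lambda>t. a) (\<lambda>t. 0)"
  unfolding pwC1_def by (auto intro!: exI[of _ "\<bar>a\<bar>"] exI[of _ "{}"])

lemma pwC1_mult:
  assumes 1: "pwC1 c d" and 2: "pwC1 c' d'"
  shows "pwC1 (\<lambda>t. c t * c' t) (\<lambda>t. d t * c' t + d' t * c t)"
proof -
  obtain B where B: "0 \<le> B" "\<And>t. \<bar>c t\<bar> \<le> B" "\<And>t. \<bar>d t\<bar> \<le> B" using pwC1_bound[OF 1] by metis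
  obtain B' where B': "0 \<le> B'" "\<And>t. \<bar>c' t\<bar> \<le> B'" "\<And>t. \<bar>d' t\<bar> \<le> B'" using pwC1_bound[OF 2] by metis
  obtain E E' where E: "finite E" "\<And>t. t \<notin> E \<Longrightarrow> (c has_real_derivative d t) (at t)"
    "finite E'" "\<And>t. t \<notin> E' \<Longrightarrow> (c' has_real_derivative d' t) (at t)"
    using 1 2 unfolding pwC1_def by metis
  have [measurable]: "c \<in> borel_measurable borel" "d \<in> borel_measurable borel"
    "c' \<in> borel_measurable borel" "d' \<in> borel_measurable borel"
    using pwC1_measurable 1 2 by auto
  have b: "\<bar>c t * c' t\<bar> \<le> B * B' + B' * B" "\<bar>d t * c' t + d' t * c t\<bar> \<le> B * B' + B' * B" for t
  proof -
    have "\<bar>c t\<bar> * \<bar>c' t\<bar> \<le> B * B'" "\<bar>d t\<bar> * \<bar>c' t\<bar> \<le> B * B'" "\<bar>d' t\<bar> * \<bar>c t\<bar> \<le> B' * B"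
      by (intro mult_mono B B' abs_ge_zero)+
    moreover have "0 \<le> B' * B" using B B' by simp
    ultimately show "\<bar>c t * c' t\<bar> \<le> B * B' + B' * B" "\<bar>d t * c' t + d' t * c t\<bar> \<le> B * B' + B' * B"
      unfolding abs_mult[symmetric] by linarith+
  qed
  have "((\<lambda>t. c t * c' t) has_real_derivative d t * c' t + d' t * c t) (at t)" if "t \<notin> E \<union> E'" for t
    using DERIV_mult[OF E(2)[of t] E(4)[of t]] that by simp
  moreover have "finite (E \<union> E')" using E by simp
  moreover have "continuous_on UNIV (\<lambda>t. c t * c' t)"
    using 1 2 by (auto simp: pwC1_def intro: continuous_intros)
  ultimately show ?thesis unfolding pwC1_def
    using b by (intro conjI exI[of _ "B * B' + B' * B"] exI[of _ "E \<union> E'"]) auto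
qed

lemma pwC1_add:
  assumes 1: "pwC1 c d" and 2: "pwC1 c' d'"
  shows "pwC1 (\<lambda>t. c t + c' t) (\<lambda>t. d t + d' t)"
proof -
  obtain B where B: "0 \<le> B" "\<And>t. \<bar>c t\<bar> \<le> B" "\<And>t. \<bar>d t\<bar> \<le> B" using pwC1_bound[OF 1] by metis
  obtain B' where B': "0 \<le> B'" "\<And>t. \<bar>c' t\<bar> \<le> B'" "\<And>t. \<bar>d' t\<bar> \<le> B'" using pwC1_bound[OF 2] by metis
  obtain E E' where E: "finite E" "\<And>t. t \<notin> E \<Longrightarrow> (c has_real_derivative d t) (at t)"
    "finite E'" "\<And>t. t \<notin> E' \<Longrightarrow> (c' has_real_derivative d' t) (at t)"
    using 1 2 unfolding pwC1_def by metis
  have [measurable]: "d \<in> borel_measurable borel" "d' \<in> borel_measurable borel"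
    using pwC1_measurable 1 2 by auto
  have b: "\<bar>c t + c' t\<bar> \<le> B + B'" "\<bar>d t + d' t\<bar> \<le> B + B'" for t
    using B(2,3)[of t] B'(2,3)[of t] by linarith+
  have "((\<lambda>t. c t + c' t) has_real_derivative d t + d' t) (at t)" if "t \<notin> E \<union> E'" for t
    using DERIV_add[OF E(2)[of t] E(4)[of t]] that by simp
  moreover have "finite (E \<union> E')" using E by simp
  moreover have "continuous_on UNIV (\<lambda>t. c t + c' t)"
    using 1 2 by (auto simp: pwC1_def intro: continuous_intros)
  ultimately show ?thesis unfolding pwC1_def
    using b by (intro conjI exI[of _ "B + B'"] exI[of _ "E \<union> E'"]) auto
qed

lemma pwC1_cmult: "pwC1 c d \<Longrightarrow> pwC1 (\<lambda>t. a * c t) (\<lambda>t. a * d t)"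
  using pwC1_mult[OF pwC1_const[of a], of c d] by (simp add: mult.commute)

lemma pwC1_diff:
  assumes 1: "pwC1 c d" and 2: "pwC1 c' d'"
  shows "pwC1 (\<lambda>t. c t - c' t) (\<lambda>t. d t - d' t)"
  using pwC1_add[OF 1 pwC1_cmult[OF 2, of "-1"]] by simp

lemma pwC1_sum:
  assumes "\<And>i. i \<in> I \<Longrightarrow> pwC1 (c i) (d i)"
  shows "pwC1 (\<lambda>t. \<Sum>i\<in>I. c i t) (\<lambda>t. \<Sum>i\<in>I. d i t)"
  using assms by (induction I rule: infinite_finite_induct) (auto intro: pwC1_add pwC1_const)

definition ramp :: "real \<Rightarrow> real \<Rightarrow> real \<Rightarrow> real" where
  "ramp e b t = max 0 (min 1 ((t - b) / e))"

lemma ramp_le: "0 < e \<Longrightarrow> t \<le> b \<Longrightarrow> ramp e b t = 0"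
  unfolding ramp_def by (simp add: divide_nonpos_pos)

lemma ramp_ge: "0 < e \<Longrightarrow> b + e \<le> t \<Longrightarrow> ramp e b t = 1"
  unfolding ramp_def by (simp add: field_simps)

lemma ramp_nonneg: "0 \<le> ramp e b t" and ramp_le_1: "ramp e b t \<le> 1"
  unfolding ramp_def by simp_all

lemma pwC1_ramp:
  assumes e: "0 < e"
  shows "pwC1 (ramp e b) (\<lambda>t. indicator {b<..<b+e} t / e)"
proof -
  have "continuous_on UNIV (ramp e b)"
    unfolding ramp_def by (intro continuous_intros) (use e in auto)
  moreover have "(ramp e b has_real_derivative indicator {b<..<b+e} t / e) (at t)" if "t \<notin> {b, b+e}" for t
  proof -
    consider "t < b" | "b < t" "t < b + e" | "b + e < t" using \<open>t \<notin> {b, b+e}\<close> by force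
    then show ?thesis
    proof cases
      case 1
      have "((\<lambda>_. 0) has_real_derivative 0) (at t)" by simp
      then have "(ramp e b has_real_derivative 0) (at t)"
        by (rule has_field_derivative_transform_within_open[where S="{..<b}"])
           (use 1 e in \<open>auto simp: ramp_le\<close>)
      then show ?thesis using 1 by simp
    next
      case 2
      have "((\<lambda>t. (t - b) / e) has_real_derivative 1 / e) (at t)"
        using e by (auto intro!: derivative_eq_intros)
      then have "(ramp e b has_real_derivative 1 / e) (at t)"
        by (rule has_field_derivative_transform_within_open[where S="{b<..<b+e}"])
           (use 2 e in \<open>auto simp: ramp_def field_simps\<close>)
      then show ?thesis using 2 by simp
    next
      case 3
      have "((\<lambda>_. 1) has_real_derivative 0) (at t)" by simp
      then have "(ramp e b has_real_derivative 0) (at t)"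
        by (rule has_field_derivative_transform_within_open[where S="{b+e<..}"])
           (use 3 e in \<open>auto simp: ramp_ge\<close>)
      then show ?thesis using 3 by simp
    qed
  qed
  moreover have "\<bar>ramp e b t\<bar> \<le> 1 + 1/e \<and> \<bar>indicator {b<..<b+e} t / e\<bar> \<le> 1 + 1 / e" for t
    using ramp_nonneg[of e b t] ramp_le_1[of e b t] e by (auto simp: indicator_def add_increasing2)
  ultimately show ?thesis unfolding pwC1_def
    by (intro conjI exI[of _ "1 + 1/e"] exI[of _ "{b, b+e}"]) auto
qed

lemma integrable_bounded_on_interval:
  fixes f :: "real \<Rightarrow> real"
  assumes f: "f \<in> borel_measurable lebesgue" and B: "\<And>t. a < t \<Longrightarrow> t < b \<Longrightarrow> \<bar>f t\<bar> \<le> B"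
  shows "integrable lebesgue (\<lambda>t. indicator {a<..<b} t * f t)"
proof (rule Bochner_Integration.integrable_bound)
  show "integrable lebesgue (\<lambda>t. \<bar>B\<bar> * indicator {a<..<b} t :: real)"
    by (cases "a \<le> b") (auto intro!: integrable_real_indicator simp: emeasure_lborel_Ioo)
  show "(\<lambda>t. indicator {a<..<b} t * f t) \<in> borel_measurable lebesgue"
    by (intro borel_measurable_times borel_measurable_indicator f) simp
  show "AE t in lebesgue. norm (indicator {a<..<b} t * f t) \<le> norm (\<bar>B\<bar> * indicator {a<..<b} t :: real)"
    using order_trans[OF B abs_ge_self] by (intro AE_I2) (auto simp: indicator_def)
qed

text \<open>The gauge-integral version of the fundamental theorem tolerates finitely many
  exceptional points; boundedness of \<open>d\<close> then identifies the gauge integral with the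
  Lebesgue integral.\<close>

lemma pwC1_FTC:
  assumes cd: "pwC1 c d" and ab: "a \<le> b"
  shows "(\<integral>t. indicator {a<..<b} t * d t \<partial>lebesgue) = c b - c a"
proof -
  obtain B where B: "\<And>t. \<bar>d t\<bar> \<le> B" using pwC1_bound[OF cd] by metis
  obtain E where E: "finite E" "\<And>t. t \<notin> E \<Longrightarrow> (c has_real_derivative d t) (at t)"
    using cd unfolding pwC1_def by metis
  have dm[measurable]: "d \<in> borel_measurable borel" using cd by (rule pwC1_measurable)
  have "(d has_integral (c b - c a)) {a..b}"
    by (rule fundamental_theorem_of_calculus_interior_strong[OF E(1) ab])
       (use E(2) cd in \<open>auto simp: has_real_derivative_iff_has_vector_derivative pwC1_def intro: continuous_on_subset\<close>)
  then have hi: "(d has_integral (c b - c a)) {a<..<b}" by (simp add: has_integral_Icc_iff_Ioo)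
  have "integrable lebesgue (\<lambda>t. indicator {a<..<b} t * d t)"
    by (rule integrable_bounded_on_interval[where B=B]) (use B in \<open>auto intro: measurable_completion\<close>)
  moreover have m: "(\<lambda>t. indicator {a<..<b} t * d t) \<in> borel_measurable lborel" by measurable
  ultimately have si: "set_integrable lborel {a<..<b} d"
    unfolding set_integrable_def by (simp add: integrable_completion[OF m])
  have "(\<integral>t. indicator {a<..<b} t * d t \<partial>lebesgue) = (\<integral>t. indicator {a<..<b} t * d t \<partial>lborel)"
    by (rule integral_completion[OF m])
  also have "\<dots> = integral {a<..<b} d"
    using set_borel_integral_eq_integral(2)[OF si] by (simp add: set_lebesgue_integral_def)
  also have "\<dots> = c b - c a" by (rule integral_unique[OF hi])
  finally show ?thesis .
qed

subsection \<open>Finite sums of products of functions of space and time\<close>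

lemma tensor_integrable:
  fixes z :: "'a::euclidean_space \<Rightarrow> real" and d :: "real \<Rightarrow> real"
  assumes z: "integrable lebesgue z" and d: "d \<in> borel_measurable borel" and B: "\<And>t. \<bar>d t\<bar> \<le> B"
  shows "integrable lebesgue (\<lambda>p. z (fst p) * (indicator {a<..<b} (snd p) * d (snd p)))"
proof (rule integrableI_bounded)
  let ?e = "\<lambda>t. indicator {a<..<b} t * d t"
  have zm: "z \<in> borel_measurable lebesgue" using z by simp
  have em: "?e \<in> borel_measurable lebesgue" 
    by (intro measurable_completion borel_measurable_times borel_measurable_indicator) (use d in \<open>simp_all add: borel_open\<close>)
  have zfm[measurable]: "(\<lambda>p::'a \<times> real. z (fst p)) \<in> borel_measurable lebesgue"
    by (rule lebesgue_measurable_vimage_fst[OF zm])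
  have efm[measurable]: "(\<lambda>p::'a \<times> real. ?e (snd p)) \<in> borel_measurable lebesgue"
    by (rule lebesgue_measurable_vimage_snd[OF em])
  show m: "(\<lambda>p::'a \<times> real. z (fst p) * ?e (snd p)) \<in> borel_measurable lebesgue"
    using zfm efm by (rule borel_measurable_times)
  have B0: "0 \<le> B" using B[of 0] by linarith
  have "(\<integral>\<^sup>+p. ennreal (norm (z (fst p) * ?e (snd p))) \<partial>lebesgue)
     = (\<integral>\<^sup>+t. (\<integral>\<^sup>+x. ennreal (norm (z x * ?e t)) \<partial>lebesgue) \<partial>lebesgue)"
    using lebesgue_Tonelli[of "\<lambda>p. ennreal (norm (z (fst p) * ?e (snd p)))"] m by simp
  also have "\<dots> = (\<integral>\<^sup>+t. ennreal \<bar>?e t\<bar> * ennreal (\<integral>x. \<bar>z x\<bar> \<partial>lebesgue) \<partial>lebesgue)"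
  proof (rule nn_integral_cong)
    fix t
    have "(\<integral>\<^sup>+x. ennreal (norm (z x * ?e t)) \<partial>lebesgue) = (\<integral>\<^sup>+x. ennreal \<bar>?e t\<bar> * ennreal \<bar>z x\<bar> \<partial>lebesgue)"
      by (intro nn_integral_cong) (simp add: abs_mult ennreal_mult mult.commute)
    also have "\<dots> = ennreal \<bar>?e t\<bar> * (\<integral>\<^sup>+x. ennreal \<bar>z x\<bar> \<partial>lebesgue)"
      using zm by (intro nn_integral_cmult) measurable
    also have "(\<integral>\<^sup>+x. ennreal \<bar>z x\<bar> \<partial>lebesgue) = ennreal (\<integral>x. \<bar>z x\<bar> \<partial>lebesgue)"
      using z by (intro nn_integral_eq_integral) auto
    finally show "(\<integral>\<^sup>+x. ennreal (norm (z x * ?e t)) \<partial>lebesgue) = ennreal \<bar>?e t\<bar> * ennreal (\<integral>x. \<bar>z x\<bar> \<partial>lebesgue)" .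
  qed
  also have "\<dots> = (\<integral>\<^sup>+t. ennreal \<bar>?e t\<bar> \<partial>lebesgue) * ennreal (\<integral>x. \<bar>z x\<bar> \<partial>lebesgue)"
    by (intro nn_integral_multc measurable_compose[OF _ measurable_ennreal] borel_measurable_abs em)
  also have "\<dots> < \<infinity>"
  proof -
    have "integrable lebesgue ?e"
      by (rule integrable_bounded_on_interval[where B=B]) (use B d in \<open>auto intro: measurable_completion\<close>)
    then have "(\<integral>\<^sup>+t. ennreal \<bar>?e t\<bar> \<partial>lebesgue) < \<infinity>"
      by (simp add: integrable_iff_bounded)
    then show ?thesis by (simp add: ennreal_mult_less_top)
  qed
  finally show "(\<integral>\<^sup>+p. ennreal (norm (z (fst p) * ?e (snd p))) \<partial>lebesgue) < \<infinity>" .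
qed

text \<open>\<open>dtime\<close> is an ordinary derivative along a time slice. Its continuity and
  its compact support come from identifying it with the Frechet derivative in the basis direction
  \<open>(0, 1)\<close>. The last claim lets a test function enter products of piecewise C1
  functions.\<close>

lemma test_function_time:
  fixes \<phi> :: "'a::euclidean_space \<times> real \<Rightarrow> real"
  assumes \<phi>: "C1_c \<phi>"
  shows "continuous_on UNIV (dtime \<phi>)" "\<And>p. p \<notin> supp \<phi> \<Longrightarrow> \<phi> p = 0" "\<And>p. p \<notin> supp \<phi> \<Longrightarrow> dtime \<phi> p = 0"
    "\<exists>B. \<forall>p. \<bar>\<phi> p\<bar> \<le> B \<and> \<bar>dtime \<phi> p\<bar> \<le> B"
    "\<And>x. pwC1 (\<lambda>s. \<phi> (x, s)) (\<lambda>s. dtime \<phi> (x, s))"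
proof -
  have der: "((\<lambda>s. \<phi> (x, s)) has_real_derivative frechet_derivative \<phi> (at (x, t)) (0, 1)) (at t)" for x t
  proof -
    have "\<phi> differentiable (at (x, t))"
      using \<phi> unfolding C1_c_def by (auto simp: One_nat_def differentiable_on_def)
    then have D: "(\<phi> has_derivative frechet_derivative \<phi> (at (x, t))) (at (x, t))"
      by (simp add: frechet_derivative_works)
    have "((\<lambda>s. (x, s)) has_derivative (\<lambda>h. (0, h))) (at t)"
      by (auto intro!: derivative_eq_intros)
    from diff_chain_at[OF this D] have "((\<lambda>s. \<phi> (x, s)) has_derivative (\<lambda>h. frechet_derivative \<phi> (at (x, t)) (0, h))) (at t)"
      by (simp add: o_def)
    moreover have "(\<lambda>h. frechet_derivative \<phi> (at (x, t)) (0, h)) = (\<lambda>h. frechet_derivative \<phi> (at (x, t)) (0, 1) * h)"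
    proof
      fix h :: real
      have "linear (frechet_derivative \<phi> (at (x, t)))" by (rule has_derivative_linear[OF D])
      from linear_scale[OF this, of h "(0, 1)"] show "frechet_derivative \<phi> (at (x, t)) (0, h) = frechet_derivative \<phi> (at (x, t)) (0, 1) * h"
        by simp
    qed
    ultimately show ?thesis by (simp add: has_field_derivative_def)
  qed
  then have dt: "dtime \<phi> p = frechet_derivative \<phi> (at p) (0, 1)" for p
    unfolding dtime_def using DERIV_imp_deriv[of "\<lambda>s. \<phi> (fst p, s)" _ "snd p"] by (metis prod.collapse)
  have "(0, 1) \<in> (Basis :: ('a \<times> real) set)" by (simp add: Basis_prod_def)
  then have "continuous_on UNIV (\<lambda>p. frechet_derivative \<phi> (at p) (0, 1))"
    using \<phi> unfolding C1_c_def by (auto simp: One_nat_def)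
  then show cd: "continuous_on UNIV (dtime \<phi>)" by (simp add: dt[abs_def])
  show z: "\<phi> p = 0" if "p \<notin> supp \<phi>" for p
    using that closure_subset[of "{x. \<phi> x \<noteq> 0}"] unfolding supp_def by auto
  have zero_dt: "dtime \<phi> p = 0" if p: "p \<notin> supp \<phi>" for p
  proof -
    have "open (- supp \<phi>)" by (simp add: supp_def open_Compl)
    have "((\<lambda>_. 0) has_derivative (\<lambda>_. 0)) (at p)" by simp
    then have "(\<phi> has_derivative (\<lambda>_. 0)) (at p)"
      by (rule has_derivative_transform_within_open[OF _ \<open>open (- supp \<phi>)\<close>]) (use p z in auto)
    from frechet_derivative_at[OF this] show ?thesis unfolding dt by metis
  qed
  then show "dtime \<phi> p = 0" if "p \<notin> supp \<phi>" for p using that by blast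
  have cphi: "continuous_on UNIV \<phi>" by (rule C1_c_continuous[OF \<phi>])
  have cpt: "compact (supp \<phi>)" using \<phi> by (simp add: C1_c_def)
  have "\<exists>B. \<forall>p. \<bar>f p\<bar> \<le> B" if "continuous_on UNIV f" "\<And>p. p \<notin> supp \<phi> \<Longrightarrow> f p = 0" for f :: "'a \<times> real \<Rightarrow> real"
  proof -
    have "compact (f ` supp \<phi>)" 
      by (rule compact_continuous_image[OF continuous_on_subset[OF that(1)] cpt]) simp
    from compact_imp_bounded[OF this] obtain B where B: "\<forall>y\<in>f ` supp \<phi>. norm y \<le> B"
      unfolding bounded_iff by (elim exE)
    have "\<bar>f p\<bar> \<le> \<bar>B\<bar>" for p
    proof (cases "p \<in> supp \<phi>")
      case True
      then have "norm (f p) \<le> B" using B by simp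
      then show ?thesis by simp
    qed (simp add: that(2))
    then show ?thesis by blast
  qed
  from this[OF cphi] this[OF cd] z zero_dt obtain B1 B2 where "\<forall>p. \<bar>\<phi> p\<bar> \<le> B1" "\<forall>p. \<bar>dtime \<phi> p\<bar> \<le> B2"
    by metis
  then have B: "\<forall>p. \<bar>\<phi> p\<bar> \<le> max B1 B2 \<and> \<bar>dtime \<phi> p\<bar> \<le> max B1 B2" by (simp add: max.coboundedI1 max.coboundedI2)
  then show "\<exists>B. \<forall>p. \<bar>\<phi> p\<bar> \<le> B \<and> \<bar>dtime \<phi> p\<bar> \<le> B" by blast
  show "pwC1 (\<lambda>s. \<phi> (x, s)) (\<lambda>s. dtime \<phi> (x, s))" for x
    unfolding pwC1_def
  proof (intro conjI)
    show "continuous_on UNIV (\<lambda>s. \<phi> (x, s))"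
      by (rule continuous_on_compose2[OF cphi]) (auto intro: continuous_intros)
    have "continuous_on UNIV (\<lambda>s. dtime \<phi> (x, s))"
      by (rule continuous_on_compose2[OF cd]) (auto intro: continuous_intros)
    then show "(\<lambda>s. dtime \<phi> (x, s)) \<in> borel_measurable borel" by (rule borel_measurable_continuous_onI)
    show "\<exists>B. \<forall>t. \<bar>\<phi> (x, t)\<bar> \<le> B \<and> \<bar>dtime \<phi> (x, t)\<bar> \<le> B" using B by blast
    show "\<exists>E. finite E \<and> (\<forall>t. t \<notin> E \<longrightarrow> ((\<lambda>s. \<phi> (x, s)) has_real_derivative dtime \<phi> (x, t)) (at t))"
      using der[of x] by (intro exI[of _ "{}"]) (simp add: dt)
  qed
qed

text \<open>For fixed \<open>x\<close> the product \<open>c i t * \<phi> (x, t)\<close> is piecewise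
  C1 in time and vanishes at 0 and \<open>T\<close>, because the support of \<phi> lies over the
  open interval. Its derivative thus integrates to 0, and Fubini with time as the inner variable
  gives the identity for each summand.\<close>

lemma weak_dt_tensor_sum:
  fixes z :: "'i \<Rightarrow> 'a::euclidean_space \<Rightarrow> real"
  assumes \<Omega>: "open \<Omega>" and T: "0 < T" and z: "\<And>i. i \<in> I \<Longrightarrow> integrable lebesgue (z i)"
    and cd: "\<And>i. i \<in> I \<Longrightarrow> pwC1 (c i) (d i)"
  shows "weak_dt \<Omega> T (\<lambda>t x. \<Sum>i\<in>I. c i t * z i x) (\<lambda>p. \<Sum>i\<in>I. d i (snd p) * z i (fst p))"
proof -
  let ?S = "\<Omega> \<times> {0<..<T}"
  have "open ?S" using \<Omega> by (intro open_Times) auto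
  then have Ss: "?S \<in> sets lebesgue" by simp
  have K: "integrable (lebesgue_on K) (\<lambda>p. \<Sum>i\<in>I. e i (snd p) * z i (fst p))"
    if "compact K" "K \<subseteq> ?S" and e: "\<And>i. i \<in> I \<Longrightarrow> e i \<in> borel_measurable borel" "\<And>i. i \<in> I \<Longrightarrow> \<exists>B. \<forall>t. \<bar>e i t\<bar> \<le> B"
    for K and e :: "'i \<Rightarrow> real \<Rightarrow> real"
  proof (rule Bochner_Integration.integrable_sum)
    fix i assume i: "i \<in> I"
    from e(2)[OF i] obtain B where "\<And>t. \<bar>e i t\<bar> \<le> B" by blast
    from tensor_integrable[OF z[OF i] e(1)[OF i] this]
    have "integrable lebesgue (\<lambda>p. z i (fst p) * (indicator {0<..<T} (snd p) * e i (snd p)))" .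
    moreover have Ks: "K \<in> sets lebesgue" using that(1) by (simp add: lmeasurable_compact fmeasurableD)
    ultimately have "integrable lebesgue (\<lambda>p. indicator K p *\<^sub>R (z i (fst p) * (indicator {0<..<T} (snd p) * e i (snd p))))"
      by (intro integrable_mult_indicator) 
    also have "(\<lambda>p. indicator K p *\<^sub>R (z i (fst p) * (indicator {0<..<T} (snd p) * e i (snd p))))
        = (\<lambda>p. indicator K p *\<^sub>R (e i (snd p) * z i (fst p)))"
    proof
      fix p show "indicator K p *\<^sub>R (z i (fst p) * (indicator {0<..<T} (snd p) * e i (snd p))) = indicator K p *\<^sub>R (e i (snd p) * z i (fst p))"
      proof (cases "p \<in> K")
        case True
        with that(2) have "snd p \<in> {0<..<T}" by auto
        then show ?thesis by simp
      qed simp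
    qed
    finally show "integrable (lebesgue_on K) (\<lambda>p. e i (snd p) * z i (fst p))"
      using Ks by (subst integrable_restrict_space) auto
  qed
  have bd: "\<exists>B. \<forall>t. \<bar>c i t\<bar> \<le> B" "\<exists>B. \<forall>t. \<bar>d i t\<bar> \<le> B" if "i \<in> I" for i
    using cd[OF that] by (auto simp: pwC1_def)
  have eq: "(\<integral>p. (\<Sum>i\<in>I. c i (snd p) * z i (fst p)) * dtime \<phi> p \<partial>lebesgue_on ?S)
      = - (\<integral>p. (\<Sum>i\<in>I. d i (snd p) * z i (fst p)) * \<phi> p \<partial>lebesgue_on ?S)"
    if \<phi>: "Cinf_c \<phi>" and sup: "supp \<phi> \<subseteq> ?S" for \<phi>
  proof -
    note tf = test_function_time[OF Cinf_c_C1_c[OF \<phi>]]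
    from tf(4) obtain B where B: "\<And>p. \<bar>\<phi> p\<bar> \<le> B" "\<And>p. \<bar>dtime \<phi> p\<bar> \<le> B" by blast
    have z0: "\<phi> p = 0" "dtime \<phi> p = 0" if "p \<notin> ?S" for p using tf(2,3) sup that by blast+
    have cont: "continuous_on UNIV \<phi>" by (rule C1_c_continuous[OF Cinf_c_C1_c[OF \<phi>]])
    have int: "integrable lebesgue (\<lambda>p. z i (fst p) * (e (snd p) * \<psi> p))"
      if i: "i \<in> I" and e: "e \<in> borel_measurable borel" "\<exists>B. \<forall>t. \<bar>e t\<bar> \<le> B" and \<psi>: "continuous_on UNIV \<psi>" "\<And>p. \<bar>\<psi> p\<bar> \<le> B"
        "\<And>p. p \<notin> ?S \<Longrightarrow> \<psi> p = 0" for i e and \<psi> :: "'a \<times> real \<Rightarrow> real"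
    proof -
      from e(2) obtain B' where B': "\<And>t. \<bar>e t\<bar> \<le> B'" by blast
      have bi: "integrable lebesgue (\<lambda>p::'a\<times>real. z i (fst p) * (indicator {0<..<T} (snd p) * (B' * B)))"
        by (rule tensor_integrable[OF z[OF i]]) auto
      have 1: "(\<lambda>p::'a \<times> real. z i (fst p)) \<in> borel_measurable lebesgue"
        using z[OF i] by (intro lebesgue_measurable_vimage_fst) simp
      have 2: "(\<lambda>p::'a \<times> real. e (snd p)) \<in> borel_measurable lebesgue"
        using e(1) by (intro lebesgue_measurable_vimage_snd measurable_completion) simp
      have 3: "\<psi> \<in> borel_measurable lebesgue"
        using borel_measurable_continuous_onI[OF \<psi>(1)] by (intro measurable_completion) simp
      have bm: "(\<lambda>p. z i (fst p) * (e (snd p) * \<psi> p)) \<in> borel_measurable lebesgue"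
        by (intro borel_measurable_times 1 2 3)
      have bb: "AE p in lebesgue. norm (z i (fst p) * (e (snd p) * \<psi> p)) \<le> norm (z i (fst p) * (indicator {0<..<T} (snd p) * (B' * B)))"
      proof (intro AE_I2)
        fix p :: "'a \<times> real"
        show "norm (z i (fst p) * (e (snd p) * \<psi> p)) \<le> norm (z i (fst p) * (indicator {0<..<T} (snd p) * (B' * B)))"
        proof (cases "p \<in> ?S")
          case True
          have "\<bar>e (snd p)\<bar> * \<bar>\<psi> p\<bar> \<le> \<bar>B'\<bar> * \<bar>B\<bar>"
            using B'[of "snd p"] \<psi>(2)[of p] by (intro mult_mono) linarith+
          then have "\<bar>z i (fst p)\<bar> * (\<bar>e (snd p)\<bar> * \<bar>\<psi> p\<bar>) \<le> \<bar>z i (fst p)\<bar> * (\<bar>B'\<bar> * \<bar>B\<bar>)"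
            by (rule mult_left_mono) simp
          with True show ?thesis by (auto simp: abs_mult)
        qed (simp add: \<psi>(3))
      qed
      show ?thesis by (rule Bochner_Integration.integrable_bound[OF bi bm bb])
    qed
    have i1: "integrable lebesgue (\<lambda>p. z i (fst p) * (c i (snd p) * dtime \<phi> p))" if "i \<in> I" for i
      using int[OF that pwC1_measurable(1)[OF cd[OF that]] bd(1)[OF that] tf(1) B(2) z0(2)] .
    have i2: "integrable lebesgue (\<lambda>p. z i (fst p) * (d i (snd p) * \<phi> p))" if "i \<in> I" for i
      using int[OF that pwC1_measurable(2)[OF cd[OF that]] bd(2)[OF that] cont B(1) z0(1)] .
    have zero: "(\<integral>p. z i (fst p) * (c i (snd p) * dtime \<phi> p) \<partial>lebesgue) + (\<integral>p. z i (fst p) * (d i (snd p) * \<phi> p) \<partial>lebesgue) = 0"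
      if i: "i \<in> I" for i
    proof -
      have "(\<integral>p. z i (fst p) * (c i (snd p) * dtime \<phi> p) \<partial>lebesgue) + (\<integral>p. z i (fst p) * (d i (snd p) * \<phi> p) \<partial>lebesgue)
         = (\<integral>p. z i (fst p) * (c i (snd p) * dtime \<phi> p) + z i (fst p) * (d i (snd p) * \<phi> p) \<partial>lebesgue)"
        using i1[OF i] i2[OF i] by simp
      also have "\<dots> = (\<integral>x. (\<integral>t. z i x * (c i t * dtime \<phi> (x, t)) + z i x * (d i t * \<phi> (x, t)) \<partial>lebesgue) \<partial>lebesgue)"
        using lebesgue_Fubini_swap[OF Bochner_Integration.integrable_add[OF i1[OF i] i2[OF i]]] by simp
      also have "\<dots> = (\<integral>x. 0 \<partial>(lebesgue :: 'a measure))"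
      proof (rule Bochner_Integration.integral_cong[OF refl])
        fix x
        have "(\<integral>t. z i x * (c i t * dtime \<phi> (x, t)) + z i x * (d i t * \<phi> (x, t)) \<partial>lebesgue)
          = (\<integral>t. z i x * (indicator {0<..<T} t * (d i t * \<phi> (x, t) + dtime \<phi> (x, t) * c i t)) \<partial>lebesgue)"
          by (rule Bochner_Integration.integral_cong) (auto simp: z0 algebra_simps indicator_def)
        also have "\<dots> = z i x * (\<integral>t. indicator {0<..<T} t * (d i t * \<phi> (x, t) + dtime \<phi> (x, t) * c i t) \<partial>lebesgue)"
          by simp
        also have "\<dots> = z i x * (c i T * \<phi> (x, T) - c i 0 * \<phi> (x, 0))"
          using pwC1_FTC[OF pwC1_mult[OF cd[OF i] tf(5)], of 0 T x] T by simp
        also have "\<dots> = 0" by (simp add: z0)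
        finally show "(\<integral>t. z i x * (c i t * dtime \<phi> (x, t)) + z i x * (d i t * \<phi> (x, t)) \<partial>lebesgue) = 0" .
      qed
      finally show ?thesis by simp
    qed
    have r: "(\<integral>p. f p * \<psi> p \<partial>lebesgue_on ?S) = (\<integral>p. f p * \<psi> p \<partial>lebesgue)"
      if "\<And>p. p \<notin> ?S \<Longrightarrow> \<psi> p = 0" for f \<psi> :: "'a \<times> real \<Rightarrow> real"
    proof (subst integral_restrict_space)
      show "(\<integral>p. indicator ?S p *\<^sub>R (f p * \<psi> p) \<partial>lebesgue) = (\<integral>p. f p * \<psi> p \<partial>lebesgue)"
      proof (rule Bochner_Integration.integral_cong[OF refl])
        fix p show "indicator ?S p *\<^sub>R (f p * \<psi> p) = f p * \<psi> p"
        proof (cases "p \<in> ?S")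
          case False
          from that[OF this] show ?thesis by simp
        qed (simp only: indicator_simps scaleR_one)
      qed
    qed (use Ss in simp)
    have "(\<integral>p. (\<Sum>i\<in>I. c i (snd p) * z i (fst p)) * dtime \<phi> p \<partial>lebesgue_on ?S)
        = (\<integral>p. (\<Sum>i\<in>I. z i (fst p) * (c i (snd p) * dtime \<phi> p)) \<partial>lebesgue)"
      by (subst r[OF z0(2)]) (simp_all add: sum_distrib_left mult_ac)
    also have "\<dots> = (\<Sum>i\<in>I. \<integral>p. z i (fst p) * (c i (snd p) * dtime \<phi> p) \<partial>lebesgue)"
      using i1 by (rule Bochner_Integration.integral_sum)
    also have "\<dots> = (\<Sum>i\<in>I. - (\<integral>p. z i (fst p) * (d i (snd p) * \<phi> p) \<partial>lebesgue))"
      using zero by (intro sum.cong refl) (simp add: eq_neg_iff_add_eq_0)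
    also have "\<dots> = - (\<integral>p. (\<Sum>i\<in>I. z i (fst p) * (d i (snd p) * \<phi> p)) \<partial>lebesgue)"
      using i2 by (subst Bochner_Integration.integral_sum) (auto simp: sum_negf)
    also have "(\<integral>p. (\<Sum>i\<in>I. z i (fst p) * (d i (snd p) * \<phi> p)) \<partial>lebesgue)
        = (\<integral>p. (\<Sum>i\<in>I. d i (snd p) * z i (fst p)) * \<phi> p \<partial>lebesgue_on ?S)"
      by (subst r[OF z0(1)]) (simp_all add: sum_distrib_left mult_ac)
    finally show ?thesis .
  qed
  show ?thesis unfolding weak_dt_def
    using K[OF _ _ pwC1_measurable(1)[OF cd] bd(1)] K[OF _ _ pwC1_measurable(2)[OF cd] bd(2)] eq
    by (auto simp del: Sigma_cong)
qed

subsection \<open>Testing the variational inequality\<close>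

locale denoising_flow = denoising +
  fixes u :: "real \<Rightarrow> 'a \<Rightarrow> real"
  assumes global_sol: "global_var_sol \<alpha> R \<Omega> u0 u"
begin

section \<open>The solution as a continuous curve in L2\<close>

lemma sol: "0 < T \<Longrightarrow> var_sol \<alpha> R \<Omega> u0 T u"
  using global_sol by (simp add: global_var_sol_def)

lemma state_u: "0 \<le> t \<Longrightarrow> state (u t)"
  using sol[of "t+1"] by (auto simp: var_sol_def L1w_def C0L2_def state_def)

lemma u_continuous: "t \<in> {0..T} \<Longrightarrow> ((\<lambda>s. dst (u s) (u t)) \<longlongrightarrow> 0) (at t within {0..T})"
proof (cases "0 < T")
  case True
  assume t: "t \<in> {0..T}"
  then have "((\<lambda>s. (dst (u s) (u t))\<^sup>2) \<longlongrightarrow> 0) (at t within {0..T})"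
    using sol[OF True] by (simp add: var_sol_def C0L2_def L2dist2_dst)
  from tendsto_real_sqrt[OF this] show ?thesis by (simp add: nrm2_nonneg)
next
  case False
  assume "t \<in> {0..T}"
  with False have "{0..T} = {t}" by auto
  then have "at t within {0..T} = bot" by (simp add: at_within_eq_bot_iff)
  then show ?thesis by simp
qed

text \<open>A convergent sequence of times is bounded, hence contained in a single interval
  \<open>{0..T}\<close> on which continuity is part of the definition of a solution.\<close>

lemma u_seq:
  fixes s :: "nat \<Rightarrow> real"
  assumes s: "\<And>i. 0 \<le> s i" "s \<longlonglongrightarrow> t"
  shows "(\<lambda>i. dst (u (s i)) (u t)) \<longlonglongrightarrow> 0"
proof -
  have t: "0 \<le> t" using s by (intro LIMSEQ_le_const) auto
  from convergent_imp_Bseq[OF convergentI[OF s(2)]] obtain K where K: "\<And>i. norm (s i) \<le> K"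
    unfolding Bseq_def by blast
  define T where "T = max K t"
  have sT: "s i \<in> {0..T}" for i using s(1)[of i] K[of i] by (simp add: T_def)
  have tT: "t \<in> {0..T}" using t by (simp add: T_def)
  have "continuous (at t within {0..T}) (\<lambda>s. dst (u s) (u t))"
    using u_continuous[OF tT] by (simp add: continuous_within nrm2_def)
  from this[unfolded continuous_within_sequentially, rule_format, of s] sT s(2)
  show ?thesis by (simp add: o_def nrm2_def)
qed

lemma u_dst_continuous:
  assumes w: "sq_int M w"
  shows "continuous_on {0..} (\<lambda>t. dst (u t) w)"
  unfolding continuous_on_sequentially
proof (intro allI ballI impI)
  fix s :: "nat \<Rightarrow> real" and t assume a: "t \<in> {0..}" "(\<forall>n. s n \<in> {0..}) \<and> s \<longlonglongrightarrow> t"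
  have "(\<lambda>i. dst (u (s i)) w) \<longlonglongrightarrow> dst (u t) w"
  proof (rule nrm2_dist_tendsto)
    show "sq_int M (u (s i))" for i using a by (auto intro: state_sq_int state_u)
    show "sq_int M (u t)" using a by (auto intro: state_sq_int state_u)
    show "(\<lambda>i. dst (u (s i)) (u t)) \<longlonglongrightarrow> 0" by (rule u_seq) (use a in auto)
    show "(\<lambda>i. dst w w) \<longlonglongrightarrow> 0" by (simp add: nrm2_def)
  qed (use w in auto)
  then show "((\<lambda>t. dst (u t) w) \<circ> s) \<longlonglongrightarrow> dst (u t) w" by (simp add: o_def)
qed

lemma u_inner_continuous:
  assumes w: "sq_int M w"
  shows "continuous_on {0..} (\<lambda>t. \<integral>x. w x * u t x \<partial>M)"
  unfolding continuous_on_sequentially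
proof (intro allI ballI impI)
  fix s :: "nat \<Rightarrow> real" and t assume a: "t \<in> {0..}" "(\<forall>n. s n \<in> {0..}) \<and> s \<longlonglongrightarrow> t"
  have "(\<lambda>i. \<integral>x. w x * u (s i) x \<partial>M) \<longlonglongrightarrow> (\<integral>x. w x * u t x \<partial>M)"
  proof (rule L2_inner_tendsto)
    show "sq_int M (u (s i))" for i using a by (auto intro: state_sq_int state_u)
    show "sq_int M (u t)" using a by (auto intro: state_sq_int state_u)
    show "(\<lambda>i. dst (u (s i)) (u t)) \<longlonglongrightarrow> 0" by (rule u_seq) (use a in auto)
  qed (use w in auto)
  then show "((\<lambda>t. \<integral>x. w x * u t x \<partial>M) \<circ> s) \<longlonglongrightarrow> (\<integral>x. w x * u t x \<partial>M)" by (simp add: o_def)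
qed

lemma u_nrm2_bounded: "\<exists>B. \<forall>t\<in>{0..T}. nrm2 M (u t) \<le> B"
proof -
  have "continuous_on {0..T} (\<lambda>t. dst (u t) (\<lambda>x. 0))"
    by (rule continuous_on_subset[OF u_dst_continuous[OF sq_int_zero]]) auto
  then have "compact ((\<lambda>t. dst (u t) (\<lambda>x. 0)) ` {0..T})"
    by (rule compact_continuous_image) simp
  from compact_imp_bounded[OF this] obtain B where "\<forall>y\<in>(\<lambda>t. dst (u t) (\<lambda>x. 0)) ` {0..T}. norm y \<le> B"
    unfolding bounded_iff by (elim exE)
  then show ?thesis by (intro exI[of _ B]) auto
qed

section \<open>Integration over the space-time cylinder\<close>

lemma cylinder_sets[measurable, simp]: "\<Omega> \<times> {0<..<T::real} \<in> sets lebesgue" "(UNIV :: 'a set) \<times> {0<..<T::real} \<in> sets lebesgue"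
proof -
  have "open (\<Omega> \<times> {0<..<T})" "open ((UNIV :: 'a set) \<times> {0<..<T})"
    using open_\<Omega> by (intro open_Times; simp)+
  then show "\<Omega> \<times> {0<..<T} \<in> sets lebesgue" "(UNIV :: 'a set) \<times> {0<..<T} \<in> sets lebesgue" by simp_all
qed

abbreviation MT :: "real \<Rightarrow> ('a \<times> real) measure" where "MT T \<equiv> lebesgue_on (\<Omega> \<times> {0<..<T})"

lemma indicator_cylinder: "(indicator (\<Omega> \<times> {0<..<T}) (x, t) :: 'b::semiring_1) = indicator \<Omega> x * indicator {0<..<T} t"
  by (simp add: indicator_def)

lemma finite_MT: "finite_measure (MT T)"
proof
  have "bounded (\<Omega> \<times> {0<..<T})" using bounded_\<Omega> by (intro bounded_Times) auto
  then have "emeasure lborel (\<Omega> \<times> {0<..<T}) < \<infinity>" by (rule emeasure_bounded_finite)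
  moreover have "open (\<Omega> \<times> {0<..<T})" using open_\<Omega> by (intro open_Times) auto
  ultimately show "emeasure (MT T) (space (MT T)) \<noteq> \<infinity>"
    by (simp add: emeasure_restrict_space)
qed

lemma cylinder_Fubini:
  fixes h :: "'a \<times> real \<Rightarrow> real"
  assumes "integrable (MT T) h"
  shows "(\<integral>p. h p \<partial>MT T) = (\<integral>t. indicator {0<..<T} t * (\<integral>x. h (x, t) \<partial>M) \<partial>lebesgue)"
proof -
  let ?S = "\<Omega> \<times> {0<..<T}"
  have i: "integrable lebesgue (\<lambda>p. indicator ?S p *\<^sub>R h p)"
    using assms integrable_restrict_space[of ?S lebesgue h] by simp
  have "(\<integral>p. h p \<partial>MT T) = (\<integral>p. indicator ?S p *\<^sub>R h p \<partial>lebesgue)"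
    by (subst integral_restrict_space) auto
  also have "\<dots> = (\<integral>t. (\<integral>x. indicator ?S (x, t) *\<^sub>R h (x, t) \<partial>lebesgue) \<partial>lebesgue)"
    by (rule lebesgue_Fubini[OF i])
  also have "\<dots> = (\<integral>t. indicator {0<..<T} t * (\<integral>x. h (x, t) \<partial>M) \<partial>lebesgue)"
  proof (rule Bochner_Integration.integral_cong[OF refl])
    fix t :: real
    have "(\<integral>x. indicator ?S (x, t) *\<^sub>R h (x, t) \<partial>lebesgue) = (\<integral>x. indicator {0<..<T} t * (indicator \<Omega> x * h (x, t)) \<partial>lebesgue)"
      by (simp add: indicator_cylinder mult_ac)
    also have "\<dots> = indicator {0<..<T} t * (\<integral>x. indicator \<Omega> x * h (x, t) \<partial>lebesgue)" by simp
    also have "(\<integral>x. indicator \<Omega> x * h (x, t) \<partial>lebesgue) = (\<integral>x. h (x, t) \<partial>M)"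
      by (subst integral_restrict_space) auto
    finally show "(\<integral>x. indicator ?S (x, t) *\<^sub>R h (x, t) \<partial>lebesgue) = indicator {0<..<T} t * (\<integral>x. h (x, t) \<partial>M)" .
  qed
  finally show ?thesis .
qed

lemma cylinder_Tonelli:
  fixes h :: "'a \<times> real \<Rightarrow> ennreal"
  assumes "h \<in> borel_measurable (MT T)"
  shows "(\<integral>\<^sup>+p. h p \<partial>MT T) = (\<integral>\<^sup>+t. indicator {0<..<T} t * (\<integral>\<^sup>+x. h (x, t) \<partial>M) \<partial>lebesgue)"
proof -
  let ?S = "\<Omega> \<times> {0<..<T}"
  have i: "(\<lambda>p. h p * indicator ?S p) \<in> borel_measurable lebesgue"
    using assms by (simp add: borel_measurable_restrict_space_iff_ennreal)
  have "(\<integral>\<^sup>+p. h p \<partial>MT T) = (\<integral>\<^sup>+p. h p * indicator ?S p \<partial>lebesgue)"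
    by (subst nn_integral_restrict_space) auto
  also have "\<dots> = (\<integral>\<^sup>+t. (\<integral>\<^sup>+x. h (x, t) * indicator ?S (x, t) \<partial>lebesgue) \<partial>lebesgue)"
    by (rule lebesgue_Tonelli[OF i])
  also have "\<dots> = (\<integral>\<^sup>+t. indicator {0<..<T} t * (\<integral>\<^sup>+x. h (x, t) \<partial>M) \<partial>lebesgue)"
  proof (rule nn_integral_cong)
    fix t :: real
    have "(\<integral>\<^sup>+x. h (x, t) * indicator ?S (x, t) \<partial>lebesgue) = indicator {0<..<T} t * (\<integral>\<^sup>+x. h (x, t) * indicator \<Omega> x \<partial>lebesgue)"
      unfolding indicator_cylinder by (cases "t \<in> {0<..<T}") auto
    also have "(\<integral>\<^sup>+x. h (x, t) * indicator \<Omega> x \<partial>lebesgue) = (\<integral>\<^sup>+x. h (x, t) \<partial>M)"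
      by (subst nn_integral_restrict_space) auto
    finally show "(\<integral>\<^sup>+x. h (x, t) * indicator ?S (x, t) \<partial>lebesgue) = indicator {0<..<T} t * (\<integral>\<^sup>+x. h (x, t) \<partial>M)" .
  qed
  finally show ?thesis .
qed

lemma u_joint_measurable:
  assumes "0 < T" shows "(\<lambda>p. u (snd p) (fst p)) \<in> borel_measurable (MT T)"
proof -
  have "integrable (lebesgue_on (UNIV \<times> {0<..<T})) (\<lambda>p. u (snd p) (fst p))"
    using sol[OF assms] by (simp add: var_sol_def L1w_def)
  then have "(\<lambda>p. u (snd p) (fst p)) \<in> borel_measurable (lebesgue_on (UNIV \<times> {0<..<T}))"
    by (rule borel_measurable_integrable)
  then show ?thesis by (rule measurable_restrict_mono) auto
qed

text \<open>Joint measurability is assumed separately, since measurability of the time slices does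
  not imply it. Both the square integrability of \<open>u\<close> on the cylinder and the uniform
  closeness of the interpolations to \<open>u\<close> are used through this bound.\<close>

lemma bounded_time_sq_int:
  assumes T: "0 < T" and f: "f \<in> borel_measurable (MT T)"
    and s: "\<And>t. t \<in> {0<..<T} \<Longrightarrow> sq_int M (\<lambda>x. f (x, t))"
    and b: "\<And>t. t \<in> {0<..<T} \<Longrightarrow> nrm2 M (\<lambda>x. f (x, t)) \<le> B"
  shows "sq_int (MT T) f" "nrm2 (MT T) f \<le> sqrt T * B"
proof -
  have B0: "0 \<le> B" using b[of "T/2"] nrm2_nonneg[of M "\<lambda>x. f (x, T/2)"] T by auto
  have "(\<integral>\<^sup>+p. ennreal ((f p)\<^sup>2) \<partial>MT T) = (\<integral>\<^sup>+t. indicator {0<..<T} t * (\<integral>\<^sup>+x. ennreal ((f (x, t))\<^sup>2) \<partial>M) \<partial>lebesgue)"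
    by (rule cylinder_Tonelli) (use f in measurable)
  also have "\<dots> \<le> (\<integral>\<^sup>+t. ennreal (B\<^sup>2) * indicator {0<..<T} t \<partial>lebesgue)"
  proof (rule nn_integral_mono)
    fix t
    show "indicator {0<..<T} t * (\<integral>\<^sup>+x. ennreal ((f (x, t))\<^sup>2) \<partial>M) \<le> ennreal (B\<^sup>2) * indicator {0<..<T} t"
    proof (cases "t \<in> {0<..<T}")
      case True
      have "(\<integral>\<^sup>+x. ennreal ((f (x, t))\<^sup>2) \<partial>M) \<le> ennreal (B\<^sup>2)"
        unfolding nn_integral_sq_eq_nrm2[OF s[OF True]]
        by (intro ennreal_leI power_mono b[OF True] nrm2_nonneg)
      with True show ?thesis by simp
    qed simp
  qed
  also have "\<dots> = ennreal (B\<^sup>2) * ennreal T"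
    using T by (subst nn_integral_cmult_indicator) auto
  also have "\<dots> = ennreal ((sqrt T * B)\<^sup>2)"
    using T by (simp add: ennreal_mult[symmetric] power_mult_distrib mult.commute)
  finally have "(\<integral>\<^sup>+p. ennreal ((f p)\<^sup>2) \<partial>MT T) \<le> ennreal ((sqrt T * B)\<^sup>2)" .
  from nrm2_le_if_nn_integral_le[OF f this] B0 T show "sq_int (MT T) f" "nrm2 (MT T) f \<le> sqrt T * B"
    by simp_all
qed

lemma u_joint_sq_int: "0 < T \<Longrightarrow> sq_int (MT T) (\<lambda>p. u (snd p) (fst p))"
proof -
  assume T: "0 < T"
  obtain B where B: "\<forall>t\<in>{0..T}. nrm2 M (u t) \<le> B" using u_nrm2_bounded by blast
  show ?thesis
    by (rule bounded_time_sq_int(1)[OF T u_joint_measurable[OF T], of B])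
       (use B state_sq_int[OF state_u] in auto)
qed

section \<open>Finite tensor sums as admissible test functions\<close>

lemma tensor_sum_measurable:
  fixes z :: "'i \<Rightarrow> 'a \<Rightarrow> real" and d :: "'i \<Rightarrow> real \<Rightarrow> real"
  assumes z: "\<And>i. i \<in> I \<Longrightarrow> integrable lebesgue (z i)" and d: "\<And>i. i \<in> I \<Longrightarrow> d i \<in> borel_measurable borel"
  shows "(\<lambda>p. \<Sum>i\<in>I. d i (snd p) * z i (fst p)) \<in> borel_measurable (lebesgue :: ('a \<times> real) measure)"
proof (rule borel_measurable_sum)
  fix i assume i: "i \<in> I"
  have "(\<lambda>p::'a \<times> real. z i (fst p)) \<in> borel_measurable lebesgue"
    by (rule lebesgue_measurable_vimage_fst) (use z[OF i] in simp)
  moreover have "(\<lambda>p::'a \<times> real. d i (snd p)) \<in> borel_measurable lebesgue"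
    by (intro lebesgue_measurable_vimage_snd measurable_completion) (use d[OF i] in simp)
  ultimately show "(\<lambda>p::'a \<times> real. d i (snd p) * z i (fst p)) \<in> borel_measurable lebesgue"
    by (intro borel_measurable_times)
qed

lemma tensor_sum_sq_int:
  fixes z :: "'i \<Rightarrow> 'a \<Rightarrow> real" and d :: "'i \<Rightarrow> real \<Rightarrow> real"
  assumes T: "0 < T" and z: "\<And>i. i \<in> I \<Longrightarrow> integrable lebesgue (z i)" "\<And>i. i \<in> I \<Longrightarrow> sq_int M (z i)"
    and d: "\<And>i. i \<in> I \<Longrightarrow> d i \<in> borel_measurable borel"
    and b: "\<And>i. i \<in> I \<Longrightarrow> \<exists>B. \<forall>t. \<bar>d i t\<bar> \<le> B"
  shows "sq_int (MT T) (\<lambda>p. \<Sum>i\<in>I. d i (snd p) * z i (fst p))"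
proof (rule sq_int_sum)
  fix i assume i: "i \<in> I"
  from b[OF i] obtain B where B: "\<And>t. \<bar>d i t\<bar> \<le> B" by blast
  have "(\<lambda>p::'a \<times> real. \<Sum>i\<in>{i}. d i (snd p) * z i (fst p)) \<in> borel_measurable lebesgue"
    by (rule tensor_sum_measurable) (use i z d in auto)
  then have m: "(\<lambda>p::'a \<times> real. d i (snd p) * z i (fst p)) \<in> borel_measurable (MT T)"
    by (simp add: measurable_restrict_space1)
  show "sq_int (MT T) (\<lambda>p. d i (snd p) * z i (fst p))"
  proof (rule bounded_time_sq_int(1)[OF T m, of "B * nrm2 M (z i)"])
    fix t
    show "sq_int M (\<lambda>x. d i (snd (x, t)) * z i (fst (x, t)))"
      using sq_int_cmult[OF z(2)[OF i]] by simp
    show "nrm2 M (\<lambda>x. d i (snd (x, t)) * z i (fst (x, t))) \<le> B * nrm2 M (z i)"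
      using B[of t] by (simp add: nrm2_cmult mult_right_mono nrm2_nonneg)
  qed
qed

lemma L1w_tensor_sum:
  fixes w :: "'i \<Rightarrow> 'a \<Rightarrow> real"
  assumes T: "0 < T" and I: "finite I" and w: "\<And>i. i \<in> I \<Longrightarrow> state (w i)" and cd: "\<And>i. i \<in> I \<Longrightarrow> pwC1 (c i) (d i)"
    and c0: "\<And>i t. i \<in> I \<Longrightarrow> 0 \<le> c i t" and c1: "\<And>t. (\<Sum>i\<in>I. c i t) = 1"
  shows "L1w \<alpha> \<Omega> u0 T (\<lambda>t x. \<Sum>i\<in>I. c i t * w i x)"
  unfolding L1w_def
proof (intro conjI ballI allI impI)
  have st: "state (\<lambda>x. \<Sum>i\<in>I. c i t * w i x)" for t
    by (rule state_convex[OF I w c0 c1])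
  then show "BVG_bc \<alpha> \<Omega> u0 (\<lambda>x. \<Sum>i\<in>I. c i t * w i x)" for t by (simp add: state_def)
  have "integrable (lebesgue_on (UNIV \<times> {0<..<T})) (\<lambda>p. c i (snd p) * w i (fst p))" if i: "i \<in> I" for i
  proof -
    obtain B where B: "\<And>t. \<bar>c i t\<bar> \<le> B" using pwC1_bound[OF cd[OF i]] by metis
    have "integrable lebesgue (\<lambda>p. w i (fst p) * (indicator {0<..<T} (snd p) * c i (snd p)))"
      by (rule tensor_integrable[OF state_integrable[OF w[OF i]] pwC1_measurable(1)[OF cd[OF i]] B])
    also have "(\<lambda>p. w i (fst p) * (indicator {0<..<T} (snd p) * c i (snd p))) = (\<lambda>p. indicator (UNIV \<times> {0<..<T}) p *\<^sub>R (c i (snd p) * w i (fst p)))"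
      by (auto simp: indicator_def)
    finally show ?thesis by (subst integrable_restrict_space) auto
  qed
  then show "integrable (lebesgue_on (UNIV \<times> {0<..<T})) (\<lambda>p. \<Sum>i\<in>I. c i (snd p) * w i (fst p))"
    by (rule Bochner_Integration.integrable_sum)
  show "(\<lambda>t. \<integral>x. (\<Sum>i\<in>I. c i t * w i x) * divG \<alpha> \<Phi> x \<partial>lebesgue) \<in> borel_measurable (lebesgue_on {0..T})"
    if \<Phi>: "C1_c \<Phi>" for \<Phi>
  proof -
    note int = integrable_mult_divG[OF \<Phi> \<alpha> state_integrable[OF w]]
    have "(\<lambda>t. \<integral>x. (\<Sum>i\<in>I. c i t * w i x) * divG \<alpha> \<Phi> x \<partial>lebesgue) = (\<lambda>t. \<Sum>i\<in>I. c i t * (\<integral>x. w i x * divG \<alpha> \<Phi> x \<partial>lebesgue))"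
    proof
      fix t
      have "(\<integral>x. (\<Sum>i\<in>I. c i t * w i x) * divG \<alpha> \<Phi> x \<partial>lebesgue) = (\<integral>x. (\<Sum>i\<in>I. c i t * (w i x * divG \<alpha> \<Phi> x)) \<partial>lebesgue)"
        by (simp add: sum_distrib_right mult.assoc)
      then show "(\<integral>x. (\<Sum>i\<in>I. c i t * w i x) * divG \<alpha> \<Phi> x \<partial>lebesgue) = (\<Sum>i\<in>I. c i t * (\<integral>x. w i x * divG \<alpha> \<Phi> x \<partial>lebesgue))"
        using int by (subst (asm) Bochner_Integration.integral_sum) auto
    qed
    moreover have "\<dots> \<in> borel_measurable (lebesgue_on {0..T})"
      by (intro borel_measurable_sum borel_measurable_times borel_measurable_const measurable_restrict_space1 measurable_completion)
         (use pwC1_measurable(1)[OF cd] in simp)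
    ultimately show ?thesis by simp
  qed
  have c_le: "c i t \<le> 1" if "i \<in> I" for i t
    using member_le_sum[of i I "\<lambda>i. c i t"] c0 c1[of t] I that by auto
  have "(\<integral>\<^sup>+ t\<in>{0..T}. TVG \<alpha> (\<lambda>x. \<Sum>i\<in>I. c i t * w i x) \<partial>lebesgue) \<le> (\<integral>\<^sup>+ t\<in>{0..T}. (\<Sum>i\<in>I. TVG \<alpha> (w i)) \<partial>lebesgue)"
  proof (intro nn_integral_mono mult_right_mono)
    fix t
    have "TVG \<alpha> (\<lambda>x. \<Sum>i\<in>I. c i t * w i x) \<le> (\<Sum>i\<in>I. ennreal (c i t) * TVG \<alpha> (w i))"
      by (rule TVG_sum_le[OF \<alpha> state_integrable[OF w] c0])
    also have "\<dots> \<le> (\<Sum>i\<in>I. 1 * TVG \<alpha> (w i))"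
      using c_le by (intro sum_mono mult_right_mono) (auto simp: ennreal_le_1)
    finally show "TVG \<alpha> (\<lambda>x. \<Sum>i\<in>I. c i t * w i x) \<le> (\<Sum>i\<in>I. TVG \<alpha> (w i))" by simp
  qed simp
  also have "\<dots> = (\<Sum>i\<in>I. TVG \<alpha> (w i)) * ennreal T"
    using T by (subst nn_integral_cmult_indicator) auto
  also have "\<dots> < \<infinity>"
    using I state_TVG[OF w] by (auto simp: ennreal_mult_less_top less_top)
  finally show "(\<integral>\<^sup>+ t\<in>{0..T}. TVG \<alpha> (\<lambda>x. \<Sum>i\<in>I. c i t * w i x) \<partial>lebesgue) < \<infinity>" .
qed

lemma C0L2_tensor_sum:
  fixes w :: "'i \<Rightarrow> 'a \<Rightarrow> real"
  assumes I: "finite I" and w: "\<And>i. i \<in> I \<Longrightarrow> state (w i)" and cd: "\<And>i. i \<in> I \<Longrightarrow> pwC1 (c i) (d i)"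
  shows "C0L2 \<Omega> T (\<lambda>t x. \<Sum>i\<in>I. c i t * w i x)"
  unfolding C0L2_def
proof (intro conjI ballI)
  have sq: "sq_int M (\<lambda>x. \<Sum>i\<in>I. a i * w i x)" for a
    by (intro sq_int_sum sq_int_cmult state_sq_int w)
  then show "L2on \<Omega> (\<lambda>x. \<Sum>i\<in>I. c i t * w i x)" for t by (simp add: L2on_sq_int)
  have le: "nrm2 M (\<lambda>x. \<Sum>i\<in>J. a i * w i x) \<le> (\<Sum>i\<in>J. \<bar>a i\<bar> * nrm2 M (w i))" if "J \<subseteq> I" for J a
    using finite_subset[OF that I] that
  proof (induction J rule: finite_induct)
    case (insert i J)
    have "nrm2 M (\<lambda>x. a i * w i x + (\<Sum>i\<in>J. a i * w i x)) \<le> nrm2 M (\<lambda>x. a i * w i x) + nrm2 M (\<lambda>x. \<Sum>i\<in>J. a i * w i x)"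
      using insert by (intro nrm2_triangle sq_int_sum sq_int_cmult state_sq_int w) auto
    with insert show ?case by (simp add: nrm2_cmult)
  qed (simp add: nrm2_def)
  fix t
  have "((\<lambda>s. dst (\<lambda>x. \<Sum>i\<in>I. c i s * w i x) (\<lambda>x. \<Sum>i\<in>I. c i t * w i x)) \<longlongrightarrow> 0) (at t within {0..T})"
  proof (rule Lim_null_comparison)
    show "\<forall>\<^sub>F s in at t within {0..T}. norm (dst (\<lambda>x. \<Sum>i\<in>I. c i s * w i x) (\<lambda>x. \<Sum>i\<in>I. c i t * w i x))
        \<le> (\<Sum>i\<in>I. \<bar>c i s - c i t\<bar> * nrm2 M (w i))"
      using le[of I "\<lambda>i. c i s - c i t" for s]
      by (intro always_eventually allI) (simp add: nrm2_nonneg left_diff_distrib sum_subtractf)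
    have ct: "((\<lambda>s. c i s) \<longlongrightarrow> c i t) (at t within {0..T})" if "i \<in> I" for i
    proof -
      have "isCont (c i) t" using cd[OF that] by (simp add: pwC1_def continuous_on_eq_continuous_at)
      then show ?thesis by (metis continuous_at_imp_continuous_at_within continuous_within)
    qed
    have "((\<lambda>s. \<Sum>i\<in>I. \<bar>c i s - c i t\<bar> * nrm2 M (w i)) \<longlongrightarrow> (\<Sum>i\<in>I. \<bar>c i t - c i t\<bar> * nrm2 M (w i))) (at t within {0..T})"
      by (intro tendsto_intros ct)
    then show "((\<lambda>s. \<Sum>i\<in>I. \<bar>c i s - c i t\<bar> * nrm2 M (w i)) \<longlongrightarrow> 0) (at t within {0..T})" by simp
  qed
  from tendsto_power[OF this, of 2]
  show "((\<lambda>s. L2dist2 \<Omega> (\<lambda>x. \<Sum>i\<in>I. c i s * w i x) (\<lambda>x. \<Sum>i\<in>I. c i t * w i x)) \<longlongrightarrow> 0) (at t within {0..T})"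
    by (simp add: L2dist2_dst)
qed

text \<open>The product of \<open>v\<close> with its own time derivative is the derivative of half
  the squared norm, which is a quadratic form \<open>q\<close> in the coefficients given by the Gram
  matrix of the \<open>w i\<close>; it contributes boundary terms only. The part containing
  \<open>u\<close> is kept as it stands because \<open>u\<close> has no known time derivative
  yet.\<close>

lemma tensor_sum_pairing:
  fixes w :: "'i \<Rightarrow> 'a \<Rightarrow> real"
  assumes T: "0 < T" and I: "finite I" and w: "\<And>i. i \<in> I \<Longrightarrow> state (w i)" and cd: "\<And>i. i \<in> I \<Longrightarrow> pwC1 (c i) (d i)"
  shows "(\<integral>p. (\<Sum>i\<in>I. d i (snd p) * w i (fst p)) * ((\<Sum>i\<in>I. c i (snd p) * w i (fst p)) - u (snd p) (fst p)) \<partial>MT T)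
    = 1/2 * (nrm2 M (\<lambda>x. \<Sum>i\<in>I. c i T * w i x))\<^sup>2 - 1/2 * (nrm2 M (\<lambda>x. \<Sum>i\<in>I. c i 0 * w i x))\<^sup>2
      - (\<Sum>i\<in>I. \<integral>t. indicator {0<..<T} t * (d i t * (\<integral>x. w i x * u t x \<partial>M)) \<partial>lebesgue)"
proof -
  let ?G = "\<lambda>i j. \<integral>x. w i x * w j x \<partial>M" and ?U = "\<lambda>i t. \<integral>x. w i x * u t x \<partial>M"
  let ?i = "\<lambda>t. indicator {0<..<T} t :: real"
  note sw = state_sq_int[OF w]
  have Gs: "?G i j = ?G j i" for i j by (simp add: mult.commute)
  have bd: "\<exists>B. \<forall>t. \<bar>c i t\<bar> \<le> B" "\<exists>B. \<forall>t. \<bar>d i t\<bar> \<le> B" if "i \<in> I" for i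
    using cd[OF that] by (auto simp: pwC1_def)
  have sv: "sq_int (MT T) (\<lambda>p. \<Sum>i\<in>I. c i (snd p) * w i (fst p))"
    by (rule tensor_sum_sq_int[OF T state_integrable[OF w] state_sq_int[OF w] pwC1_measurable(1)[OF cd] bd(1)])
  have sg: "sq_int (MT T) (\<lambda>p. \<Sum>i\<in>I. d i (snd p) * w i (fst p))"
    by (rule tensor_sum_sq_int[OF T state_integrable[OF w] state_sq_int[OF w] pwC1_measurable(2)[OF cd] bd(2)])
  have int: "integrable (MT T) (\<lambda>p. (\<Sum>i\<in>I. d i (snd p) * w i (fst p)) * ((\<Sum>i\<in>I. c i (snd p) * w i (fst p)) - u (snd p) (fst p)))"
    by (intro sq_int_prod sg sq_int_diff sv u_joint_sq_int T)
  define q where "q t = (\<Sum>i\<in>I. \<Sum>j\<in>I. (?G i j / 2) * (c i t * c j t))" for t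
  define q' where "q' t = (\<Sum>i\<in>I. \<Sum>j\<in>I. (?G i j / 2) * (d i t * c j t + d j t * c i t))" for t
  have pq: "pwC1 q q'"
    unfolding q_def q'_def by (intro pwC1_sum pwC1_cmult pwC1_mult cd)
  have nq: "(nrm2 M (\<lambda>x. \<Sum>i\<in>I. c i t * w i x))\<^sup>2 = 2 * q t" for t
  proof -
    have "(nrm2 M (\<lambda>x. \<Sum>i\<in>I. c i t * w i x))\<^sup>2 = (\<integral>x. (\<Sum>i\<in>I. \<Sum>j\<in>I. (c i t * c j t) * (w i x * w j x)) \<partial>M)"
      unfolding nrm2_sq by (simp only: power2_eq_square sum_product mult_ac)
    also have "\<dots> = (\<Sum>i\<in>I. \<Sum>j\<in>I. (c i t * c j t) * ?G i j)"
      using sq_int_prod[OF sw sw] by (simp add: Bochner_Integration.integral_sum)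
    finally show ?thesis unfolding q_def by (simp add: sum_distrib_left mult_ac)
  qed
  have q'_eq: "q' t = (\<Sum>i\<in>I. \<Sum>j\<in>I. (d i t * c j t) * ?G i j)" for t
  proof -
    have "q' t = (\<Sum>i\<in>I. \<Sum>j\<in>I. (?G i j / 2) * (d i t * c j t)) + (\<Sum>i\<in>I. \<Sum>j\<in>I. (?G i j / 2) * (d j t * c i t))"
      unfolding q'_def by (simp add: distrib_left sum.distrib)
    \<comment> \<open>Exchanging the indices and using the symmetry of the Gram matrix, the two
      halves of the product rule coincide.\<close>
    also have "(\<Sum>i\<in>I. \<Sum>j\<in>I. (?G i j / 2) * (d j t * c i t)) = (\<Sum>i\<in>I. \<Sum>j\<in>I. (?G i j / 2) * (d i t * c j t))"
      by (subst sum.swap) (simp add: Gs)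
    finally show ?thesis by (simp add: sum.distrib[symmetric] mult_ac)
  qed
  have inner: "?i t * (\<integral>x. (\<Sum>i\<in>I. d i t * w i x) * ((\<Sum>i\<in>I. c i t * w i x) - u t x) \<partial>M)
     = ?i t * q' t - (\<Sum>i\<in>I. ?i t * (d i t * ?U i t))" for t
  proof (cases "t \<in> {0<..<T}")
    case True
    then have su: "sq_int M (u t)" by (intro state_sq_int state_u) auto
    have "(\<integral>x. (\<Sum>i\<in>I. d i t * w i x) * ((\<Sum>i\<in>I. c i t * w i x) - u t x) \<partial>M)
      = (\<integral>x. (\<Sum>i\<in>I. \<Sum>j\<in>I. (d i t * c j t) * (w i x * w j x)) - (\<Sum>i\<in>I. d i t * (w i x * u t x)) \<partial>M)"
      unfolding right_diff_distrib sum_product unfolding sum_distrib_right by (simp only: mult_ac)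
    also have "\<dots> = (\<integral>x. (\<Sum>i\<in>I. \<Sum>j\<in>I. (d i t * c j t) * (w i x * w j x)) \<partial>M) - (\<integral>x. (\<Sum>i\<in>I. d i t * (w i x * u t x)) \<partial>M)"
      by (intro Bochner_Integration.integral_diff Bochner_Integration.integrable_sum integrable_mult_right sq_int_prod sw su)
    also have "(\<integral>x. (\<Sum>i\<in>I. \<Sum>j\<in>I. (d i t * c j t) * (w i x * w j x)) \<partial>M) = q' t"
      unfolding q'_eq using sq_int_prod[OF sw sw] by (simp add: Bochner_Integration.integral_sum)
    also have "(\<integral>x. (\<Sum>i\<in>I. d i t * (w i x * u t x)) \<partial>M) = (\<Sum>i\<in>I. d i t * ?U i t)"
      using sq_int_prod[OF sw su] by (simp add: Bochner_Integration.integral_sum)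
    finally show ?thesis using True by simp
  qed simp
  have iq: "integrable lebesgue (\<lambda>t. ?i t * q' t)"
  proof -
    obtain B where "\<And>t. \<bar>q' t\<bar> \<le> B" using pwC1_bound[OF pq] by metis
    then show ?thesis
      using pwC1_measurable(2)[OF pq] by (intro integrable_bounded_on_interval[where B=B] measurable_completion) auto
  qed
  have iU: "integrable lebesgue (\<lambda>t. ?i t * (d i t * ?U i t))" if i: "i \<in> I" for i
  proof -
    obtain B where B: "0 \<le> B" "\<And>t. \<bar>d i t\<bar> \<le> B" using pwC1_bound[OF cd[OF i]] by metis
    obtain C where C: "\<And>t. t \<in> {0..T} \<Longrightarrow> nrm2 M (u t) \<le> C" using u_nrm2_bounded by metis
    \<comment> \<open>The inner product with \<open>u t\<close> is continuous for nonnegative times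
      only, so it is cut off to the interval before measurability is claimed.\<close>
    have m: "(\<lambda>t. ?i t *\<^sub>R ?U i t) \<in> borel_measurable borel"
      by (rule borel_measurable_continuous_on_indicator)
         (auto intro: continuous_on_subset[OF u_inner_continuous[OF sw[OF i]]])
    have "(\<lambda>t. d i t * (?i t *\<^sub>R ?U i t)) \<in> borel_measurable lebesgue"
      by (intro borel_measurable_times measurable_completion) (use m pwC1_measurable(2)[OF cd[OF i]] in simp_all)
    then have "integrable lebesgue (\<lambda>t. ?i t * (d i t * (?i t *\<^sub>R ?U i t)))"
    proof (rule integrable_bounded_on_interval[where B="B * (nrm2 M (w i) * C)"])
      fix t assume t: "0 < t" "t < T"
      have "\<bar>?U i t\<bar> \<le> nrm2 M (w i) * nrm2 M (u t)"
        by (rule L2_Cauchy_Schwarz[OF sw[OF i] state_sq_int[OF state_u]]) (use t in simp)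
      also have "\<dots> \<le> nrm2 M (w i) * C" using C t by (intro mult_left_mono nrm2_nonneg) auto
      finally have "\<bar>d i t\<bar> * \<bar>?U i t\<bar> \<le> B * (nrm2 M (w i) * C)"
        using B by (intro mult_mono) auto
      then show "\<bar>d i t * (?i t *\<^sub>R ?U i t)\<bar> \<le> B * (nrm2 M (w i) * C)" using t by (simp add: abs_mult)
    qed
    moreover have "(\<lambda>t. ?i t * (d i t * (?i t *\<^sub>R ?U i t))) = (\<lambda>t. ?i t * (d i t * ?U i t))"
      by (auto simp: indicator_def)
    ultimately show ?thesis by simp
  qed
  have "(\<integral>p. (\<Sum>i\<in>I. d i (snd p) * w i (fst p)) * ((\<Sum>i\<in>I. c i (snd p) * w i (fst p)) - u (snd p) (fst p)) \<partial>MT T)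
     = (\<integral>t. ?i t * q' t - (\<Sum>i\<in>I. ?i t * (d i t * ?U i t)) \<partial>lebesgue)"
    unfolding cylinder_Fubini[OF int] by (simp add: inner)
  also have "\<dots> = (\<integral>t. ?i t * q' t \<partial>lebesgue) - (\<integral>t. (\<Sum>i\<in>I. ?i t * (d i t * ?U i t)) \<partial>lebesgue)"
    by (intro Bochner_Integration.integral_diff iq Bochner_Integration.integrable_sum iU)
  also have "(\<integral>t. ?i t * q' t \<partial>lebesgue) = q T - q 0" using pwC1_FTC[OF pq] T by simp
  also have "(\<integral>t. (\<Sum>i\<in>I. ?i t * (d i t * ?U i t)) \<partial>lebesgue) = (\<Sum>i\<in>I. \<integral>t. ?i t * (d i t * ?U i t) \<partial>lebesgue)"
    using iU by (rule Bochner_Integration.integral_sum)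
  finally show ?thesis unfolding nq by simp
qed

text \<open>A real majorant \<open>A\<close> of the energy of the test function turns the
  extended-real inequality into one between \<open>ennreal\<close> numbers. Nonnegativity of
  \<open>B\<close> is kept as a separate conclusion because \<open>ennreal B\<close> alone would
  hide a negative value.\<close>

lemma variational_inequality_tensor_sum:
  fixes w :: "'i \<Rightarrow> 'a \<Rightarrow> real"
  assumes T: "0 < T" and I: "finite I" and w: "\<And>i. i \<in> I \<Longrightarrow> state (w i)" and cd: "\<And>i. i \<in> I \<Longrightarrow> pwC1 (c i) (d i)"
    and c0: "\<And>i t. i \<in> I \<Longrightarrow> 0 \<le> c i t" and c1: "\<And>t. (\<Sum>i\<in>I. c i t) = 1"
    and A: "(\<integral>\<^sup>+ t\<in>{0..T}. F (\<lambda>x. \<Sum>i\<in>I. c i t * w i x) \<partial>lebesgue) \<le> ennreal A" "0 \<le> A"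
    and Bd: "B = 1/2 * (nrm2 M (\<lambda>x. \<Sum>i\<in>I. c i T * w i x))\<^sup>2 - 1/2 * (nrm2 M (\<lambda>x. \<Sum>i\<in>I. c i 0 * w i x))\<^sup>2
      - (\<Sum>i\<in>I. \<integral>t. indicator {0<..<T} t * (d i t * (\<integral>x. w i x * u t x \<partial>M)) \<partial>lebesgue) + A
      - 1/2 * (dst (\<lambda>x. \<Sum>i\<in>I. c i T * w i x) (u T))\<^sup>2 + 1/2 * (dst (\<lambda>x. \<Sum>i\<in>I. c i 0 * w i x) u0)\<^sup>2"
  shows "(\<integral>\<^sup>+ t\<in>{0..T}. F (u t) \<partial>lebesgue) \<le> ennreal B" "0 \<le> B"
proof -
  let ?v = "\<lambda>t x. \<Sum>i\<in>I. c i t * w i x" and ?g = "\<lambda>p. \<Sum>i\<in>I. d i (snd p) * w i (fst p)"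
  let ?X = "\<integral>\<^sup>+ t\<in>{0..T}. F (u t) \<partial>lebesgue"
  have bd: "\<exists>B. \<forall>t. \<bar>d i t\<bar> \<le> B" if "i \<in> I" for i
    using cd[OF that] by (auto simp: pwC1_def)
  have "sq_int (MT T) ?g"
    by (rule tensor_sum_sq_int[OF T state_integrable[OF w] state_sq_int[OF w] pwC1_measurable(2)[OF cd] bd])
  then have g: "L2on (\<Omega> \<times> {0<..<T}) ?g" by (simp add: L2on_def sq_int_def)
  have v: "L1w \<alpha> \<Omega> u0 T ?v" by (rule L1w_tensor_sum[OF T I w cd c0 c1])
  have C: "C0L2 \<Omega> T ?v" by (rule C0L2_tensor_sum[OF I w cd])
  then have v0: "L2on \<Omega> (?v 0)" using T by (simp add: C0L2_def)
  have wd: "weak_dt \<Omega> T ?v ?g" by (rule weak_dt_tensor_sum[OF open_\<Omega> T state_integrable[OF w] cd])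
  have "enn2ereal ?X \<le> ereal (\<integral>p. ?g p * (?v (snd p) (fst p) - u (snd p) (fst p)) \<partial>MT T)
             + enn2ereal (\<integral>\<^sup>+ t\<in>{0..T}. F (?v t) \<partial>lebesgue)
             - ereal (1/2 * L2dist2 \<Omega> (?v T) (u T))
             + ereal (1/2 * L2dist2 \<Omega> (?v 0) u0)"
    using sol[OF T] v g C v0 wd unfolding var_sol_def by blast
  also have "\<dots> \<le> ereal (\<integral>p. ?g p * (?v (snd p) (fst p) - u (snd p) (fst p)) \<partial>MT T)
             + ereal A
             - ereal (1/2 * L2dist2 \<Omega> (?v T) (u T))
             + ereal (1/2 * L2dist2 \<Omega> (?v 0) u0)"
  proof -
    have "enn2ereal (\<integral>\<^sup>+ t\<in>{0..T}. F (?v t) \<partial>lebesgue) \<le> ereal A"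
      using A(1) unfolding less_eq_ennreal.rep_eq enn2ereal_ennreal[OF A(2)] .
    then show ?thesis by (intro add_right_mono ereal_minus_mono add_left_mono order_refl)
  qed
  also have "\<dots> = ereal B"
  proof -
    note p = tensor_sum_pairing[where w=w, OF T I w cd]
    show ?thesis unfolding L2dist2_dst Bd by (subst p) simp_all
  qed
  finally have X: "enn2ereal ?X \<le> ereal B" .
  then have "0 \<le> ereal B" by (rule order_trans[OF enn2ereal_nonneg])
  then show "0 \<le> B" by simp
  with X show "?X \<le> ennreal B" by (simp add: less_eq_ennreal.rep_eq enn2ereal_ennreal)
qed

end

subsection \<open>Step functions in time as test functions\<close>

lemma integrable_bounded_times_continuous:
  fixes e f :: "real \<Rightarrow> real"
  assumes e: "e \<in> borel_measurable borel" "\<And>t. \<bar>e t\<bar> \<le> B" and f: "continuous_on {0..T} f"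
  shows "integrable lebesgue (\<lambda>t. indicator {0<..<T} t * (e t * f t))"
proof -
  have "compact (f ` {0..T})" by (rule compact_continuous_image[OF f]) simp
  from compact_imp_bounded[OF this] obtain C where C: "\<forall>y\<in>f ` {0..T}. norm y \<le> C"
    unfolding bounded_iff by (elim exE)
  let ?i = "\<lambda>t. indicator {0<..<T} t :: real"
  have m: "(\<lambda>t. ?i t *\<^sub>R f t) \<in> borel_measurable borel"
    by (rule borel_measurable_continuous_on_indicator) (auto intro: continuous_on_subset[OF f])
  have "(\<lambda>t. e t * (?i t *\<^sub>R f t)) \<in> borel_measurable lebesgue"
    by (intro borel_measurable_times measurable_completion) (use m e in simp_all)
  then have "integrable lebesgue (\<lambda>t. ?i t * (e t * (?i t *\<^sub>R f t)))"
  proof (rule integrable_bounded_on_interval[where B="B * C"])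
    fix t assume t: "0 < t" "t < T"
    have "\<bar>f t\<bar> \<le> C" using C t by auto
    then have "\<bar>e t\<bar> * \<bar>f t\<bar> \<le> B * C"
      using e(2)[of t] by (intro mult_mono) auto
    then show "\<bar>e t * (?i t *\<^sub>R f t)\<bar> \<le> B * C" using t by (simp add: abs_mult)
  qed
  moreover have "(\<lambda>t. ?i t * (e t * (?i t *\<^sub>R f t))) = (\<lambda>t. ?i t * (e t * f t))"
    by (auto simp: indicator_def)
  ultimately show ?thesis by simp
qed

text \<open>A ramp that starts at \<open>b\<close> has slope 1/\<epsilon> on the interval of length
  \<epsilon> to the right of \<open>b\<close>, so this is the limit of the derivative terms as the
  ramps become jumps. The value of \<open>f\<close> at the start of the ramp is picked out.\<close>

lemma right_average_tendsto:
  fixes f :: "real \<Rightarrow> real"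
  assumes f: "continuous_on {0..T} f" and b: "0 \<le> b" "b < T"
  shows "((\<lambda>\<epsilon>. \<integral>t. indicator {0<..<T} t * (indicator {b<..<b+\<epsilon>} t / \<epsilon> * f t) \<partial>lebesgue) \<longlongrightarrow> f b) (at_right 0)"
proof (rule tendstoI)
  fix \<eta> :: real assume \<eta>: "0 < \<eta>"
  from f b have "continuous (at b within {0..T}) f" by (simp add: continuous_on_eq_continuous_within)
  then obtain \<delta> where \<delta>: "0 < \<delta>" "\<And>t. t \<in> {0..T} \<Longrightarrow> dist t b < \<delta> \<Longrightarrow> dist (f t) (f b) < \<eta> / 2"
    unfolding continuous_within_eps_delta using \<eta> by (metis half_gt_zero)
  let ?J = "\<lambda>\<epsilon>. \<integral>t. indicator {0<..<T} t * (indicator {b<..<b+\<epsilon>} t / \<epsilon> * f t) \<partial>lebesgue"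
  have "dist (?J \<epsilon>) (f b) < \<eta>" if \<epsilon>: "0 < \<epsilon>" "\<epsilon> < min \<delta> (T - b)" for \<epsilon>
  proof -
    have int: "integrable lebesgue (\<lambda>t. indicator {0<..<T} t * (indicator {b<..<b+\<epsilon>} t / \<epsilon> * f t))"
      by (rule integrable_bounded_times_continuous[where B="1/\<epsilon>", OF _ _ f]) (use \<epsilon> in \<open>auto simp: indicator_def\<close>)
    have intc: "integrable lebesgue (\<lambda>t. indicator {b<..<b+\<epsilon>} t * (k::real))" for k
      by (rule integrable_bounded_on_interval[where B="\<bar>k\<bar>"]) auto
    have ic: "(\<integral>t. indicator {b<..<b+\<epsilon>} t * (k::real) \<partial>lebesgue) = \<epsilon> * k" for k
      using \<epsilon> by simp
    have "?J \<epsilon> - f b = ?J \<epsilon> - (\<integral>t. indicator {b<..<b+\<epsilon>} t * (f b / \<epsilon>) \<partial>lebesgue)"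
      unfolding ic using \<epsilon> by simp
    also have "\<dots> = (\<integral>t. indicator {0<..<T} t * (indicator {b<..<b+\<epsilon>} t / \<epsilon> * f t) - indicator {b<..<b+\<epsilon>} t * (f b / \<epsilon>) \<partial>lebesgue)"
      by (rule Bochner_Integration.integral_diff[OF int intc[of "f b / \<epsilon>"], symmetric])
    finally have "\<bar>?J \<epsilon> - f b\<bar> \<le> (\<integral>t. \<bar>indicator {0<..<T} t * (indicator {b<..<b+\<epsilon>} t / \<epsilon> * f t) - indicator {b<..<b+\<epsilon>} t * (f b / \<epsilon>)\<bar> \<partial>lebesgue)"
      by (simp only: integral_abs_bound)
    also have "\<dots> \<le> (\<integral>t. indicator {b<..<b+\<epsilon>} t * (\<eta> / 2 / \<epsilon>) \<partial>lebesgue)"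
    proof (rule integral_mono[OF _ intc[of "\<eta> / 2 / \<epsilon>"]])
      show "integrable lebesgue (\<lambda>t. \<bar>indicator {0<..<T} t * (indicator {b<..<b+\<epsilon>} t / \<epsilon> * f t) - indicator {b<..<b+\<epsilon>} t * (f b / \<epsilon>)\<bar>)"
        using Bochner_Integration.integrable_diff[OF int intc[of "f b / \<epsilon>"]] by (rule integrable_abs)
      fix t
      show "\<bar>indicator {0<..<T} t * (indicator {b<..<b+\<epsilon>} t / \<epsilon> * f t) - indicator {b<..<b+\<epsilon>} t * (f b / \<epsilon>)\<bar> \<le> indicator {b<..<b+\<epsilon>} t * (\<eta> / 2 / \<epsilon>)"
      proof (cases "t \<in> {b<..<b+\<epsilon>}")
        case True
        have tb: "b < t" "t < b + \<epsilon>" "\<epsilon> < \<delta>" "\<epsilon> < T - b" using True \<epsilon> by simp_all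
        then have tt: "t \<in> {0<..<T}" "t \<in> {0..T}" "dist t b < \<delta>"
          using b by (simp_all add: dist_real_def)
        have "\<bar>f t - f b\<bar> \<le> \<eta> / 2"
          using \<delta>(2)[OF tt(2,3)] by (simp add: dist_real_def)
        then have "\<bar>f t - f b\<bar> / \<epsilon> \<le> \<eta> / 2 / \<epsilon>" using \<epsilon> by (intro divide_right_mono) auto
        moreover have "\<bar>1 / \<epsilon> * f t - f b / \<epsilon>\<bar> = \<bar>f t - f b\<bar> / \<epsilon>"
          using \<epsilon> by (simp add: diff_divide_distrib[symmetric])
        ultimately show ?thesis using True tt by simp
      qed simp
    qed
    also have "\<dots> = \<eta> / 2" unfolding ic using \<epsilon> by simp
    also have "\<dots> < \<eta>" using \<eta> by simp
    finally show ?thesis by (simp add: dist_real_def)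
  qed
  moreover have "\<forall>\<^sub>F \<epsilon> in at_right 0. 0 < \<epsilon> \<and> \<epsilon> < min \<delta> (T - b)"
    using \<delta>(1) b by (auto simp: eventually_at_right intro!: exI[of _ "min \<delta> (T - b)"])
  ultimately show "\<forall>\<^sub>F \<epsilon> in at_right 0. dist (?J \<epsilon>) (f b) < \<eta>"
    by (auto elim: eventually_mono)
qed

lemma ramp_antimono: "0 < e \<Longrightarrow> b \<le> b' \<Longrightarrow> ramp e b' t \<le> ramp e b t"
  unfolding ramp_def by (intro max.mono min.mono divide_right_mono) auto

context denoising_flow
begin

text \<open>By convexity a ramp costs no more than the energies of its two neighbours, so its
  contribution disappears with \<epsilon>. Each new value is the value of \<open>u\<close> at its
  own jump time, because the ramp derivative samples \<open>u\<close> exactly there.\<close>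

lemma step_inequality:
  fixes a :: "nat \<Rightarrow> real"
  assumes a0: "a 0 = 0" and a: "\<And>k. k \<le> n \<Longrightarrow> a k < a (Suc k)" and aT: "a (Suc n) = T"
    and w0: "w 0 = u0" and wk: "\<And>k. 1 \<le> k \<Longrightarrow> k \<le> n \<Longrightarrow> w k = u (a k)"
    and fin: "\<And>k. k \<le> n \<Longrightarrow> F (w k) < \<infinity>"
    and Bd: "B = (\<Sum>k\<le>n. enn2real (F (w k)) * (a (Suc k) - a k))
       - (1/2 * (\<Sum>k<n. (dst (w (Suc k)) (w k))\<^sup>2) + 1/2 * (dst (w n) (u T))\<^sup>2)"
  shows "(\<integral>\<^sup>+ t\<in>{0..T}. F (u t) \<partial>lebesgue) \<le> ennreal B" "0 \<le> B"
proof -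
  let ?X = "\<integral>\<^sup>+ t\<in>{0..T}. F (u t) \<partial>lebesgue"
  have amono: "j \<le> k \<Longrightarrow> k \<le> Suc n \<Longrightarrow> a j \<le> a k" for j k
  proof (induction k rule: dec_induct)
    case (step k) then show ?case using a[of k] by simp
  qed simp
  have apos: "0 < a k" if "1 \<le> k" "k \<le> Suc n" for k
    using a[of 0] amono[of 1 k] that a0 by simp
  have T: "0 < T" using apos[of "Suc n"] aT by simp
  have alt: "a k < T" if "k \<le> n" for k using a[of k] amono[of "Suc k" "Suc n"] that aT by simp
  have st: "state (w k)" if "k \<le> n" for k
  proof (cases "k = 0")
    case False
    then show ?thesis using wk[of k] that state_u[of "a k"] apos[of k] by simp
  qed (simp add: w0 state_u0)
  note sw = state_sq_int[OF st]
  let ?f = "\<lambda>k. enn2real (F (w k))"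
  have Ff: "F (w k) = ennreal (?f k)" if "k \<le> n" for k using fin[OF that] by simp
  \<comment> \<open>Cumulative switches: \<open>r \<epsilon> k\<close> turns on at
    \<open>a k\<close>, the first is constantly 1 and the one after the last is 0. The differences
    \<open>c\<close> are therefore a partition of unity by telescoping, and \<open>e\<close>,
    \<open>d\<close> are the corresponding derivatives.\<close>
  define r where "r \<epsilon> k t = (if k = 0 then 1 else if k \<le> n then ramp \<epsilon> (a k) t else 0)" for \<epsilon> t and k :: nat
  define e where "e \<epsilon> k t = (if k = 0 then 0 else if k \<le> n then indicator {a k<..<a k+\<epsilon>} t / \<epsilon> else (0::real))" for \<epsilon> t and k :: nat
  define c where "c \<epsilon> k t = r \<epsilon> k t - r \<epsilon> (Suc k) t" for \<epsilon> k t
  define d where "d \<epsilon> k t = e \<epsilon> k t - e \<epsilon> (Suc k) t" for \<epsilon> k t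
  \<comment> \<open>The \<open>k\<close>-th value is active at most from \<open>a k\<close> until
    the next ramp is complete at \<open>a (Suc k) + \<epsilon>\<close>, whence the additional
    \<epsilon>.\<close>
  define A where "A \<epsilon> = (\<Sum>k\<le>n. ?f k * (a (Suc k) - a k + \<epsilon>))" for \<epsilon> :: real
  let ?I = "\<lambda>\<epsilon> k. \<integral>t. indicator {0<..<T} t * (d \<epsilon> k t * (\<integral>x. w k x * u t x \<partial>M)) \<partial>lebesgue"
  define B' where "B' \<epsilon> = 1/2 * (nrm2 M (w n))\<^sup>2 - 1/2 * (nrm2 M (w 0))\<^sup>2 - (\<Sum>k\<le>n. ?I \<epsilon> k)
      + A \<epsilon> - 1/2 * (dst (w n) (u T))\<^sup>2" for \<epsilon>
  have pr: "pwC1 (r \<epsilon> k) (e \<epsilon> k)" if "0 < \<epsilon>" for \<epsilon> k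
    unfolding r_def[abs_def] e_def[abs_def]
    by (cases "k = 0"; cases "k \<le> n") (simp_all add: pwC1_const pwC1_ramp[OF that])
  have B'_bound: "?X \<le> ennreal (B' \<epsilon>) \<and> 0 \<le> B' \<epsilon>" if \<epsilon>: "0 < \<epsilon>" "\<And>k. k \<le> n \<Longrightarrow> a k + \<epsilon> \<le> a (Suc k)" for \<epsilon>
  proof -
    have cd: "pwC1 (c \<epsilon> k) (d \<epsilon> k)" for k
      unfolding c_def[abs_def] d_def[abs_def] by (intro pwC1_diff pr \<epsilon>)
    have rmono: "r \<epsilon> (Suc k) t \<le> r \<epsilon> k t" if "k \<le> n" for k t
      unfolding r_def using ramp_antimono[OF \<epsilon>(1), of "a k" "a (Suc k)" t] a[OF that] that
      by (auto simp: ramp_nonneg ramp_le_1)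
    then have c0: "0 \<le> c \<epsilon> k t" if "k \<in> {..n}" for k t using that by (simp add: c_def)
    have c1: "(\<Sum>k\<le>n. c \<epsilon> k t) = 1" for t
    proof -
      have "(\<Sum>k\<le>n. c \<epsilon> k t) = r \<epsilon> 0 t - r \<epsilon> (Suc n) t"
        unfolding c_def by (rule sum_telescope)
      then show ?thesis by (simp add: r_def)
    qed
    \<comment> \<open>This uses that \<epsilon> does not exceed the cell width: even the last ramp
      is finished by time \<open>T\<close>, so the test function ends in \<open>w n\<close>.\<close>
    have rT: "r \<epsilon> k T = 1" if "k \<le> n" for k
      unfolding r_def using that ramp_ge[OF \<epsilon>(1), of "a k" T] \<epsilon>(2)[OF that] amono[of "Suc k" "Suc n"] aT by auto
    have vT: "(\<Sum>k\<le>n. c \<epsilon> k T * w k x) = w n x" for x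
    proof -
      have "(\<Sum>k\<le>n. c \<epsilon> k T * w k x) = (\<Sum>k\<le>n. if k = n then w n x else 0)"
        by (rule sum.cong) (auto simp: c_def rT, simp_all add: r_def)
      then show ?thesis by simp
    qed
    have r0: "r \<epsilon> k 0 = 0" if "k \<noteq> 0" for k
      unfolding r_def using that ramp_le[OF \<epsilon>(1), of 0 "a k"] apos[of k] by auto
    have v0: "(\<Sum>k\<le>n. c \<epsilon> k 0 * w k x) = w 0 x" for x
    proof -
      have "(\<Sum>k\<le>n. c \<epsilon> k 0 * w k x) = (\<Sum>k\<le>n. if k = 0 then w 0 x else 0)"
        by (rule sum.cong) (auto simp: c_def r0, simp_all add: r_def)
      then show ?thesis by simp
    qed
    have cle: "c \<epsilon> k t \<le> indicator {a k..a (Suc k) + \<epsilon>} t" if k: "k \<le> n" and t: "t \<in> {0..T}" for k t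
    proof -
      have r01: "0 \<le> r \<epsilon> j t" "r \<epsilon> j t \<le> 1" for j
        unfolding r_def by (auto simp: ramp_nonneg ramp_le_1)
      show ?thesis
      proof (cases "t \<in> {a k..a (Suc k) + \<epsilon>}")
        case True
        then show ?thesis using r01[of k] r01[of "Suc k"] by (simp add: c_def)
      next
        case False
        then consider "t < a k" | "a (Suc k) + \<epsilon> < t" by fastforce
        then have "c \<epsilon> k t \<le> 0"
        proof cases
          case 1
          then have "k \<noteq> 0" using t a0 by (intro notI) auto
          then have "r \<epsilon> k t = 0" unfolding r_def using k 1 ramp_le[OF \<epsilon>(1), of t "a k"] by simp
          then show ?thesis using r01[of "Suc k"] by (simp add: c_def)
        next
          case 2
          have "k \<noteq> n" using 2 t aT \<epsilon>(1) by (intro notI) auto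
          then have "r \<epsilon> (Suc k) t = 1" unfolding r_def using k 2 ramp_ge[OF \<epsilon>(1), of "a (Suc k)" t] by simp
          then show ?thesis using r01[of k] by (simp add: c_def)
        qed
        with False show ?thesis by simp
      qed
    qed
    have Ale: "(\<integral>\<^sup>+ t\<in>{0..T}. F (\<lambda>x. \<Sum>k\<le>n. c \<epsilon> k t * w k x) \<partial>lebesgue) \<le> ennreal (A \<epsilon>)"
    proof -
      have "(\<integral>\<^sup>+ t\<in>{0..T}. F (\<lambda>x. \<Sum>k\<le>n. c \<epsilon> k t * w k x) \<partial>lebesgue)
        \<le> (\<integral>\<^sup>+ t. (\<Sum>k\<le>n. ennreal (?f k) * indicator {a k..a (Suc k) + \<epsilon>} t) \<partial>lebesgue)"
      proof (rule nn_integral_mono)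
        fix t
        show "F (\<lambda>x. \<Sum>k\<le>n. c \<epsilon> k t * w k x) * indicator {0..T} t \<le> (\<Sum>k\<le>n. ennreal (?f k) * indicator {a k..a (Suc k) + \<epsilon>} t)"
        proof (cases "t \<in> {0..T}")
          case True
          have "F (\<lambda>x. \<Sum>k\<le>n. c \<epsilon> k t * w k x) \<le> (\<Sum>k\<le>n. ennreal (c \<epsilon> k t) * F (w k))"
            by (rule F_convex[OF _ _ c0 c1]) (auto intro: st)
          also have "\<dots> \<le> (\<Sum>k\<le>n. indicator {a k..a (Suc k) + \<epsilon>} t * F (w k))"
          proof (intro sum_mono mult_right_mono)
            fix k assume "k \<in> {..n}"
            then have "ennreal (c \<epsilon> k t) \<le> ennreal (indicator {a k..a (Suc k) + \<epsilon>} t)"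
              using cle[of k t] True by (intro ennreal_leI) auto
            then show "ennreal (c \<epsilon> k t) \<le> indicator {a k..a (Suc k) + \<epsilon>} t" by (simp add: ennreal_indicator)
          qed simp
          also have "\<dots> = (\<Sum>k\<le>n. ennreal (?f k) * indicator {a k..a (Suc k) + \<epsilon>} t)"
            using Ff by (intro sum.cong) (auto simp: mult.commute)
          finally show ?thesis using True by simp
        qed simp
      qed
      also have "\<dots> = (\<Sum>k\<le>n. ennreal (?f k) * ennreal (a (Suc k) - a k + \<epsilon>))"
      proof (subst nn_integral_sum)
        show "(\<Sum>k\<le>n. \<integral>\<^sup>+ t. ennreal (?f k) * indicator {a k..a (Suc k) + \<epsilon>} t \<partial>lebesgue) = (\<Sum>k\<le>n. ennreal (?f k) * ennreal (a (Suc k) - a k + \<epsilon>))"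
        proof (rule sum.cong[OF refl])
          fix k assume "k \<in> {..n}"
          then have "a k \<le> a (Suc k) + \<epsilon>" using a[of k] \<epsilon>(1) by simp
          then show "(\<integral>\<^sup>+ t. ennreal (?f k) * indicator {a k..a (Suc k) + \<epsilon>} t \<partial>lebesgue) = ennreal (?f k) * ennreal (a (Suc k) - a k + \<epsilon>)"
            by (subst nn_integral_cmult_indicator) (auto simp: algebra_simps)
        qed
      qed (simp add: borel_measurable_times_ennreal borel_measurable_indicator)
      also have "\<dots> = ennreal (A \<epsilon>)"
        unfolding A_def using a \<epsilon>(1)
        by (subst sum_ennreal[symmetric]) (auto intro!: sum.cong mult_nonneg_nonneg simp: ennreal_mult' less_imp_le add_nonneg_nonneg)
      finally show ?thesis .
    qed
    have A0: "0 \<le> A \<epsilon>"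
      unfolding A_def using a \<epsilon>(1) by (intro sum_nonneg mult_nonneg_nonneg add_nonneg_nonneg) (auto simp: less_imp_le)
    have dst0: "dst (w 0) u0 = 0" by (simp add: w0 nrm2_def)
    have "B' \<epsilon> = 1/2 * (nrm2 M (\<lambda>x. \<Sum>k\<le>n. c \<epsilon> k T * w k x))\<^sup>2 - 1/2 * (nrm2 M (\<lambda>x. \<Sum>k\<le>n. c \<epsilon> k 0 * w k x))\<^sup>2
      - (\<Sum>k\<le>n. \<integral>t. indicator {0<..<T} t * (d \<epsilon> k t * (\<integral>x. w k x * u t x \<partial>M)) \<partial>lebesgue) + A \<epsilon>
      - 1/2 * (dst (\<lambda>x. \<Sum>k\<le>n. c \<epsilon> k T * w k x) (u T))\<^sup>2 + 1/2 * (dst (\<lambda>x. \<Sum>k\<le>n. c \<epsilon> k 0 * w k x) u0)\<^sup>2"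
      unfolding vT v0 B'_def using dst0 by simp
    from variational_inequality_tensor_sum[OF T _ st cd c0 c1 Ale A0 this]
    show ?thesis by auto
  qed
  \<comment> \<open>The limit of the pairing with the derivative of \<open>r \<epsilon> k\<close>.
    It vanishes for the two constant switches, at index 0 and beyond \<open>n\<close>.\<close>
  define L where "L k z = (if k = 0 then 0 else if k \<le> n then (\<integral>x. z x * u (a k) x \<partial>M) else 0)" for k :: nat and z
  have cont: "continuous_on {0..T} (\<lambda>t. \<integral>x. z x * u t x \<partial>M)" if "sq_int M z" for z
    by (rule continuous_on_subset[OF u_inner_continuous[OF that]]) auto
  have limE: "((\<lambda>\<epsilon>. \<integral>t. indicator {0<..<T} t * (e \<epsilon> k t * (\<integral>x. z x * u t x \<partial>M)) \<partial>lebesgue) \<longlongrightarrow> L k z) (at_right 0)"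
    if z: "sq_int M z" for k z
  proof (cases "k = 0 \<or> n < k")
    case True
    then show ?thesis unfolding e_def L_def by auto
  next
    case False
    then show ?thesis unfolding e_def L_def
      using right_average_tendsto[OF cont[OF z], of "a k"] apos[of k] alt[of k] by simp
  qed
  have epos: "\<forall>\<^sub>F \<epsilon> in at_right (0::real). 0 < \<epsilon>" by (simp add: eventually_at_right_less)
  have limI: "((\<lambda>\<epsilon>. ?I \<epsilon> k) \<longlongrightarrow> L k (w k) - L (Suc k) (w k)) (at_right 0)" if k: "k \<le> n" for k
  proof (rule Lim_transform_eventually[OF tendsto_diff[OF limE[OF sw[OF k], of k] limE[OF sw[OF k], of "Suc k"]]])
    show "\<forall>\<^sub>F \<epsilon> in at_right 0. (\<integral>t. indicator {0<..<T} t * (e \<epsilon> k t * (\<integral>x. w k x * u t x \<partial>M)) \<partial>lebesgue)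
        - (\<integral>t. indicator {0<..<T} t * (e \<epsilon> (Suc k) t * (\<integral>x. w k x * u t x \<partial>M)) \<partial>lebesgue) = ?I \<epsilon> k"
      using epos
    proof eventually_elim
      case (elim \<epsilon>)
      have i: "integrable lebesgue (\<lambda>t. indicator {0<..<T} t * (e \<epsilon> j t * (\<integral>x. w k x * u t x \<partial>M)))" for j
      proof -
        obtain B where "\<And>t. \<bar>e \<epsilon> j t\<bar> \<le> B" using pwC1_bound[OF pr[OF elim, of j]] by metis
        then show ?thesis
          by (rule integrable_bounded_times_continuous[OF pwC1_measurable(2)[OF pr[OF elim]] _ cont[OF sw[OF k]]])
      qed
      show ?case unfolding Bochner_Integration.integral_diff[OF i i, symmetric] d_def
        by (rule Bochner_Integration.integral_cong) (auto simp: algebra_simps)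
    qed
  qed
  have limA: "(A \<longlongrightarrow> (\<Sum>k\<le>n. ?f k * (a (Suc k) - a k + 0))) (at_right 0)"
    unfolding A_def[abs_def] by (intro tendsto_intros)
  have L0: "L 0 z = 0" "L (Suc n) z = 0" for z by (simp_all add: L_def)
  have LS: "L (Suc k) z = (\<integral>x. z x * w (Suc k) x \<partial>M)" if "k < n" for k z
    using wk[of "Suc k"] that by (simp add: L_def)
  \<comment> \<open>Summation by parts: each jump is collected from the two neighbouring indices,
    and the terms at both ends vanish.\<close>
  have sumL: "(\<Sum>k\<le>n. L k (w k) - L (Suc k) (w k)) = (\<Sum>k<n. (nrm2 M (w (Suc k)))\<^sup>2 - (\<integral>x. w k x * w (Suc k) x \<partial>M))"
  proof -
    have "(\<Sum>k\<le>n. L k (w k) - L (Suc k) (w k)) = (\<Sum>k\<le>n. L k (w k)) - (\<Sum>k\<le>n. L (Suc k) (w k))"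
      by (rule sum_subtractf)
    also have "(\<Sum>k\<le>n. L k (w k)) = (\<Sum>k<n. L (Suc k) (w (Suc k)))"
      unfolding lessThan_Suc_atMost[symmetric] sum.lessThan_Suc_shift by (simp add: L0)
    also have "(\<Sum>k\<le>n. L (Suc k) (w k)) = (\<Sum>k<n. L (Suc k) (w k))"
      unfolding lessThan_Suc_atMost[symmetric] sum.lessThan_Suc by (simp add: L0)
    finally show ?thesis
      unfolding sum_subtractf[symmetric] by (simp add: LS nrm2_sq) (simp add: power2_eq_square)
  qed
  \<comment> \<open>Because \<open>w (Suc k)\<close> is the value of \<open>u\<close> at the jump time, the boundary terms and the jump terms complete to squares.\<close>
  have Beq: "1/2 * (nrm2 M (w n))\<^sup>2 - 1/2 * (nrm2 M (w 0))\<^sup>2 - (\<Sum>k\<le>n. L k (w k) - L (Suc k) (w k))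
      + (\<Sum>k\<le>n. ?f k * (a (Suc k) - a k + 0)) - 1/2 * (dst (w n) (u T))\<^sup>2 = B"
  proof -
    have "(\<Sum>k<n. (dst (w (Suc k)) (w k))\<^sup>2) = (\<Sum>k<n. 2 * ((nrm2 M (w (Suc k)))\<^sup>2 - (\<integral>x. w k x * w (Suc k) x \<partial>M)) - ((nrm2 M (w (Suc k)))\<^sup>2 - (nrm2 M (w k))\<^sup>2))"
    proof (rule sum.cong[OF refl])
      fix k assume "k \<in> {..<n}"
      then show "(dst (w (Suc k)) (w k))\<^sup>2 = 2 * ((nrm2 M (w (Suc k)))\<^sup>2 - (\<integral>x. w k x * w (Suc k) x \<partial>M)) - ((nrm2 M (w (Suc k)))\<^sup>2 - (nrm2 M (w k))\<^sup>2)"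
        by (subst nrm2_diff_sq) (auto intro: sw simp: mult.commute)
    qed
    also have "\<dots> = 2 * (\<Sum>k<n. (nrm2 M (w (Suc k)))\<^sup>2 - (\<integral>x. w k x * w (Suc k) x \<partial>M)) - ((nrm2 M (w n))\<^sup>2 - (nrm2 M (w 0))\<^sup>2)"
      unfolding sum_subtractf[of _ "\<lambda>k. (nrm2 M (w (Suc k)))\<^sup>2 - (nrm2 M (w k))\<^sup>2"] sum_distrib_left[symmetric]
      by (simp only: sum_lessThan_telescope[where f="\<lambda>k. (nrm2 M (w k))\<^sup>2"])
    finally have s: "(\<Sum>k<n. (dst (w (Suc k)) (w k))\<^sup>2) = 2 * (\<Sum>k<n. (nrm2 M (w (Suc k)))\<^sup>2 - (\<integral>x. w k x * w (Suc k) x \<partial>M)) - ((nrm2 M (w n))\<^sup>2 - (nrm2 M (w 0))\<^sup>2)" .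
    show ?thesis unfolding sumL Bd s by (simp add: field_simps)
  qed
  have limB: "(B' \<longlongrightarrow> B) (at_right 0)"
    unfolding Beq[symmetric] B'_def[abs_def]
    by (intro tendsto_intros limA limI) auto
  define \<delta> where "\<delta> = Min ((\<lambda>k. a (Suc k) - a k) ` {..n})"
  have \<delta>: "0 < \<delta>" unfolding \<delta>_def using a by (subst Min_gr_iff) auto
  have \<delta>le: "\<delta> \<le> a (Suc k) - a k" if "k \<le> n" for k unfolding \<delta>_def using that by (intro Min_le) auto
  have ev: "\<forall>\<^sub>F \<epsilon> in at_right 0. ?X \<le> ennreal (B' \<epsilon>) \<and> 0 \<le> B' \<epsilon>"
    unfolding eventually_at_right_field using \<delta> \<delta>le by (intro exI[of _ \<delta>]) (force intro!: B'_bound)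
  have nb: "at_right (0::real) \<noteq> bot" by simp
  show "0 \<le> B"
    by (rule tendsto_lowerbound[OF limB _ nb]) (use ev in \<open>auto elim: eventually_mono\<close>)
  show "?X \<le> ennreal B"
    by (rule tendsto_lowerbound[OF tendsto_ennrealI[OF limB] _ nb]) (use ev in \<open>auto elim: eventually_mono\<close>)
qed

abbreviation F0 :: real where "F0 \<equiv> enn2real (F u0)"

lemma F_u0: "F u0 = ennreal F0" using F_u0_finite by simp

text \<open>A single cell with the value \<open>u0\<close>. The first bound makes the time integral
  of F(u) finite, so that it may be cancelled later on; the second one shows at which rate the
  initial datum is attained.\<close>

lemma constant_test_inequality:
  assumes T: "0 < T"
  shows "(\<integral>\<^sup>+ t\<in>{0..T}. F (u t) \<partial>lebesgue) \<le> ennreal (F0 * T)" "(dst u0 (u T))\<^sup>2 \<le> 2 * (F0 * T)"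
proof -
  let ?a = "\<lambda>k::nat. if k = 0 then 0 else T"
  let ?B = "(\<Sum>k\<le>(0::nat). enn2real (F u0) * (?a (Suc k) - ?a k)) - (1/2 * (\<Sum>k<(0::nat). (dst u0 u0)\<^sup>2) + 1/2 * (dst u0 (u T))\<^sup>2)"
  have "(\<integral>\<^sup>+ t\<in>{0..T}. F (u t) \<partial>lebesgue) \<le> ennreal ?B \<and> 0 \<le> ?B"
    using step_inequality[of ?a 0 T "\<lambda>_. u0" ?B] T F_u0_finite by auto
  then have *: "(\<integral>\<^sup>+ t\<in>{0..T}. F (u t) \<partial>lebesgue) \<le> ennreal (F0 * T - 1/2 * (dst u0 (u T))\<^sup>2)" "0 \<le> F0 * T - 1/2 * (dst u0 (u T))\<^sup>2"
    by simp_all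
  from *(1) show "(\<integral>\<^sup>+ t\<in>{0..T}. F (u t) \<partial>lebesgue) \<le> ennreal (F0 * T)"
    by (rule order_trans) (simp add: ennreal_leI)
  from *(2) show "(dst u0 (u T))\<^sup>2 \<le> 2 * (F0 * T)" by simp
qed

lemma shifted_grid_inequality:
  assumes \<theta>: "0 < \<theta>" and \<tau>: "0 < \<tau>" and T: "\<theta> + real m * \<tau> < T"
  shows "(\<integral>\<^sup>+ t\<in>{0..T}. F (u t) \<partial>lebesgue)
      + ennreal (1/2 * (\<Sum>k<m. (dst (u (\<theta> + real (Suc k) * \<tau>)) (u (\<theta> + real k * \<tau>)))\<^sup>2))
    \<le> ennreal (F0 * \<theta>) + ennreal \<tau> * (\<Sum>k<m. F (u (\<theta> + real k * \<tau>))) + ennreal (T - \<theta> - real m * \<tau>) * F (u (\<theta> + real m * \<tau>))"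
    (is "?X + ennreal (1/2 * ?S) \<le> ?R")
\<comment> \<open>Every grid value has a positive weight on the right-hand side, so an infinite
  energy at one grid point makes the claim trivial.\<close>
proof (cases "\<forall>k\<le>m. F (u (\<theta> + real k * \<tau>)) < \<infinity>")
  case False
  then obtain k where k: "k \<le> m" "F (u (\<theta> + real k * \<tau>)) = \<infinity>" by (auto simp: less_top[symmetric])
  have "?R = top"
  proof (cases "k = m")
    case True
    then show ?thesis using k T by (simp add: ennreal_mult_top)
  next
    case False
    then have "(\<Sum>k<m. F (u (\<theta> + real k * \<tau>))) = top" using k by (auto intro!: bexI[of _ k])
    then show ?thesis using \<tau> by (simp add: ennreal_mult_top del: ennreal_sum_eq_top)
  qed
  then show ?thesis by (simp only: top_greatest)
next
  case True
  \<comment> \<open>The cell from 0 to \<theta> carries \<open>u0\<close> and takes index 0, so the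
    grid point with number k has index k + 1 and the last index of a value is
    \<open>Suc m\<close>.\<close>
  define a where "a k = (if k = 0 then 0 else if k \<le> Suc m then \<theta> + real (k - 1) * \<tau> else T)" for k
  define w where "w k = (if k = 0 then u0 else u (a k))" for k
  let ?f = "\<lambda>k. enn2real (F (u (\<theta> + real k * \<tau>)))"
  define B where "B = (\<Sum>k\<le>Suc m. enn2real (F (w k)) * (a (Suc k) - a k))
       - (1/2 * (\<Sum>k<Suc m. (dst (w (Suc k)) (w k))\<^sup>2) + 1/2 * (dst (w (Suc m)) (u T))\<^sup>2)"
  have "?X \<le> ennreal B \<and> 0 \<le> B"
  proof -
    have 1: "a 0 = 0" by (simp add: a_def)
    have 2: "a k < a (Suc k)" if k: "k \<le> Suc m" for k
    proof -
      consider "k = 0" | "1 \<le> k" "k \<le> m" | "k = Suc m" using k by linarith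
      then show ?thesis
      proof cases
        case 2
        then have "real (k - 1) * \<tau> < real k * \<tau>" using \<tau> by simp
        with 2 show ?thesis by (simp add: a_def)
      qed (use \<theta> T in \<open>auto simp: a_def\<close>)
    qed
    have 3: "a (Suc (Suc m)) = T" by (simp add: a_def)
    have 4: "w 0 = u0" "\<And>k. 1 \<le> k \<Longrightarrow> k \<le> Suc m \<Longrightarrow> w k = u (a k)" by (auto simp: w_def)
    have 5: "F (w k) < \<infinity>" if "k \<le> Suc m" for k
    proof (cases k)
      case 0
      then show ?thesis using F_u0_finite by (simp add: w_def)
    next
      case (Suc j)
      then have "j \<le> m" using that by simp
      with True have "F (u (\<theta> + real j * \<tau>)) < \<infinity>" by blast
      then show ?thesis using Suc \<open>j \<le> m\<close> by (simp add: w_def a_def)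
    qed
    show ?thesis using step_inequality[OF 1 2 3 4 5 B_def] by blast
  qed
  have wS: "w (Suc k) = u (\<theta> + real k * \<tau>)" if "k \<le> m" for k using that by (simp add: w_def a_def)
  have d1: "a (Suc 0) - a 0 = \<theta>" by (simp add: a_def)
  have d2: "a (Suc (Suc k)) - a (Suc k) = \<tau>" if "k < m" for k using that by (simp add: a_def algebra_simps)
  have d3: "a (Suc (Suc m)) - a (Suc m) = T - \<theta> - real m * \<tau>" by (simp add: a_def)
  have s1: "(\<Sum>k\<le>Suc m. enn2real (F (w k)) * (a (Suc k) - a k)) = F0 * \<theta> + \<tau> * (\<Sum>k<m. ?f k) + (T - \<theta> - real m * \<tau>) * ?f m"
  proof -
    have "(\<Sum>k\<le>Suc m. enn2real (F (w k)) * (a (Suc k) - a k)) = enn2real (F (w 0)) * (a (Suc 0) - a 0)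
      + (\<Sum>k\<le>m. enn2real (F (w (Suc k))) * (a (Suc (Suc k)) - a (Suc k)))"
      by (rule sum.atMost_Suc_shift)
    also have "(\<Sum>k\<le>m. enn2real (F (w (Suc k))) * (a (Suc (Suc k)) - a (Suc k)))
      = (\<Sum>k<m. enn2real (F (w (Suc k))) * (a (Suc (Suc k)) - a (Suc k))) + enn2real (F (w (Suc m))) * (a (Suc (Suc m)) - a (Suc m))"
      unfolding lessThan_Suc_atMost[symmetric] by simp
    also have "(\<Sum>k<m. enn2real (F (w (Suc k))) * (a (Suc (Suc k)) - a (Suc k))) = (\<Sum>k<m. ?f k * \<tau>)"
      using d2 wS by (intro sum.cong) auto
    finally show ?thesis using wS[of m] d1 d3 by (simp add: w_def sum_distrib_left mult.commute)
  qed
  \<comment> \<open>The jump from \<open>u0\<close> to \<open>u \<theta>\<close> is dropped here, as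
    is the distance to \<open>u T\<close> in the next estimate; only increments between shifted grid
    points are kept.\<close>
  have s2: "?S \<le> (\<Sum>k<Suc m. (dst (w (Suc k)) (w k))\<^sup>2)"
  proof -
    have "(\<Sum>k<Suc m. (dst (w (Suc k)) (w k))\<^sup>2) = (dst (w (Suc 0)) (w 0))\<^sup>2 + (\<Sum>k<m. (dst (w (Suc (Suc k))) (w (Suc k)))\<^sup>2)"
      by (rule sum.lessThan_Suc_shift)
    also have "(\<Sum>k<m. (dst (w (Suc (Suc k))) (w (Suc k)))\<^sup>2) = ?S"
      using wS by (intro sum.cong) auto
    finally show ?thesis by simp
  qed
  have S0: "0 \<le> ?S" by (intro sum_nonneg) simp
  have Ble: "B + 1/2 * ?S \<le> F0 * \<theta> + \<tau> * (\<Sum>k<m. ?f k) + (T - \<theta> - real m * \<tau>) * ?f m"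
    unfolding B_def s1 using s2 zero_le_power2[of "dst (w (Suc m)) (u T)"] by linarith
  have "?X + ennreal (1/2 * ?S) \<le> ennreal B + ennreal (1/2 * ?S)"
    using \<open>?X \<le> ennreal B \<and> 0 \<le> B\<close> by (intro add_right_mono) simp
  also have "\<dots> = ennreal (B + 1/2 * ?S)"
    using \<open>?X \<le> ennreal B \<and> 0 \<le> B\<close> S0 by (intro ennreal_plus[symmetric]) auto
  also have "\<dots> \<le> ennreal (F0 * \<theta> + \<tau> * (\<Sum>k<m. ?f k) + (T - \<theta> - real m * \<tau>) * ?f m)"
    using Ble by (rule ennreal_leI)
  also have "\<dots> = ennreal (F0 * \<theta>) + ennreal \<tau> * ennreal (\<Sum>k<m. ?f k) + ennreal (T - \<theta> - real m * \<tau>) * ennreal (?f m)"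
    using \<theta> \<tau> T by (simp add: ennreal_plus ennreal_mult sum_nonneg)
  also have "\<dots> = ?R"
    using True by (subst sum_ennreal[symmetric]) auto
  finally show ?thesis .
qed

end

subsection \<open>Averaging over shifted grids\<close>

lemma sum_lessThan_add:
  fixes h :: "nat \<Rightarrow> 'b::comm_monoid_add"
  shows "(\<Sum>k<a + b. h k) = (\<Sum>k<a. h k) + (\<Sum>l<b. h (a + l))"
  by (induction b) (simp_all add: add.assoc)

lemma sum_blocks:
  fixes h :: "nat \<Rightarrow> 'b::comm_monoid_add"
  shows "(\<Sum>i<r. \<Sum>l<q. h (i * q + l)) = (\<Sum>k<r * q. h k)"
proof (induction r)
  case (Suc r)
  have "(\<Sum>k<Suc r * q. h k) = (\<Sum>k<r * q + q. h k)" by (simp add: add.commute)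
  then show ?case using Suc by (simp add: sum_lessThan_add)
qed simp

text \<open>The weight that F(u_0) receives when the length \<theta> of the first cell runs through
  all shifts; divided by \<tau> it is the mean \<tau>/2.\<close>

lemma nn_integral_identity_interval:
  assumes "0 < \<tau>" "0 \<le> c"
  shows "(\<integral>\<^sup>+\<theta>. ennreal (c * \<theta>) * indicator {0<..<\<tau>} \<theta> \<partial>lebesgue) = ennreal (c * \<tau>\<^sup>2 / 2)"
proof -
  \<comment> \<open>The squared ramp is a bounded antiderivative of a multiple of the identity on the interval.\<close>
  let ?d = "\<lambda>t. indicator {0<..<0+\<tau>} t / \<tau> * ramp \<tau> 0 t + indicator {0<..<0+\<tau>} t / \<tau> * ramp \<tau> 0 t"
  have p: "pwC1 (\<lambda>t. ramp \<tau> 0 t * ramp \<tau> 0 t) ?d"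
    by (intro pwC1_mult pwC1_ramp assms)
  have "(\<integral>t. indicator {0<..<\<tau>} t * ?d t \<partial>lebesgue) = ramp \<tau> 0 \<tau> * ramp \<tau> 0 \<tau> - ramp \<tau> 0 0 * ramp \<tau> 0 0"
    by (rule pwC1_FTC[OF p]) (use assms in simp)
  also have "\<dots> = 1" using assms by (simp add: ramp_ge ramp_le)
  also have "(\<lambda>t. indicator {0<..<\<tau>} t * ?d t) = (\<lambda>t. 2 / \<tau>\<^sup>2 * (indicator {0<..<\<tau>} t * t))"
    using assms by (auto simp: indicator_def ramp_def power2_eq_square field_simps)
  also have "(\<integral>t. 2 / \<tau>\<^sup>2 * (indicator {0<..<\<tau>} t * t) \<partial>lebesgue) = 2 / \<tau>\<^sup>2 * (\<integral>t. indicator {0<..<\<tau>} t * t \<partial>lebesgue)"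
    by (rule integral_mult_right_zero)
  finally have e: "(\<integral>t. indicator {0<..<\<tau>} t * t \<partial>lebesgue) = \<tau>\<^sup>2 / 2"
    using assms by (simp add: divide_simps mult.commute)
  have i: "integrable lebesgue (\<lambda>t. indicator {0<..<\<tau>} t * t)"
    by (rule integrable_bounded_on_interval[where B=\<tau>]) (auto intro: measurable_completion)
  have "(\<integral>\<^sup>+\<theta>. ennreal (c * \<theta>) * indicator {0<..<\<tau>} \<theta> \<partial>lebesgue) = (\<integral>\<^sup>+\<theta>. ennreal (c * (indicator {0<..<\<tau>} \<theta> * \<theta>)) \<partial>lebesgue)"
    by (rule nn_integral_cong) (auto simp: indicator_def)
  also have "\<dots> = ennreal (\<integral>\<theta>. c * (indicator {0<..<\<tau>} \<theta> * \<theta>) \<partial>lebesgue)"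
    using i assms by (intro nn_integral_eq_integral) (auto simp: indicator_def intro!: AE_I2)
  also have "(\<integral>\<theta>. c * (indicator {0<..<\<tau>} \<theta> * \<theta>) \<partial>lebesgue) = c * \<tau>\<^sup>2 / 2" using e by simp
  finally show ?thesis .
qed

lemma borel_imp_lebesgue_measurable: "f \<in> borel_measurable borel \<Longrightarrow> f \<in> borel_measurable lebesgue"
  by (intro measurable_completion) simp

context denoising_flow
begin

text \<open>Half-open intervals fit together without overlap, so additivity needs no treatment of
  end points.\<close>

definition Fint :: "real \<Rightarrow> real \<Rightarrow> ennreal" where
  "Fint a b = (\<integral>\<^sup>+t\<in>{a<..b}. F (u t) \<partial>lebesgue)"

lemma F_u_half_line_measurable: "(\<lambda>t. F (u t) * indicator {0..} t) \<in> borel_measurable borel"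
proof -
  have "(\<lambda>t. F (u t)) \<in> borel_measurable (restrict_space borel {0..})"
  proof (rule F_measurable_along)
    fix t :: real assume t: "t \<in> {0..}"
    then show "state (u t)" by (simp add: state_u)
    have "sq_int M (u t)" using t by (intro state_sq_int state_u) simp
    from u_dst_continuous[OF this] t have "((\<lambda>s. dst (u s) (u t)) \<longlongrightarrow> dst (u t) (u t)) (at t within {0..})"
      unfolding continuous_on_def by (rule bspec)
    then show "((\<lambda>s. dst (u s) (u t)) \<longlongrightarrow> 0) (at t within {0..})" by (simp add: nrm2_def)
  qed simp
  then show ?thesis by (simp add: borel_measurable_restrict_space_iff_ennreal)
qed

lemma Fint_add:
  assumes "0 \<le> a" "a \<le> b" "b \<le> c"
  shows "Fint a c = Fint a b + Fint b c"
proof -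
  let ?f = "\<lambda>t. F (u t) * indicator {0..} t"
  have m: "(\<lambda>t. ?f t * indicator {x<..y} t) \<in> borel_measurable lebesgue" for x y
    by (intro borel_imp_lebesgue_measurable borel_measurable_times_ennreal[OF F_u_half_line_measurable borel_measurable_indicator]) simp
  have r: "Fint x y = (\<integral>\<^sup>+t. ?f t * indicator {x<..y} t \<partial>lebesgue)" if "0 \<le> x" for x y
    unfolding Fint_def using that by (intro nn_integral_cong) (auto simp: indicator_def)
  have "Fint a c = (\<integral>\<^sup>+t. ?f t * indicator {a<..b} t + ?f t * indicator {b<..c} t \<partial>lebesgue)"
    unfolding r[OF assms(1)] using assms by (intro nn_integral_cong) (auto simp: indicator_def)
  also have "\<dots> = Fint a b + Fint b c"
    using assms by (subst nn_integral_add[OF m m]) (simp add: r)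
  finally show ?thesis .
qed

lemma Fint_closed: "(\<integral>\<^sup>+t\<in>{a..b}. F (u t) \<partial>lebesgue) = Fint a b"
  unfolding Fint_def
proof (rule nn_integral_null_delta)
  have "{a..b} - {a<..b} \<union> ({a<..b} - {a..b}) \<subseteq> {a}" by auto
  moreover have "{a} \<in> null_sets (lebesgue :: real measure)" by (intro null_sets_completionI finite_imp_null_set_lborel) simp
  ultimately show "{a..b} - {a<..b} \<union> ({a<..b} - {a..b}) \<in> null_sets lebesgue"
    by (metis completion.complete2)
qed simp_all

lemma Fint_le: assumes T: "0 < T" shows "Fint 0 T \<le> ennreal (F0 * T)"
  using constant_test_inequality(1)[OF T] by (simp add: Fint_closed)

lemma shifted_F_u_measurable:
  assumes "0 \<le> a"
  shows "(\<lambda>\<theta>. F (u (\<theta> + a)) * indicator {0<..<\<tau>} \<theta>) \<in> borel_measurable lebesgue"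
proof -
  let ?f = "\<lambda>t. F (u t) * indicator {0..} t"
  have "(\<lambda>\<theta>. ?f (\<theta> + a)) \<in> borel_measurable borel"
    by (rule measurable_compose[OF _ F_u_half_line_measurable]) simp
  then have "(\<lambda>\<theta>. ?f (\<theta> + a) * indicator {0<..<\<tau>} \<theta>) \<in> borel_measurable borel"
    by (rule borel_measurable_times_ennreal[OF _ borel_measurable_indicator]) simp
  then have "(\<lambda>\<theta>. ?f (\<theta> + a) * indicator {0<..<\<tau>} \<theta>) \<in> borel_measurable lebesgue"
    by (rule borel_imp_lebesgue_measurable)
  also have "(\<lambda>\<theta>. ?f (\<theta> + a) * indicator {0<..<\<tau>} \<theta>) = (\<lambda>\<theta>. F (u (\<theta> + a)) * indicator {0<..<\<tau>} \<theta>)"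
    using assms by (auto simp: indicator_def)
  finally show ?thesis .
qed

lemma shifted_average_le:
  assumes a: "0 \<le> a"
  shows "(\<integral>\<^sup>+\<theta>. F (u (\<theta> + a)) * indicator {0<..<\<tau>} \<theta> \<partial>lebesgue) \<le> Fint a (a + \<tau>)"
proof -
  let ?f = "\<lambda>t. F (u t) * indicator {0..} t"
  let ?g = "\<lambda>t. ?f t * indicator {a<..a+\<tau>} t"
  have m: "?g \<in> borel_measurable lebesgue"
    by (intro borel_imp_lebesgue_measurable borel_measurable_times_ennreal[OF F_u_half_line_measurable borel_measurable_indicator]) simp
  have "(\<integral>\<^sup>+\<theta>. F (u (\<theta> + a)) * indicator {0<..<\<tau>} \<theta> \<partial>lebesgue) \<le> (\<integral>\<^sup>+\<theta>. ?g (a + 1 * \<theta>) \<partial>lebesgue)"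
    using a by (intro nn_integral_mono) (auto simp: indicator_def add.commute)
  also have "\<dots> = (\<integral>\<^sup>+t. ?g t \<partial>lebesgue)"
    using nn_integral_real_affine_lebesgue[OF m, of 1 a] by simp
  also have "\<dots> \<le> Fint a (a + \<tau>)"
    unfolding Fint_def using a by (intro nn_integral_mono) (auto simp: indicator_def)
  finally show ?thesis .
qed

text \<open>When \<theta> sweeps the interval from 0 to \<tau>, the points \<theta> + k\<tau> with k
  < m sweep the interval from 0 to m\<tau> once. The uncontrolled point values of F(u) thereby
  become a time integral.\<close>

lemma grid_average_le:
  assumes \<tau>: "0 < \<tau>"
  shows "(\<integral>\<^sup>+\<theta>. (\<Sum>k<m. F (u (\<theta> + real k * \<tau>))) * indicator {0<..<\<tau>} \<theta> \<partial>lebesgue) \<le> Fint 0 (real m * \<tau>)"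
proof -
  have "(\<integral>\<^sup>+\<theta>. (\<Sum>k<m. F (u (\<theta> + real k * \<tau>))) * indicator {0<..<\<tau>} \<theta> \<partial>lebesgue)
     = (\<Sum>k<m. \<integral>\<^sup>+\<theta>. F (u (\<theta> + real k * \<tau>)) * indicator {0<..<\<tau>} \<theta> \<partial>lebesgue)"
    unfolding sum_distrib_right using \<tau> by (intro nn_integral_sum shifted_F_u_measurable) simp
  also have "\<dots> \<le> (\<Sum>k<m. Fint (real k * \<tau>) (real k * \<tau> + \<tau>))"
    using \<tau> by (intro sum_mono shifted_average_le) simp
  also have "\<dots> = Fint 0 (real m * \<tau>)"
  proof (induction m)
    case 0
    show ?case by (simp add: Fint_def)
  next
    case (Suc m)
    have "Fint 0 (real (Suc m) * \<tau>) = Fint 0 (real m * \<tau>) + Fint (real m * \<tau>) (real (Suc m) * \<tau>)"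
      using \<tau> by (intro Fint_add) (auto simp: algebra_simps)
    with Suc show ?case by (simp add: algebra_simps)
  qed
  finally show ?thesis .
qed

text \<open>Integrated over \<theta> and not divided by \<tau>, which keeps the computation inside
  \<open>ennreal\<close>. The condition on \<open>T\<close> leaves room for a last cell under every
  shift; its length is replaced by the larger \<open>T - real m * \<tau>\<close> so that the weight
  no longer depends on \<theta>. With \<open>T\<close> equal to \<open>real (Suc m) * \<tau>\<close>
  this controls the squares, and with c = 0 and a distant \<open>T\<close> it compares averages of
  the energy.\<close>

lemma averaged_grid_inequality:
  assumes \<tau>: "0 < \<tau>" and T: "real (Suc m) * \<tau> \<le> T" and c: "0 \<le> c"
    and S: "\<And>\<theta>. 0 < \<theta> \<Longrightarrow> \<theta> < \<tau> \<Longrightarrow> c \<le> 1/2 * (\<Sum>k<m. (dst (u (\<theta> + real (Suc k) * \<tau>)) (u (\<theta> + real k * \<tau>)))\<^sup>2)"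
  shows "ennreal \<tau> * (Fint 0 T + ennreal c) \<le> ennreal (F0 * \<tau>\<^sup>2 / 2) + ennreal \<tau> * Fint 0 (real m * \<tau>)
     + ennreal (T - real m * \<tau>) * Fint (real m * \<tau>) (real m * \<tau> + \<tau>)"
proof -
  let ?i = "indicator {0<..<\<tau>} :: real \<Rightarrow> ennreal"
  have F0: "0 \<le> F0" by simp
  have m1: "(\<lambda>\<theta>. (\<Sum>k<m. F (u (\<theta> + real k * \<tau>))) * ?i \<theta>) \<in> borel_measurable lebesgue"
    unfolding sum_distrib_right using \<tau> by (intro borel_measurable_sum shifted_F_u_measurable) simp
  have m2: "(\<lambda>\<theta>. F (u (\<theta> + real m * \<tau>)) * ?i \<theta>) \<in> borel_measurable lebesgue"
    using \<tau> by (intro shifted_F_u_measurable) simp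
  have m3: "(\<lambda>\<theta>. ennreal (F0 * \<theta>) * ?i \<theta>) \<in> borel_measurable lebesgue"
    by (intro measurable_completion borel_measurable_times_ennreal borel_measurable_indicator) simp_all
  have "ennreal \<tau> * (Fint 0 T + ennreal c) = (\<integral>\<^sup>+\<theta>. (Fint 0 T + ennreal c) * ?i \<theta> \<partial>lebesgue)"
    using \<tau> by (subst nn_integral_cmult_indicator) (auto simp: mult.commute)
  also have "\<dots> \<le> (\<integral>\<^sup>+\<theta>. ennreal (F0 * \<theta>) * ?i \<theta> + ennreal \<tau> * ((\<Sum>k<m. F (u (\<theta> + real k * \<tau>))) * ?i \<theta>)
      + ennreal (T - real m * \<tau>) * (F (u (\<theta> + real m * \<tau>)) * ?i \<theta>) \<partial>lebesgue)"
  proof (rule nn_integral_mono)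
    fix \<theta>
    show "(Fint 0 T + ennreal c) * ?i \<theta> \<le> ennreal (F0 * \<theta>) * ?i \<theta> + ennreal \<tau> * ((\<Sum>k<m. F (u (\<theta> + real k * \<tau>))) * ?i \<theta>)
      + ennreal (T - real m * \<tau>) * (F (u (\<theta> + real m * \<tau>)) * ?i \<theta>)"
    proof (cases "\<theta> \<in> {0<..<\<tau>}")
      case True
      then have \<theta>: "0 < \<theta>" "\<theta> < \<tau>" by auto
      have lt: "\<theta> + real m * \<tau> < T" using \<theta> T by (simp add: algebra_simps)
      have "Fint 0 T + ennreal c \<le> Fint 0 T + ennreal (1/2 * (\<Sum>k<m. (dst (u (\<theta> + real (Suc k) * \<tau>)) (u (\<theta> + real k * \<tau>)))\<^sup>2))"
        by (intro add_left_mono ennreal_leI S \<theta>)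
      also have "\<dots> \<le> ennreal (F0 * \<theta>) + ennreal \<tau> * (\<Sum>k<m. F (u (\<theta> + real k * \<tau>))) + ennreal (T - \<theta> - real m * \<tau>) * F (u (\<theta> + real m * \<tau>))"
        using shifted_grid_inequality[OF \<theta>(1) \<tau> lt] unfolding Fint_closed .
      also have "\<dots> \<le> ennreal (F0 * \<theta>) + ennreal \<tau> * (\<Sum>k<m. F (u (\<theta> + real k * \<tau>))) + ennreal (T - real m * \<tau>) * F (u (\<theta> + real m * \<tau>))"
        using \<theta> by (intro add_left_mono mult_right_mono ennreal_leI) simp_all
      finally show ?thesis using True by simp
    qed simp
  qed
  also have "\<dots> = (\<integral>\<^sup>+\<theta>. ennreal (F0 * \<theta>) * ?i \<theta> \<partial>lebesgue) + ennreal \<tau> * (\<integral>\<^sup>+\<theta>. (\<Sum>k<m. F (u (\<theta> + real k * \<tau>))) * ?i \<theta> \<partial>lebesgue)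
      + ennreal (T - real m * \<tau>) * (\<integral>\<^sup>+\<theta>. F (u (\<theta> + real m * \<tau>)) * ?i \<theta> \<partial>lebesgue)"
    using m1 m2 m3 by (simp add: nn_integral_add nn_integral_cmult borel_measurable_times_ennreal borel_measurable_add)
  also have "\<dots> \<le> ennreal (F0 * \<tau>\<^sup>2 / 2) + ennreal \<tau> * Fint 0 (real m * \<tau>) + ennreal (T - real m * \<tau>) * Fint (real m * \<tau>) (real m * \<tau> + \<tau>)"
    unfolding nn_integral_identity_interval[OF \<tau> F0]
    using \<tau> by (intro add_mono mult_left_mono order_refl grid_average_le shifted_average_le) simp_all
  finally show ?thesis .
qed

text \<open>If every shift violated the bound, the squares would be bounded below by a constant and
  could be averaged without being measurable in \<theta>. The integrals of F(u) on both sides are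
  then equal and finite and cancel, leaving \<tau>(F0 + \<delta>) \<le> \<tau> F0.\<close>

lemma shifted_grid_energy:
  assumes \<tau>: "0 < \<tau>" and \<delta>: "0 < \<delta>"
  shows "\<exists>\<theta>. 0 < \<theta> \<and> \<theta> < \<tau> \<and> (\<Sum>k<m. (dst (u (\<theta> + real (Suc k) * \<tau>)) (u (\<theta> + real k * \<tau>)))\<^sup>2) < \<tau> * (F0 + \<delta>)"
proof (rule ccontr)
  assume "\<not> ?thesis"
  then have S: "1/2 * (\<tau> * (F0 + \<delta>)) \<le> 1/2 * (\<Sum>k<m. (dst (u (\<theta> + real (Suc k) * \<tau>)) (u (\<theta> + real k * \<tau>)))\<^sup>2)"
    if "0 < \<theta>" "\<theta> < \<tau>" for \<theta> using that by (force simp: not_less)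
  \<comment> \<open>With this end point the last cell has weight exactly \<tau>, so the integrals on
    the right add up to the one on the left.\<close>
  let ?T = "real (Suc m) * \<tau>"
  have T: "0 < ?T" using \<tau> by simp
  have F0: "0 \<le> F0" by simp
  have "ennreal \<tau> * (Fint 0 ?T + ennreal (1/2 * (\<tau> * (F0 + \<delta>)))) \<le> ennreal (F0 * \<tau>\<^sup>2 / 2) + ennreal \<tau> * Fint 0 (real m * \<tau>)
     + ennreal (?T - real m * \<tau>) * Fint (real m * \<tau>) (real m * \<tau> + \<tau>)"
    by (rule averaged_grid_inequality[OF \<tau> order_refl _ S]) (use \<tau> \<delta> F0 in simp_all)
  also have "\<dots> = ennreal (F0 * \<tau>\<^sup>2 / 2) + ennreal \<tau> * Fint 0 ?T"
  proof -
    have "Fint 0 ?T = Fint 0 (real m * \<tau>) + Fint (real m * \<tau>) (real m * \<tau> + \<tau>)"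
      using \<tau> Fint_add[of 0 "real m * \<tau>" ?T] by (simp add: algebra_simps)
    moreover have "?T - real m * \<tau> = \<tau>" by (simp add: algebra_simps)
    ultimately show ?thesis by (simp add: distrib_left add.assoc)
  qed
  finally have *: "ennreal \<tau> * (Fint 0 ?T + ennreal (1/2 * (\<tau> * (F0 + \<delta>)))) \<le> ennreal (F0 * \<tau>\<^sup>2 / 2) + ennreal \<tau> * Fint 0 ?T" .
  have "Fint 0 ?T < top" using Fint_le[OF T] by (rule le_less_trans) simp
  then obtain p where p: "0 \<le> p" "Fint 0 ?T = ennreal p" by (cases "Fint 0 ?T") auto
  have "ennreal (\<tau> * (p + 1/2 * (\<tau> * (F0 + \<delta>)))) \<le> ennreal (F0 * \<tau>\<^sup>2 / 2 + \<tau> * p)"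
    using * \<tau> \<delta> F0 p by (simp add: p ennreal_mult ennreal_plus)
  then have "\<tau> * (p + 1/2 * (\<tau> * (F0 + \<delta>))) \<le> F0 * \<tau>\<^sup>2 / 2 + \<tau> * p"
    using \<tau> p F0 by (subst (asm) ennreal_le_iff) auto
  then have "\<tau>\<^sup>2 * \<delta> \<le> 0" by (simp add: algebra_simps power2_eq_square)
  with \<tau> \<delta> show False by (simp add: mult_le_0_iff)
qed

section \<open>Quadratic variation on prescribed grids and its consequences\<close>

lemma dst_chain_sq:
  assumes "\<And>l. sq_int M (f l)"
  shows "(dst (f q) (f 0))\<^sup>2 \<le> real q * (\<Sum>l<q. (dst (f (Suc l)) (f l))\<^sup>2)"
proof -
  have "dst (f q) (f 0) \<le> (\<Sum>l<q. dst (f (Suc l)) (f l))"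
  proof (induction q)
    case (Suc q)
    then show ?case using nrm2_triangle_diff[of M "f (Suc q)" "f q" "f 0"] assms by simp
  qed (simp add: nrm2_def)
  then have "(dst (f q) (f 0))\<^sup>2 \<le> (\<Sum>l<q. dst (f (Suc l)) (f l))\<^sup>2"
    by (intro power_mono nrm2_nonneg)
  also have "\<dots> \<le> real q * (\<Sum>l<q. (dst (f (Suc l)) (f l))\<^sup>2)"
    using sum_squared_le_sum_of_squares[of "\<lambda>l. dst (f (Suc l)) (f l)" "{..<q}"] by (simp add: mult.commute)
  finally show ?thesis .
qed

text \<open>Each of the \<open>r\<close> cells is split into \<open>Suc q\<close> steps. The
  Cauchy-Schwarz inequality loses the factor \<open>Suc q\<close>, which is exactly regained from
  the smaller step in the bound for a shifted grid. As q grows, the shifted points converge to the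
  prescribed ones and \<open>u\<close> is continuous in L2, so the bound survives on the given
  grid.\<close>

lemma energy_bound:
  assumes s: "0 \<le> s" and L: "0 < L" and r: "0 < r"
  shows "(\<Sum>i<r. (dst (u (s + real (Suc i) * (L / real r))) (u (s + real i * (L / real r))))\<^sup>2) \<le> L / real r * F0"
proof -
  define \<tau> where "\<tau> q = L / (real r * real (Suc q))" for q
  \<comment> \<open>The number of fine steps before \<open>s\<close>, rounded up; the chosen grid
    starts near 0 and has to be entered at this index.\<close>
  define j where "j q = nat \<lceil>s / \<tau> q\<rceil>" for q
  have \<tau>: "0 < \<tau> q" for q unfolding \<tau>_def using L r by simp
  have "\<forall>q. \<exists>\<theta>. 0 < \<theta> \<and> \<theta> < \<tau> q \<and> (\<Sum>k<j q + r * Suc q. (dst (u (\<theta> + real (Suc k) * \<tau> q)) (u (\<theta> + real k * \<tau> q)))\<^sup>2) < \<tau> q * (F0 + 1 / real (Suc q))"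
    by (intro allI shifted_grid_energy[OF \<tau>]) simp
  from choice[OF this] obtain \<theta> where \<theta>: "\<And>q. 0 < \<theta> q" "\<And>q. \<theta> q < \<tau> q"
    and S: "\<And>q. (\<Sum>k<j q + r * Suc q. (dst (u (\<theta> q + real (Suc k) * \<tau> q)) (u (\<theta> q + real k * \<tau> q)))\<^sup>2) < \<tau> q * (F0 + 1 / real (Suc q))"
    by blast
  define x where "x q i = \<theta> q + real (j q + i * Suc q) * \<tau> q" for q i
  have x0: "0 \<le> x q i" for q i unfolding x_def using \<theta>(1)[of q] \<tau>[of q] by simp
  have su: "sq_int M (u t)" if "0 \<le> t" for t by (intro state_sq_int state_u that)
  have bound: "(\<Sum>i<r. (dst (u (x q (Suc i))) (u (x q i)))\<^sup>2) \<le> L / real r * (F0 + 1 / real (Suc q))" for q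
  proof -
    let ?h = "\<lambda>k. (dst (u (\<theta> q + real (Suc k) * \<tau> q)) (u (\<theta> q + real k * \<tau> q)))\<^sup>2"
    have "(dst (u (x q (Suc i))) (u (x q i)))\<^sup>2 \<le> real (Suc q) * (\<Sum>l<Suc q. ?h (j q + (i * Suc q + l)))" for i
    proof -
      let ?f = "\<lambda>l. u (\<theta> q + real (j q + (i * Suc q + l)) * \<tau> q)"
      have "(dst (?f (Suc q)) (?f 0))\<^sup>2 \<le> real (Suc q) * (\<Sum>l<Suc q. (dst (?f (Suc l)) (?f l))\<^sup>2)"
        by (rule dst_chain_sq, rule su) (use \<theta>(1)[of q] \<tau>[of q] in simp)
      moreover have "?f (Suc q) = u (x q (Suc i))" "?f 0 = u (x q i)" by (simp_all add: x_def algebra_simps)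
      ultimately show ?thesis by (simp only: add_Suc_right)
    qed
    then have "(\<Sum>i<r. (dst (u (x q (Suc i))) (u (x q i)))\<^sup>2) \<le> (\<Sum>i<r. real (Suc q) * (\<Sum>l<Suc q. ?h (j q + (i * Suc q + l))))"
      by (rule sum_mono)
    also have "\<dots> = real (Suc q) * (\<Sum>i<r. \<Sum>l<Suc q. ?h (j q + (i * Suc q + l)))"
      by (rule sum_distrib_left[symmetric])
    also have "(\<Sum>i<r. \<Sum>l<Suc q. ?h (j q + (i * Suc q + l))) = (\<Sum>k<r * Suc q. ?h (j q + k))"
      by (rule sum_blocks[where h="\<lambda>k. ?h (j q + k)"])
    also have "real (Suc q) * (\<Sum>k<r * Suc q. ?h (j q + k)) \<le> real (Suc q) * (\<Sum>k<j q + r * Suc q. ?h k)"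
      unfolding sum_lessThan_add[where h="?h"] by (intro mult_left_mono) (simp_all add: sum_nonneg)
    also have "\<dots> \<le> real (Suc q) * (\<tau> q * (F0 + 1 / real (Suc q)))"
      using S[of q] by (intro mult_left_mono) simp_all
    also have "\<dots> = L / real r * (F0 + 1 / real (Suc q))"
      unfolding \<tau>_def using r by (simp add: field_simps del: of_nat_Suc)
    finally show ?thesis .
  qed
  have \<tau>0: "\<tau> \<longlonglongrightarrow> 0"
  proof -
    have "(\<lambda>q. L / real r * (1 / real (Suc q))) \<longlonglongrightarrow> L / real r * 0"
      by (intro tendsto_mult_left lim_1_over_n[THEN LIMSEQ_Suc])
    then show ?thesis unfolding \<tau>_def[abs_def] by simp
  qed
  have xlim: "(\<lambda>q. x q i) \<longlonglongrightarrow> s + real i * (L / real r)" for i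
  proof (rule LIM_zero_cancel, rule Lim_null_comparison)
    \<comment> \<open>One \<tau> accounts for the shift, the other for rounding \<open>s\<close> up
      to a multiple of \<tau>.\<close>
    show "(\<lambda>q. 2 * \<tau> q) \<longlonglongrightarrow> 0" using tendsto_mult_left[OF \<tau>0, of 2] by simp
    show "\<forall>\<^sub>F q in sequentially. norm (x q i - (s + real i * (L / real r))) \<le> 2 * \<tau> q"
    proof (intro always_eventually allI)
      fix q
      have "real i * real (Suc q) * \<tau> q = real i * (L / real r)"
        unfolding \<tau>_def using r by (simp add: field_simps del: of_nat_Suc)
      then have "real (j q + i * Suc q) * \<tau> q = real (j q) * \<tau> q + real i * (L / real r)"
        by (simp only: of_nat_add of_nat_mult distrib_right)
      then have e: "x q i - (s + real i * (L / real r)) = \<theta> q + (real (j q) * \<tau> q - s)"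
        unfolding x_def by simp
      have sj: "s / \<tau> q \<le> real (j q)" "real (j q) < s / \<tau> q + 1"
        unfolding j_def using s \<tau>[of q] by (simp_all add: of_nat_nat) linarith+
      have "s \<le> real (j q) * \<tau> q" "real (j q) * \<tau> q < s + \<tau> q"
        using sj \<tau>[of q] by (simp_all add: field_simps)
      then show "norm (x q i - (s + real i * (L / real r))) \<le> 2 * \<tau> q"
        unfolding e using \<theta>(1)[of q] \<theta>(2)[of q] by simp
    qed
  qed
  have y0: "0 \<le> s + real i * (L / real r)" for i using s L by simp
  have lim: "(\<lambda>q. \<Sum>i<r. (dst (u (x q (Suc i))) (u (x q i)))\<^sup>2) \<longlonglongrightarrow>
     (\<Sum>i<r. (dst (u (s + real (Suc i) * (L / real r))) (u (s + real i * (L / real r))))\<^sup>2)"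
    by (intro tendsto_sum tendsto_power nrm2_dist_tendsto su x0 y0 u_seq xlim)
  have lim2: "(\<lambda>q. L / real r * (F0 + 1 / real (Suc q))) \<longlonglongrightarrow> L / real r * (F0 + 0)"
    by (intro tendsto_intros lim_1_over_n[THEN LIMSEQ_Suc])
  show ?thesis using LIMSEQ_le[OF lim lim2] bound by auto
qed

lemma Hoelder_half:
  assumes "0 \<le> s" "0 \<le> t"
  shows "dst (u s) (u t) \<le> sqrt F0 * sqrt \<bar>s - t\<bar>"
proof -
  have *: "dst (u s) (u t) \<le> sqrt F0 * sqrt \<bar>s - t\<bar>" if "0 \<le> s" "s < t" for s t
  proof -
    have "(dst (u t) (u s))\<^sup>2 \<le> (t - s) * F0"
      using energy_bound[of s "t - s" 1] that by simp
    then have "dst (u t) (u s) \<le> sqrt ((t - s) * F0)" by (rule real_le_rsqrt)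
    then show ?thesis using that nrm2_minus[of M "u s" "u t"] by (simp add: real_sqrt_mult mult.commute)
  qed
  consider "s < t" | "s = t" | "t < s" by linarith
  then show ?thesis
  proof cases
    case 3
    then show ?thesis using *[of t s] assms nrm2_minus[of M "u s" "u t"] by (simp add: abs_minus_commute)
  qed (use * assms in \<open>simp_all add: nrm2_def\<close>)
qed

text \<open>The interval from 0 to \<open>t1\<close> is crossed in m + 1 steps of length \<tau>,
  comparing the means over \<open>{s..t2}\<close> before and after each step. The mean over all of
  \<open>{0..t2}\<close> is at most F0 by the constant test function, and the accumulated error
  vanishes as m grows.\<close>

lemma time_average_bound:
  assumes t: "0 \<le> t1" "t1 < t2"
  shows "Fint t1 t2 \<le> ennreal (F0 * (t2 - t1))"
proof (cases "t1 = 0")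
  case True
  then show ?thesis using Fint_le[of t2] t by simp
next
  case False
  with t have t1: "0 < t1" by simp
  have t2: "0 < t2" using t by simp
  have F0: "0 \<le> F0" by simp
  have fin: "Fint s t2 < top" if "0 \<le> s" "s \<le> t2" for s
  proof -
    have "Fint s t2 \<le> Fint 0 t2" using Fint_add[of 0 s t2] that by simp
    also have "\<dots> < top" using Fint_le[OF t2] by (rule le_less_trans) simp
    finally show ?thesis .
  qed
  define p where "p s = enn2real (Fint s t2)" for s
  have p: "Fint s t2 = ennreal (p s)" "0 \<le> p s" if "0 \<le> s" "s \<le> t2" for s
    using fin[OF that] by (simp_all add: p_def)
  have bound: "p t1 / (t2 - t1) \<le> F0 + (F0 * t1 / (t2 - t1)) * (1 / real (Suc m))" for m
  proof -
    define \<tau> where "\<tau> = t1 / real (Suc m)"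
    have \<tau>: "0 < \<tau>" using t1 by (simp add: \<tau>_def)
    have m\<tau>: "real (Suc m) * \<tau> = t1" by (simp add: \<tau>_def)
    \<comment> \<open>Up to an error of order \<open>\<tau>\<close>, the mean of the energy over \<open>{s..t2}\<close> does not increase in \<open>s\<close>.\<close>
    have step: "p (real (Suc j) * \<tau>) / (t2 - real (Suc j) * \<tau>) \<le> p (real j * \<tau>) / (t2 - real j * \<tau>)
        + F0 * \<tau> * (1 / (t2 - real (Suc j) * \<tau>) - 1 / (t2 - real j * \<tau>))" if j: "j \<le> m" for j
    proof -
      let ?s = "real j * \<tau>" and ?s' = "real (Suc j) * \<tau>"
      have "?s' \<le> real (Suc m) * \<tau>" using j \<tau> by (intro mult_right_mono) auto
      then have s': "?s' \<le> t1" using m\<tau> by simp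
      have ss: "?s' = ?s + \<tau>" by (simp add: algebra_simps)
      have s0: "0 \<le> ?s" using \<tau> by simp
      have lt: "?s' < t2" "?s < t2" "?s \<le> ?s'" using s' ss t \<tau> by auto
      have "ennreal \<tau> * (Fint 0 t2 + ennreal 0) \<le> ennreal (F0 * \<tau>\<^sup>2 / 2) + ennreal \<tau> * Fint 0 ?s + ennreal (t2 - ?s) * Fint ?s (?s + \<tau>)"
        by (rule averaged_grid_inequality[OF \<tau>]) (use lt in \<open>auto intro!: sum_nonneg\<close>)
      moreover obtain a where a: "0 \<le> a" "Fint 0 ?s = ennreal a"
      proof -
        have "Fint 0 ?s \<le> Fint 0 t2" using Fint_add[of 0 ?s t2] s0 lt by simp
        also have "\<dots> < top" by (rule fin) (use t2 in simp_all)
        finally show thesis by (cases "Fint 0 ?s") (auto intro: that)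
      qed
      moreover obtain b where b: "0 \<le> b" "Fint ?s (?s + \<tau>) = ennreal b" "p ?s = b + p ?s'"
      proof -
        have e: "Fint ?s t2 = Fint ?s (?s + \<tau>) + Fint ?s' t2" unfolding ss[symmetric] by (rule Fint_add) (use s0 lt in auto)
        have "Fint ?s (?s + \<tau>) \<le> Fint ?s t2" unfolding e by simp
        also have "\<dots> < top" by (rule fin) (use s0 lt in simp_all)
        finally obtain b where b: "0 \<le> b" "Fint ?s (?s + \<tau>) = ennreal b" by (cases "Fint ?s (?s + \<tau>)") auto
        have "ennreal (p ?s) = ennreal (b + p ?s')"
          using e p[of ?s] p[of ?s'] b s0 lt by (simp add: ennreal_plus)
        then have "p ?s = b + p ?s'" using p[of ?s] p[of ?s'] b s0 lt by (subst (asm) ennreal_inj) auto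
        with b show thesis by (rule that)
      qed
      moreover have "Fint 0 t2 = ennreal a + ennreal (p ?s)"
        using Fint_add[of 0 ?s t2] s0 lt a p[of ?s] by simp
      ultimately have "ennreal (\<tau> * (a + p ?s)) \<le> ennreal (F0 * \<tau>\<^sup>2 / 2 + \<tau> * a + (t2 - ?s) * b)"
        using \<tau> p[of ?s] s0 lt F0 by (simp add: ennreal_mult ennreal_plus)
      then have "\<tau> * (a + p ?s) \<le> F0 * \<tau>\<^sup>2 / 2 + \<tau> * a + (t2 - ?s) * b"
        using \<tau> a b lt F0 by (subst (asm) ennreal_le_iff) auto
      then have le: "\<tau> * p ?s \<le> F0 * \<tau>\<^sup>2 / 2 + (t2 - ?s) * (p ?s - p ?s')"
        using b(3) by (simp add: algebra_simps)
      define D where "D = t2 - ?s'"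
      define E where "E = t2 - ?s"
      have D: "0 < D" "E = D + \<tau>" "0 < E" using lt ss by (auto simp: D_def E_def)
      have le': "\<tau> * p ?s \<le> F0 * \<tau>\<^sup>2 / 2 + E * (p ?s - p ?s')" using le unfolding E_def .
      \<comment> \<open>The error term is doubled here, only to make it divide into a telescoping
        form below.\<close>
      have "E * p ?s' \<le> (E - \<tau>) * p ?s + F0 * \<tau>\<^sup>2"
        using le' mult_nonneg_nonneg[OF F0 zero_le_power2[of \<tau>]] unfolding left_diff_distrib right_diff_distrib by linarith
      then have "E * p ?s' \<le> D * p ?s + F0 * \<tau>\<^sup>2" using D by simp
      then have "(E * p ?s') / (D * E) \<le> (D * p ?s + F0 * \<tau>\<^sup>2) / (D * E)"
        using D by (intro divide_right_mono) simp_all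
      moreover have "(E * p ?s') / (D * E) = p ?s' / D" using D by simp
      moreover have "(D * p ?s + F0 * \<tau>\<^sup>2) / (D * E) = p ?s / E + F0 * \<tau> * (1 / D - 1 / E)"
      proof -
        \<comment> \<open>Since D and E differ by \<tau>, the error \<tau>^2/(DE) is \<tau> times a
          difference of reciprocals. Over all steps it telescopes to order \<tau> instead of
          accumulating.\<close>
        have "1 / D - 1 / E = \<tau> / (D * E)" using D(1,3) diff_frac_eq[of D E 1 1] D(2) by simp
        then have "F0 * \<tau> * (1 / D - 1 / E) = F0 * \<tau>\<^sup>2 / (D * E)" by (simp add: power2_eq_square)
        then show ?thesis using D(1) by (simp add: add_divide_distrib)
      qed
      ultimately show ?thesis unfolding D_def E_def by simp
    qed
    have "p (real n * \<tau>) / (t2 - real n * \<tau>) \<le> p 0 / t2 + F0 * \<tau> * (1 / (t2 - real n * \<tau>) - 1 / t2)" if "n \<le> Suc m" for n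
      using that
    proof (induction n)
      case (Suc n)
      then have "p (real n * \<tau>) / (t2 - real n * \<tau>) \<le> p 0 / t2 + F0 * \<tau> * (1 / (t2 - real n * \<tau>) - 1 / t2)" by simp
      moreover have "n \<le> m" using Suc by simp
      ultimately show ?case using step[of n] by (simp add: algebra_simps)
    qed simp
    from this[of "Suc m"] have "p t1 / (t2 - t1) \<le> p 0 / t2 + F0 * \<tau> * (1 / (t2 - t1) - 1 / t2)"
      unfolding m\<tau> by simp
    also have "p 0 / t2 \<le> F0"
    proof -
      have "ennreal (p 0) \<le> ennreal (F0 * t2)" using Fint_le[OF t2] p[of 0] t2 by simp
      then have "p 0 \<le> F0 * t2" using F0 t2 by (subst (asm) ennreal_le_iff) auto
      then show ?thesis using t2 by (simp add: field_simps)
    qed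
    also have "F0 * \<tau> * (1 / (t2 - t1) - 1 / t2) \<le> F0 * \<tau> * (1 / (t2 - t1))"
      using F0 \<tau> t2 by (intro mult_left_mono) simp_all
    also have "F0 * \<tau> * (1 / (t2 - t1)) = (F0 * t1 / (t2 - t1)) * (1 / real (Suc m))"
      by (simp add: \<tau>_def)
    finally show ?thesis by simp
  qed
  have "(\<lambda>m. F0 + (F0 * t1 / (t2 - t1)) * (1 / real (Suc m))) \<longlonglongrightarrow> F0 + (F0 * t1 / (t2 - t1)) * 0"
    by (intro tendsto_intros lim_1_over_n[THEN LIMSEQ_Suc])
  then have "p t1 / (t2 - t1) \<le> F0" using bound by (intro LIMSEQ_le_const) auto
  then have "p t1 \<le> F0 * (t2 - t1)" using t by (simp add: field_simps)
  then show ?thesis using p[of t1] t by (simp add: ennreal_leI)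
qed

end

subsection \<open>Smooth bump functions\<close>

lemma Ck_Suc_imp: "Ck (Suc k) f \<Longrightarrow> Ck k f"
proof (induction k arbitrary: f)
  case 0
  then show ?case by (auto intro: differentiable_imp_continuous_on)
next
  case (Suc k)
  then show ?case using Suc.IH by (metis Ck.simps(2))
qed

lemma Ck_const: "Ck k (\<lambda>x. c)"
proof (induction k arbitrary: c)
  case (Suc k)
  have "frechet_derivative (\<lambda>x::'a. c) (at x) = (\<lambda>_. 0)" for x
    by (rule frechet_derivative_at[symmetric]) simp
  with Suc show ?case by (auto simp: differentiable_on_def)
qed simp

lemma Ck_SucI:
  assumes "\<And>x. (f has_derivative D x) (at x)" "\<And>i. i \<in> Basis \<Longrightarrow> Ck k (\<lambda>x. D x i)"
  shows "Ck (Suc k) f"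
proof -
  have "frechet_derivative f (at x) = D x" for x
    using frechet_derivative_at[OF assms(1)] by simp
  moreover have "f differentiable (at x)" for x using assms(1)[of x] by (auto simp: differentiable_def)
  ultimately show ?thesis using assms(2) by (simp add: differentiable_on_def)
qed

lemma Ck_SucD:
  assumes "Ck (Suc k) f"
  shows "(f has_derivative frechet_derivative f (at x)) (at x)"
    "i \<in> Basis \<Longrightarrow> Ck k (\<lambda>x. frechet_derivative f (at x) i)"
  using assms by (auto simp: differentiable_on_def frechet_derivative_works)

lemma Ck_add: "Ck k f \<Longrightarrow> Ck k g \<Longrightarrow> Ck k (\<lambda>x. f x + g x)"
proof (induction k arbitrary: f g)
  case (Suc k)
  show ?case
    by (rule Ck_SucI[OF has_derivative_add[OF Ck_SucD(1)[OF Suc.prems(1)] Ck_SucD(1)[OF Suc.prems(2)]]])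
       (rule Suc.IH[OF Ck_SucD(2)[OF Suc.prems(1)] Ck_SucD(2)[OF Suc.prems(2)]])
qed (auto intro: continuous_intros)

lemma Ck_mult: "Ck k f \<Longrightarrow> Ck k g \<Longrightarrow> Ck k (\<lambda>x. f x * g x)"
proof (induction k arbitrary: f g)
  case (Suc k)
  note f = Suc.prems(1) and g = Suc.prems(2)
  show ?case
  proof (rule Ck_SucI[OF has_derivative_mult[OF Ck_SucD(1)[OF f] Ck_SucD(1)[OF g]]])
    fix i :: 'a assume "i \<in> Basis"
    then show "Ck k (\<lambda>x. f x * frechet_derivative g (at x) i + frechet_derivative f (at x) i * g x)"
      using f g by (intro Ck_add Suc.IH Ck_SucD(2) Ck_Suc_imp[of k f] Ck_Suc_imp[of k g])
  qed
qed (auto intro: continuous_intros)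

lemma Ck_prod: "(\<And>i. i \<in> I \<Longrightarrow> Ck k (f i)) \<Longrightarrow> Ck k (\<lambda>x. \<Prod>i\<in>I. f i x)"
proof (induction I rule: infinite_finite_induct)
  case (insert i I)
  have "Ck k (\<lambda>x. f i x * (\<Prod>i\<in>I. f i x))"
    by (rule Ck_mult) (use insert in simp_all)
  then show ?case using insert.hyps by simp
qed (simp_all add: Ck_const)

text \<open>The linear span of these functions is closed under differentiation, so that no polynomials in
  \<open>1 / s\<close> are needed.\<close>

definition flat_exp :: "nat \<Rightarrow> real \<Rightarrow> real" where
  "flat_exp m s = (if 0 < s then (1 / s) ^ m * exp (- (1 / s)) else 0)"

lemma flat_exp_tendsto_0: "(flat_exp m \<longlongrightarrow> 0) (at_right 0)"
proof -
  have "((\<lambda>s. (inverse s) ^ m / exp (inverse s :: real)) \<longlongrightarrow> 0) (at_right 0)"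
    by (rule filterlim_compose[OF tendsto_power_div_exp_0 filterlim_inverse_at_top_right])
  then show ?thesis
    by (rule Lim_transform_eventually)
       (auto simp: eventually_at_right_field flat_exp_def exp_minus field_simps intro!: exI[of _ 1])
qed

text \<open>One differentiation only raises the exponent in front of the exponential, so smoothness
  follows by an induction over all \<open>m\<close> at once.\<close>

lemma flat_exp_derivative:
  "(flat_exp m has_real_derivative flat_exp (m + 2) s - real m * flat_exp (m + 1) s) (at s)"
proof -
  consider "0 < s" | "s = 0" | "s < 0" by linarith
  then show ?thesis
  proof cases
    case 1
    have d1: "((\<lambda>s. 1 / s) has_real_derivative - (1 / s\<^sup>2)) (at s)"
      using 1 by (auto intro!: derivative_eq_intros simp: power2_eq_square)
    have d2: "((\<lambda>s. exp (- (1 / s))) has_real_derivative exp (- (1 / s)) * (1 / s\<^sup>2)) (at s)"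
      using DERIV_chain2[OF DERIV_exp DERIV_minus[OF d1]] by simp
    have "((\<lambda>s. (1 / s) ^ m * exp (- (1 / s))) has_real_derivative
        (real m * (1 / s) ^ (m - 1) * (- (1 / s\<^sup>2)) * exp (- (1 / s)) + (1 / s) ^ m * (exp (- (1 / s)) * (1 / s\<^sup>2)))) (at s)"
      using DERIV_mult[OF DERIV_power[OF d1, of m] d2] by (simp add: mult_ac)
    also have "real m * (1 / s) ^ (m - 1) * (- (1 / s\<^sup>2)) * exp (- (1 / s)) + (1 / s) ^ m * (exp (- (1 / s)) * (1 / s\<^sup>2))
        = flat_exp (m + 2) s - real m * flat_exp (m + 1) s"
    proof (cases m)
      case (Suc j)
      then show ?thesis using 1 by (simp add: flat_exp_def power2_eq_square field_simps)
    qed (use 1 in \<open>simp add: flat_exp_def power2_eq_square field_simps\<close>)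
    finally show ?thesis
      by (rule has_field_derivative_transform_within_open[where S="{0<..}"]) (use 1 in \<open>auto simp: flat_exp_def\<close>)
  next
    case 3
    have "((\<lambda>_. 0) has_real_derivative 0) (at s)" by simp
    then have "(flat_exp m has_real_derivative 0) (at s)"
      by (rule has_field_derivative_transform_within_open[where S="{..<0}"]) (use 3 in \<open>auto simp: flat_exp_def\<close>)
    then show ?thesis using 3 by (simp add: flat_exp_def)
  next
    case 2
    have "((\<lambda>h. (flat_exp m (0 + h) - flat_exp m 0) / h) \<longlongrightarrow> 0) (at 0)"
      unfolding filterlim_at_split
    proof
      show "((\<lambda>h. (flat_exp m (0 + h) - flat_exp m 0) / h) \<longlongrightarrow> 0) (at_left 0)"
        by (rule Lim_transform_eventually[OF tendsto_const])
           (auto simp: eventually_at_left_field flat_exp_def intro!: exI[of _ "-1"])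
      \<comment> \<open>To the right of 0 the difference quotient at 0 is
        \<open>flat_exp (Suc m)\<close> itself, whose limit is already known.\<close>
      show "((\<lambda>h. (flat_exp m (0 + h) - flat_exp m 0) / h) \<longlongrightarrow> 0) (at_right 0)"
        by (rule Lim_transform_eventually[OF flat_exp_tendsto_0[of "Suc m"]])
           (auto simp: eventually_at_right_field flat_exp_def field_simps intro!: exI[of _ 1])
    qed
    then show ?thesis using 2 by (simp add: DERIV_def flat_exp_def)
  qed
qed

text \<open>The affine argument is part of the statement because the chain rule only multiplies by
  the constant \<open>a * (i \<bullet> v)\<close>; the induction then closes with sums and products
  alone.\<close>

lemma Ck_flat_exp: "Ck k (\<lambda>x. flat_exp m (a * (x \<bullet> v) + b))"
proof (induction k arbitrary: m)
  case 0
  have "continuous_on UNIV (flat_exp m)"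
    by (rule DERIV_continuous_on[OF has_field_derivative_at_within[OF flat_exp_derivative]])
  then have "continuous_on UNIV (\<lambda>x. flat_exp m (a * (x \<bullet> v) + b))"
    by (rule continuous_on_compose2) (auto intro!: continuous_intros)
  then show ?case by simp
next
  case (Suc k)
  let ?y = "\<lambda>x. a * (x \<bullet> v) + b"
  show ?case
  proof (rule Ck_SucI)
    fix x
    have "(?y has_derivative (\<lambda>h. a * (h \<bullet> v))) (at x)" by (auto intro!: derivative_eq_intros)
    moreover have "(flat_exp m has_derivative (\<lambda>h. (flat_exp (m + 2) (?y x) - real m * flat_exp (m + 1) (?y x)) * h)) (at (?y x))"
      using flat_exp_derivative[of m "?y x"] by (simp add: has_field_derivative_def)
    ultimately show "((\<lambda>x. flat_exp m (?y x)) has_derivative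
       (\<lambda>h. (flat_exp (m + 2) (?y x) + (- real m) * flat_exp (m + 1) (?y x)) * (a * (h \<bullet> v)))) (at x)"
      using diff_chain_at[of ?y _ x "flat_exp m"] by (simp add: o_def)
  next
    fix i
    show "Ck k (\<lambda>x. (flat_exp (m + 2) (?y x) + (- real m) * flat_exp (m + 1) (?y x)) * (a * (i \<bullet> v)))"
      by (rule Ck_mult[OF Ck_add[OF Suc.IH Ck_mult[OF Ck_const Suc.IH]] Ck_const])
  qed
qed

text \<open>Dilation by \<open>Suc n\<close> steepens every factor without moving its zero set, so
  the functions stay supported in the closed box and converge to the indicator of the open one.
  Approximating indicators of boxes takes the place of mollifying the function to be tested.\<close>

definition box_bump :: "nat \<Rightarrow> 'b::euclidean_space \<Rightarrow> 'b \<Rightarrow> 'b \<Rightarrow> real" where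
  "box_bump n c d x = (\<Prod>i\<in>Basis. flat_exp 0 (real (Suc n) * (x \<bullet> i) + - (real (Suc n) * (c \<bullet> i)))
      * flat_exp 0 (- real (Suc n) * (x \<bullet> i) + real (Suc n) * (d \<bullet> i)))"

lemma flat_exp_0: "0 \<le> flat_exp 0 s" "flat_exp 0 s \<le> 1" "s \<le> 0 \<Longrightarrow> flat_exp 0 s = 0"
  by (simp_all add: flat_exp_def)

lemma box_bump_smooth: "smooth (box_bump n c d)"
  unfolding smooth_def box_bump_def[abs_def] by (rule allI, rule Ck_prod, rule Ck_mult; rule Ck_flat_exp)

lemma box_bump_bounds: "0 \<le> box_bump n c d x" "box_bump n c d x \<le> 1"
  unfolding box_bump_def
  by (rule prod_nonneg, rule mult_nonneg_nonneg, rule flat_exp_0, rule flat_exp_0,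
      rule prod_le_1, rule conjI, rule mult_nonneg_nonneg, rule flat_exp_0, rule flat_exp_0,
      rule mult_le_one, rule flat_exp_0, rule flat_exp_0, rule flat_exp_0)

lemma box_bump_eq_0:
  assumes "x \<notin> box c d" shows "box_bump n c d x = 0"
proof -
  from assms obtain i where i: "i \<in> Basis" "x \<bullet> i \<le> c \<bullet> i \<or> d \<bullet> i \<le> x \<bullet> i"
    by (auto simp: mem_box not_less)
  then have "real (Suc n) * (x \<bullet> i) + - (real (Suc n) * (c \<bullet> i)) \<le> 0 \<or> - real (Suc n) * (x \<bullet> i) + real (Suc n) * (d \<bullet> i) \<le> 0"
    by (auto simp del: of_nat_Suc)
  then have "flat_exp 0 (real (Suc n) * (x \<bullet> i) + - (real (Suc n) * (c \<bullet> i)))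
      * flat_exp 0 (- real (Suc n) * (x \<bullet> i) + real (Suc n) * (d \<bullet> i)) = 0"
    using flat_exp_0(3) by (metis mult_eq_0_iff)
  with i(1) show ?thesis unfolding box_bump_def by (intro prod_zero) auto
qed

lemma box_bump_supp: "supp (box_bump n c d) \<subseteq> cbox c d"
  unfolding supp_def by (rule closure_minimal) (use box_bump_eq_0 box_subset_cbox in blast)+

lemma box_bump_Cinf_c: "Cinf_c (box_bump n c d)"
proof -
  have "closed (supp (box_bump n c d))" by (simp add: supp_def)
  then have "compact (supp (box_bump n c d))"
    by (metis box_bump_supp compact_cbox compact_Int_closed inf.absorb_iff2)
  then show ?thesis by (simp add: Cinf_c_def box_bump_smooth)
qed

lemma flat_exp_dilation_tendsto:
  assumes "0 < s" shows "(\<lambda>n. flat_exp 0 (real (Suc n) * s)) \<longlonglongrightarrow> 1"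
proof -
  have "(\<lambda>n. exp (- (1 / s * (1 / real (Suc n))))) \<longlonglongrightarrow> exp (- (1 / s * 0))"
    by (intro tendsto_intros lim_1_over_n[THEN LIMSEQ_Suc])
  then show ?thesis using assms by (simp add: flat_exp_def mult.commute del: of_nat_Suc)
qed

lemma box_bump_tendsto: "(\<lambda>n. box_bump n c d x) \<longlonglongrightarrow> indicator (box c d) x"
proof (cases "x \<in> box c d")
  case True
  have "(\<lambda>n. box_bump n c d x) \<longlonglongrightarrow> (\<Prod>i\<in>(Basis::'a set). 1 * 1)"
    unfolding box_bump_def
  proof (intro tendsto_prod tendsto_mult)
    fix i :: 'a assume i: "i \<in> Basis"
    then have "0 < x \<bullet> i - c \<bullet> i" "0 < d \<bullet> i - x \<bullet> i" using True by (auto simp: mem_box)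
    from this[THEN flat_exp_dilation_tendsto]
    show "(\<lambda>n. flat_exp 0 (real (Suc n) * (x \<bullet> i) + - (real (Suc n) * (c \<bullet> i)))) \<longlonglongrightarrow> 1"
      "(\<lambda>n. flat_exp 0 (- real (Suc n) * (x \<bullet> i) + real (Suc n) * (d \<bullet> i))) \<longlonglongrightarrow> 1"
      by (simp_all add: algebra_simps)
  qed
  then show ?thesis using True by simp
qed (simp add: box_bump_eq_0)

subsection \<open>The fundamental lemma of the calculus of variations\<close>

text \<open>The positive and the negative part of a Borel representative are densities of two finite
  measures that agree on open boxes. These form a generator stable under intersection, so the
  measures coincide, and the uniqueness of densities makes both parts equal, hence 0.\<close>

lemma AE_zero_if_box_integrals_zero:
  fixes h :: "'b::euclidean_space \<Rightarrow> real"
  assumes int: "integrable lebesgue (\<lambda>x. indicator (cbox a b) x * h x)"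
    and zero: "\<And>c d. cbox c d \<subseteq> cbox a b \<Longrightarrow> (\<integral>x. indicator (box c d) x * h x \<partial>lebesgue) = 0"
  shows "AE x in lebesgue. x \<in> box a b \<longrightarrow> h x = 0"
proof -
  let ?h = "\<lambda>x. indicator (box a b) x * h x"
  have ih: "integrable lebesgue ?h"
  proof -
    have "integrable lebesgue (\<lambda>x. indicator (box a b) x *\<^sub>R (indicator (cbox a b) x * h x))"
      by (rule integrable_mult_indicator[OF _ int]) simp
    moreover have "(\<lambda>x. indicator (box a b) x *\<^sub>R (indicator (cbox a b) x * h x)) = ?h"
    proof
      fix x show "indicator (box a b) x *\<^sub>R (indicator (cbox a b) x * h x) = ?h x"
        using box_subset_cbox[of a b] by (cases "x \<in> box a b") auto
    qed
    ultimately show ?thesis by simp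
  qed
  then have "?h \<in> borel_measurable lebesgue" by simp
  from completion_ex_borel_measurable_real[OF this] obtain H where
    H[measurable]: "H \<in> borel_measurable lborel" and ae: "AE x in lborel. ?h x = H x" by auto
  have ae': "AE x in lebesgue. ?h x = H x" by (rule AE_completion[OF ae])
  have "integrable lebesgue H"
    using ih measurable_completion[OF H] ae' by (rule integrable_cong_AE_imp)
  then have iH: "integrable lborel H" by (simp add: integrable_completion[OF H])
  have boxH: "(\<integral>x. indicator (box l u) x * H x \<partial>lborel) = 0" for l u
  proof -
    have m: "(\<lambda>x. indicator (box l u) x * H x) \<in> borel_measurable lborel"
      by (intro borel_measurable_times borel_measurable_indicator H) simp
    have "(\<integral>x. indicator (box l u) x * H x \<partial>lborel) = (\<integral>x. indicator (box l u) x * H x \<partial>lebesgue)"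
      by (rule integral_completion[symmetric, OF m])
    also have "\<dots> = (\<integral>x. indicator (box l u) x * ?h x \<partial>lebesgue)"
    proof (rule integral_cong_AE)
      show "(\<lambda>x. indicator (box l u) x * ?h x) \<in> borel_measurable lebesgue"
        by (rule borel_measurable_times[OF borel_measurable_indicator borel_measurable_integrable[OF ih]]) simp
      show "AE x in lebesgue. indicator (box l u) x * H x = indicator (box l u) x * ?h x"
        using ae' by eventually_elim simp
    qed (rule measurable_completion[OF m])
    also have "\<dots> = 0"
    proof (cases "box l u \<inter> box a b = {}")
      case True
      then have "indicator (box l u) x * ?h x = 0" for x
        by (cases "x \<in> box l u"; cases "x \<in> box a b") auto
      then show ?thesis by (simp only: Bochner_Integration.integral_zero)
    next
      case False
      \<comment> \<open>The intersection with \<open>box a b\<close> is again an open box. Being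
        nonempty, it has the closed box as its closure, which therefore stays inside
        \<open>cbox a b\<close>.\<close>
      define c where "c = (\<Sum>i\<in>Basis. max (l \<bullet> i) (a \<bullet> i) *\<^sub>R i)"
      define d where "d = (\<Sum>i\<in>Basis. min (u \<bullet> i) (b \<bullet> i) *\<^sub>R i)"
      have box: "box l u \<inter> box a b = box c d" unfolding c_def d_def by (rule box_Int_box)
      have "box c d \<subseteq> cbox a b" using box box_subset_cbox[of a b] by blast
      then have "cbox c d \<subseteq> cbox a b"
        using False box closure_box[of c d] closure_minimal[of "box c d" "cbox a b", OF _ closed_cbox] by simp
      from zero[OF this] have "(\<integral>x. indicator (box c d) x * h x \<partial>lebesgue) = 0" .
      moreover have "(\<lambda>x. indicator (box l u) x * ?h x) = (\<lambda>x. indicator (box c d) x * h x)"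
        unfolding box[symmetric] by (auto simp: indicator_def)
      ultimately show ?thesis by simp
    qed
    finally show ?thesis .
  qed
  let ?P = "density lborel (\<lambda>x. ennreal (H x))" and ?N = "density lborel (\<lambda>x. ennreal (- H x))"
  have fin: "(\<integral>\<^sup>+x. ennreal (H x) \<partial>lborel) < \<infinity>" "(\<integral>\<^sup>+x. ennreal (- H x) \<partial>lborel) < \<infinity>"
    using iH unfolding real_integrable_def by (auto simp: less_top)
  have eqb: "emeasure ?P (box l u) = emeasure ?N (box l u)" for l u
  proof -
    let ?I = "\<lambda>x. indicator (box l u) x * H x"
    have iI: "integrable lborel ?I"
      using integrable_mult_indicator[of "box l u" lborel H] iH by simp
    have e1: "emeasure ?P (box l u) = (\<integral>\<^sup>+x. ennreal (?I x) \<partial>lborel)"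
      by (subst emeasure_density) (auto intro!: nn_integral_cong simp: indicator_def)
    have e2: "emeasure ?N (box l u) = (\<integral>\<^sup>+x. ennreal (- ?I x) \<partial>lborel)"
      by (subst emeasure_density) (auto intro!: nn_integral_cong simp: indicator_def)
    have f: "(\<integral>\<^sup>+x. ennreal (?I x) \<partial>lborel) \<noteq> \<infinity>" "(\<integral>\<^sup>+x. ennreal (- ?I x) \<partial>lborel) \<noteq> \<infinity>"
      using iI unfolding real_integrable_def by auto
    have "enn2real (\<integral>\<^sup>+x. ennreal (?I x) \<partial>lborel) - enn2real (\<integral>\<^sup>+x. ennreal (- ?I x) \<partial>lborel) = 0"
      using real_lebesgue_integral_def[OF iI] boxH[of l u] by simp
    then have eqr: "enn2real (\<integral>\<^sup>+x. ennreal (?I x) \<partial>lborel) = enn2real (\<integral>\<^sup>+x. ennreal (- ?I x) \<partial>lborel)" by simp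
    have "y = z" if "y \<noteq> \<infinity>" "z \<noteq> \<infinity>" "enn2real y = enn2real z" for y z
      using that by (cases y; cases z) auto
    from this[OF f eqr] show ?thesis unfolding e1 e2 .
  qed
  have "?P = ?N"
  proof (rule measure_eqI_generator_eq[where E="range (\<lambda>(l, u). box l u)" and \<Omega>=UNIV and A="\<lambda>n. box (- (real n *\<^sub>R One)) (real n *\<^sub>R One)"])
    show "Int_stable (range (\<lambda>(l::'b, u). box l u))"
      by (auto simp: Int_stable_def box_Int_box)
    show "(\<Union>n. box (- (real n *\<^sub>R One)) (real n *\<^sub>R One)) = (UNIV :: 'b set)" by (rule UN_box_eq_UNIV)
    show "sets ?P = sigma_sets UNIV (range (\<lambda>(l, u). box l u))" "sets ?N = sigma_sets UNIV (range (\<lambda>(l, u). box l u))"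
      by (simp_all add: borel_eq_box sets_measure_of)
    show "emeasure ?P (box (- (real n *\<^sub>R One)) (real n *\<^sub>R One)) \<noteq> \<infinity>" for n
    proof -
      have "emeasure ?P (box (- (real n *\<^sub>R One)) (real n *\<^sub>R One)) \<le> (\<integral>\<^sup>+x. ennreal (H x) \<partial>lborel)"
        by (subst emeasure_density) (auto intro!: nn_integral_mono simp: indicator_def)
      then show ?thesis using fin(1) by (auto simp: top_unique)
    qed
  qed (use eqb in auto)
  then have "AE x in lborel. ennreal (H x) = ennreal (- H x)"
    by (subst (asm) finite_density_unique) (use fin in \<open>auto intro!: measurable_compose[OF _ measurable_ennreal] borel_measurable_uminus\<close>)
  then have "AE x in lborel. H x = 0"
  proof eventually_elim
    case (elim x)
    show ?case
    proof (cases "0 \<le> H x")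
      case True
      then have "ennreal (- H x) = 0" by (simp add: ennreal_neg)
      with elim True show ?thesis by (simp add: ennreal_eq_0_iff)
    next
      case False
      then have "ennreal (H x) = 0" by (simp add: ennreal_neg)
      with elim False have "ennreal (- H x) = 0" by simp
      with False show ?thesis by (simp add: ennreal_eq_0_iff)
    qed
  qed
  then have "AE x in lebesgue. H x = 0" by (rule AE_completion)
  with ae' show ?thesis by eventually_elim (auto simp: indicator_def)
qed

text \<open>Bump functions converge boundedly to indicators of boxes, so dominated convergence gives
  vanishing box integrals inside \<open>S\<close>. Countably many closed boxes cover
  \<open>S\<close>, and their boundaries are negligible.\<close>

lemma fundamental_lemma_calculus_variations:
  fixes h :: "'b::euclidean_space \<Rightarrow> real"
  assumes S: "open S"
    and loc: "\<And>K. compact K \<Longrightarrow> K \<subseteq> S \<Longrightarrow> integrable (lebesgue_on K) h"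
    and zero: "\<And>\<phi>. Cinf_c \<phi> \<Longrightarrow> supp \<phi> \<subseteq> S \<Longrightarrow> (\<integral>x. h x * \<phi> x \<partial>lebesgue_on S) = 0"
  shows "AE x in lebesgue. x \<in> S \<longrightarrow> h x = 0"
proof -
  have Ss: "S \<in> sets lebesgue" using S by simp
  have int: "integrable lebesgue (\<lambda>x. indicator (cbox c d) x * h x)" if "cbox c d \<subseteq> S" for c d
    using loc[OF compact_cbox that] by (simp add: integrable_restrict_space)
  have box: "(\<integral>x. indicator (box c d) x * h x \<partial>lebesgue) = 0" if sub: "cbox c d \<subseteq> S" for c d
  proof -
    have z: "(\<integral>x. box_bump n c d x * (indicator (cbox c d) x * h x) \<partial>lebesgue) = 0" for n
    proof -
      have "(\<integral>x. h x * box_bump n c d x \<partial>lebesgue_on S) = 0"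
        by (rule zero[OF box_bump_Cinf_c]) (use box_bump_supp sub in blast)
      also have "(\<integral>x. h x * box_bump n c d x \<partial>lebesgue_on S) = (\<integral>x. indicator S x *\<^sub>R (h x * box_bump n c d x) \<partial>lebesgue)"
        using Ss by (subst integral_restrict_space) auto
      also have "\<dots> = (\<integral>x. box_bump n c d x * (indicator (cbox c d) x * h x) \<partial>lebesgue)"
      proof (rule Bochner_Integration.integral_cong[OF refl])
        fix x show "indicator S x *\<^sub>R (h x * box_bump n c d x) = box_bump n c d x * (indicator (cbox c d) x * h x)"
        proof (cases "x \<in> box c d")
          case True
          then have "x \<in> cbox c d" "x \<in> S" using box_subset_cbox sub by blast+
          then show ?thesis by simp
        qed (simp add: box_bump_eq_0)
      qed
      finally show ?thesis by simp
    qed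
    have bm: "box_bump n c d \<in> borel_measurable lebesgue" for n
    proof -
      have "continuous_on UNIV (box_bump n c d)" by (rule C1_c_continuous[OF Cinf_c_C1_c[OF box_bump_Cinf_c]])
      then show ?thesis using borel_measurable_continuous_onI by (intro measurable_completion) simp
    qed
    have "(\<lambda>n. \<integral>x. box_bump n c d x * (indicator (cbox c d) x * h x) \<partial>lebesgue)
       \<longlonglongrightarrow> (\<integral>x. indicator (box c d) x * (indicator (cbox c d) x * h x) \<partial>lebesgue)"
    proof (rule integral_dominated_convergence[where w="\<lambda>x. \<bar>indicator (cbox c d) x * h x\<bar>"])
      have hm: "(\<lambda>x. indicator (cbox c d) x * h x) \<in> borel_measurable lebesgue" using int[OF sub] by simp
      show "(\<lambda>x. indicator (box c d) x * (indicator (cbox c d) x * h x)) \<in> borel_measurable lebesgue"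
        by (intro borel_measurable_times[OF borel_measurable_indicator hm]) simp
      show "(\<lambda>x. box_bump n c d x * (indicator (cbox c d) x * h x)) \<in> borel_measurable lebesgue" for n
        by (rule borel_measurable_times[OF bm hm])
      show "integrable lebesgue (\<lambda>x. \<bar>indicator (cbox c d) x * h x\<bar>)" using int[OF sub] by (rule integrable_abs)
      show "AE x in lebesgue. (\<lambda>n. box_bump n c d x * (indicator (cbox c d) x * h x)) \<longlonglongrightarrow> indicator (box c d) x * (indicator (cbox c d) x * h x)"
        by (intro AE_I2 tendsto_mult_right box_bump_tendsto)
      show "AE x in lebesgue. norm (box_bump n c d x * (indicator (cbox c d) x * h x)) \<le> \<bar>indicator (cbox c d) x * h x\<bar>" for n
        using box_bump_bounds[of n c d] by (intro AE_I2) (simp add: abs_mult mult_left_le_one_le)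
    qed
    then have "(\<integral>x. indicator (box c d) x * (indicator (cbox c d) x * h x) \<partial>lebesgue) = 0"
      unfolding z using LIMSEQ_unique tendsto_const by blast
    moreover have "(\<lambda>x. indicator (box c d) x * (indicator (cbox c d) x * h x)) = (\<lambda>x. indicator (box c d) x * h x)"
    proof
      fix x show "indicator (box c d) x * (indicator (cbox c d) x * h x) = indicator (box c d) x * h x"
        using box_subset_cbox[of c d] by (cases "x \<in> box c d") auto
    qed
    ultimately show ?thesis by simp
  qed
  obtain D where D: "countable D" "D \<subseteq> Pow S" "\<And>X. X \<in> D \<Longrightarrow> \<exists>a b. X = cbox a b" "\<Union>D = S"
    using open_countable_Union_open_cbox[OF S] by metis
  have "AE x in lebesgue. x \<in> X \<longrightarrow> h x = 0" if X: "X \<in> D" for X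
  proof -
    obtain a b where ab: "X = cbox a b" using D(3)[OF X] by blast
    then have sub: "cbox a b \<subseteq> S" using D(2) X by blast
    have 1: "AE x in lebesgue. x \<in> box a b \<longrightarrow> h x = 0"
      by (rule AE_zero_if_box_integrals_zero[OF int[OF sub] box]) (use sub in blast)
    have "negligible (cbox a b - box a b)" by (simp add: negligible_frontier_interval)
    then have "AE x in lebesgue. x \<notin> cbox a b - box a b"
      by (intro AE_not_in) (simp add: negligible_iff_null_sets)
    with 1 show ?thesis unfolding ab by eventually_elim auto
  qed
  then have "AE x in lebesgue. \<forall>X\<in>D. x \<in> X \<longrightarrow> h x = 0"
    by (subst AE_ball_countable[OF D(1)]) blast
  then show ?thesis by eventually_elim (use D(4) in blast)
qed

subsection \<open>The weak time derivative\<close>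

lemma (in finite_measure) sq_int_bounded:
  assumes "f \<in> borel_measurable M" "\<And>x. \<bar>f x\<bar> \<le> B"
  shows "sq_int M f"
  unfolding sq_int_def
proof
  show "integrable M (\<lambda>x. (f x)\<^sup>2)"
  proof (rule integrable_const_bound[where B="B\<^sup>2"])
    show "AE x in M. norm ((f x)\<^sup>2) \<le> B\<^sup>2"
      using power_mono[OF assms(2) abs_ge_zero, where n=2] by simp
  qed (use assms(1) in simp)
qed (rule assms(1))

section \<open>Dyadic interpolation in time\<close>

context denoising_flow
begin

context
  fixes T :: real
  assumes T: "0 < T"
begin

definition mesh :: "nat \<Rightarrow> real" where "mesh n = T / 2 ^ n"

text \<open>Not the usual hat functions but a cumulative basis: a constant and one ramp per cell.
  The coefficients are then the increments of \<open>u\<close>, each slope lives on a single cell,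
  and the interpolation is a tensor sum with a known weak derivative.\<close>

definition hat :: "nat \<Rightarrow> nat \<Rightarrow> real \<Rightarrow> real" where
  "hat n i t = (case i of 0 \<Rightarrow> 1 | Suc j \<Rightarrow> ramp (mesh n) (real j * mesh n) t)"

definition hat' :: "nat \<Rightarrow> nat \<Rightarrow> real \<Rightarrow> real" where
  "hat' n i t = (case i of 0 \<Rightarrow> 0 | Suc j \<Rightarrow> indicator {real j * mesh n<..<real j * mesh n + mesh n} t / mesh n)"

definition incr :: "nat \<Rightarrow> nat \<Rightarrow> 'a \<Rightarrow> real" where
  "incr n i x = (case i of 0 \<Rightarrow> u 0 x | Suc j \<Rightarrow> u (real (Suc j) * mesh n) x - u (real j * mesh n) x)"

text \<open>In time, the derivatives of the dyadic interpolations form a martingale that is bounded in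
  $L^2$. The orthogonality of its increments makes them converge strongly.\<close>

definition interp :: "nat \<Rightarrow> real \<Rightarrow> 'a \<Rightarrow> real" where
  "interp n t x = (\<Sum>i\<le>2 ^ n. hat n i t * incr n i x)"

definition interp' :: "nat \<Rightarrow> 'a \<times> real \<Rightarrow> real" where
  "interp' n p = (\<Sum>i\<le>2 ^ n. hat' n i (snd p) * incr n i (fst p))"

text \<open>The squared L2 norm of the time derivative of the interpolation: on a cell the slope is
  the increment divided by the mesh, and the cell has the length of the mesh.\<close>

definition kin :: "nat \<Rightarrow> real" where
  "kin n = (\<Sum>j<2 ^ n. (dst (u (real (Suc j) * mesh n)) (u (real j * mesh n)))\<^sup>2) / mesh n"

lemma mesh_pos: "0 < mesh n"
  using T by (simp add: mesh_def)

lemma mesh_top: "real (2 ^ n) * mesh n = T"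
  by (simp add: mesh_def)

lemma pwC1_hat: "pwC1 (hat n i) (hat' n i)"
  unfolding hat_def[abs_def] hat'_def[abs_def]
  by (cases i) (simp_all add: pwC1_const pwC1_ramp[OF mesh_pos])

lemma incr_integrable: "integrable lebesgue (incr n i)"
  unfolding incr_def[abs_def] using mesh_pos[of n]
  by (cases i) (simp_all add: state_integrable state_u Bochner_Integration.integrable_diff)

lemma incr_sq_int: "sq_int M (incr n i)"
  unfolding incr_def[abs_def] using mesh_pos[of n]
  by (cases i) (simp_all add: state_sq_int state_u sq_int_diff)

lemma weak_dt_interp: "weak_dt \<Omega> T (interp n) (interp' n)"
  unfolding interp_def[abs_def] interp'_def[abs_def]
  by (rule weak_dt_tensor_sum[OF open_\<Omega> T incr_integrable pwC1_hat])

lemma interp_sq_int: "sq_int (MT T) (\<lambda>p. interp n (snd p) (fst p))"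
  and interp'_sq_int: "sq_int (MT T) (interp' n)"
proof -
  have b: "\<exists>B. \<forall>t. \<bar>hat n i t\<bar> \<le> B" "\<exists>B. \<forall>t. \<bar>hat' n i t\<bar> \<le> B" for i
    using pwC1_hat[of n i] by (auto simp: pwC1_def)
  show "sq_int (MT T) (\<lambda>p. interp n (snd p) (fst p))"
    unfolding interp_def by (rule tensor_sum_sq_int[OF T incr_integrable incr_sq_int pwC1_measurable(1)[OF pwC1_hat] b(1)])
  show "sq_int (MT T) (interp' n)"
    unfolding interp'_def[abs_def] by (rule tensor_sum_sq_int[OF T incr_integrable incr_sq_int pwC1_measurable(2)[OF pwC1_hat] b(2)])
qed

text \<open>Ramps of earlier cells are complete and telescope to the grid value, ramps of later
  cells have not started. The case distinction admits the final grid point, after which there is no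
  cell.\<close>

lemma interp_eq:
  assumes k: "k \<le> 2 ^ n" and t: "real k * mesh n \<le> t" "t \<le> real (Suc k) * mesh n"
  shows "interp n t x = u (real k * mesh n) x
    + (if k < 2 ^ n then ramp (mesh n) (real k * mesh n) t * (u (real (Suc k) * mesh n) x - u (real k * mesh n) x) else 0)"
proof -
  let ?f = "\<lambda>i. u (real i * mesh n) x" and ?N = "2 ^ n :: nat"
  have "interp n t x = u 0 x + (\<Sum>i<?N. ramp (mesh n) (real i * mesh n) t * (?f (Suc i) - ?f i))"
    unfolding interp_def sum.atMost_shift by (simp add: hat_def incr_def)
  also have "(\<Sum>i<?N. ramp (mesh n) (real i * mesh n) t * (?f (Suc i) - ?f i))
     = (\<Sum>i<?N. (if i < k then ?f (Suc i) - ?f i else 0) + (if i = k then ramp (mesh n) (real k * mesh n) t * (?f (Suc k) - ?f k) else 0))"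
  proof (rule sum.cong[OF refl])
    fix i
    consider "i < k" | "i = k" | "k < i" by linarith
    then show "ramp (mesh n) (real i * mesh n) t * (?f (Suc i) - ?f i) = (if i < k then ?f (Suc i) - ?f i else 0) + (if i = k then ramp (mesh n) (real k * mesh n) t * (?f (Suc k) - ?f k) else 0)"
    proof cases
      case 1
      then have "real (Suc i) * mesh n \<le> real k * mesh n" using mesh_pos[of n] by (intro mult_right_mono) auto
      then have "real i * mesh n + mesh n \<le> t" using t by (simp add: algebra_simps)
      from ramp_ge[OF mesh_pos this] 1 show ?thesis by simp
    next
      case 3
      then have "real (Suc k) * mesh n \<le> real i * mesh n" using mesh_pos[of n] by (intro mult_right_mono) auto
      then have "t \<le> real i * mesh n" using t by simp
      from ramp_le[OF mesh_pos this] 3 show ?thesis by simp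
    qed simp
  qed
  also have "\<dots> = (\<Sum>i<k. ?f (Suc i) - ?f i) + (if k < ?N then ramp (mesh n) (real k * mesh n) t * (?f (Suc k) - ?f k) else 0)"
  proof -
    have "(\<Sum>i<?N. if i < k then ?f (Suc i) - ?f i else 0) = (\<Sum>i<k. ?f (Suc i) - ?f i)"
      using k by (intro sum.mono_neutral_cong_right) auto
    then show ?thesis by (simp add: sum.distrib)
  qed
  also have "(\<Sum>i<k. ?f (Suc i) - ?f i) = ?f k - ?f 0" by (rule sum_lessThan_telescope)
  finally show ?thesis by simp
qed

lemma interp_grid: "k \<le> 2 ^ n \<Longrightarrow> interp n (real k * mesh n) x = u (real k * mesh n) x"
  using interp_eq[of k n "real k * mesh n" x] mesh_pos[of n] ramp_le[OF mesh_pos order_refl]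
  by (simp add: algebra_simps)

lemma interp_dst:
  assumes t: "t \<in> {0<..<T}"
  shows "dst (interp n t) (u t) \<le> 2 * (sqrt F0 * sqrt (mesh n))"
proof -
  define k where "k = nat \<lfloor>t / mesh n\<rfloor>"
  have "0 \<le> t / mesh n" using t mesh_pos[of n] by simp
  then have "real k \<le> t / mesh n" "t / mesh n < real k + 1" unfolding k_def by linarith+
  then have kt: "real k * mesh n \<le> t" "t \<le> real (Suc k) * mesh n"
    using mesh_pos[of n] by (simp_all add: field_simps)
  have "real k * mesh n < real (2 ^ n) * mesh n" using kt t unfolding mesh_top by simp
  then have kN: "k < 2 ^ n" using mesh_pos[of n] by (simp add: mult_less_cancel_right_pos del: of_nat_power)
  let ?a = "u (real k * mesh n)" and ?b = "u (real (Suc k) * mesh n)" and ?r = "ramp (mesh n) (real k * mesh n) t"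
  have s: "sq_int M ?a" "sq_int M ?b" "sq_int M (u t)"
    using mesh_pos[of n] t by (auto intro!: state_sq_int state_u)
  have "dst (interp n t) (u t) = nrm2 M (\<lambda>x. (?a x - u t x) + ?r * (?b x - ?a x))"
    by (rule arg_cong[of _ _ "nrm2 M"], rule ext) (simp add: interp_eq[OF less_imp_le[OF kN] kt] kN)
  also have "\<dots> \<le> dst ?a (u t) + nrm2 M (\<lambda>x. ?r * (?b x - ?a x))"
    by (intro nrm2_triangle sq_int_diff sq_int_cmult s)
  also have "nrm2 M (\<lambda>x. ?r * (?b x - ?a x)) = \<bar>?r\<bar> * dst ?b ?a" by (rule nrm2_cmult)
  also have "\<bar>?r\<bar> * dst ?b ?a \<le> 1 * dst ?b ?a"
    using ramp_nonneg[of "mesh n" "real k * mesh n" t] ramp_le_1[of "mesh n" "real k * mesh n" t]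
    by (intro mult_right_mono nrm2_nonneg) simp
  also have "dst ?b ?a \<le> sqrt F0 * sqrt (mesh n)"
    using Hoelder_half[of "real (Suc k) * mesh n" "real k * mesh n"] mesh_pos[of n] by (simp add: algebra_simps)
  also have "dst ?a (u t) \<le> sqrt F0 * sqrt (mesh n)"
  proof -
    have "dst ?a (u t) \<le> sqrt F0 * sqrt \<bar>real k * mesh n - t\<bar>"
      using mesh_pos[of n] t by (intro Hoelder_half) auto
    also have "\<dots> \<le> sqrt F0 * sqrt (mesh n)"
      using kt by (intro mult_left_mono real_sqrt_le_mono) (simp_all add: algebra_simps)
    finally show ?thesis .
  qed
  finally show ?thesis by (simp add: mult.commute)
qed

text \<open>The martingale property: the coarse slope is constant on a coarse cell, and over that
  cell the fine slope integrates to the increment of \<open>u\<close>, because both interpolations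
  agree with \<open>u\<close> at coarse grid points. Hence the fine slope projects onto the coarse
  one, and the squared norm of the difference is \<open>kin m - kin n\<close>.\<close>

lemma interp'_inner:
  assumes nm: "n \<le> m"
  shows "(\<integral>p. interp' m p * interp' n p \<partial>MT T) = kin n"
proof -
  let ?i = "\<lambda>t. indicator {0<..<T} t :: real"
  let ?a = "\<lambda>i j. \<integral>x. incr m i x * incr n j x \<partial>M"
  define H where "H j t = (\<Sum>i\<le>2 ^ m. ?a i j * hat' m i t)" for j t
  \<comment> \<open>Time antiderivative of \<open>H\<close>, that is, the inner product of the fine
    interpolation with a coarse increment.\<close>
  define Q where "Q j t = (\<Sum>i\<le>2 ^ m. ?a i j * hat m i t)" for j t
  have QH: "pwC1 (Q j) (H j)" for j
    unfolding Q_def[abs_def] H_def[abs_def] by (rule pwC1_sum, rule pwC1_cmult, rule pwC1_hat)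
  have Qgrid: "Q j (real l * mesh n) = (\<integral>x. u (real l * mesh n) x * incr n j x \<partial>M)" if l: "l \<le> 2 ^ n" for j l
  proof -
    have "Q j (real l * mesh n) = (\<integral>x. (\<Sum>i\<le>2 ^ m. hat m i (real l * mesh n) * (incr m i x * incr n j x)) \<partial>M)"
      unfolding Q_def using sq_int_prod[OF incr_sq_int incr_sq_int]
      by (subst Bochner_Integration.integral_sum) (simp_all add: mult.commute)
    also have "\<dots> = (\<integral>x. interp m (real l * mesh n) x * incr n j x \<partial>M)"
      by (simp add: interp_def sum_distrib_right mult.assoc)
    also have "interp m (real l * mesh n) = u (real l * mesh n)"
    proof
    \<comment> \<open>A coarse grid point is also a fine one because the grids are dyadic; there the
      interpolation reproduces \<open>u\<close>.\<close>
    have e: "real l * mesh n = real (l * 2 ^ (m - n)) * mesh m"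
    proof -
      have "(2::real) ^ m = 2 ^ n * 2 ^ (m - n)" using nm by (simp add: power_add[symmetric])
      then show ?thesis by (simp add: mesh_def)
    qed
      have "l * 2 ^ (m - n) \<le> 2 ^ n * 2 ^ (m - n)" using l by simp
      also have "\<dots> = 2 ^ m" using nm by (simp add: power_add[symmetric])
      finally show "interp m (real l * mesh n) x = u (real l * mesh n) x" for x
        unfolding e by (rule interp_grid)
    qed
    finally show ?thesis .
  qed
  have sec: "(\<integral>x. interp' m (x, t) * interp' n (x, t) \<partial>M) = (\<Sum>j\<le>2 ^ n. hat' n j t * H j t)" for t
  proof -
    have "(\<integral>x. interp' m (x, t) * interp' n (x, t) \<partial>M)
        = (\<integral>x. (\<Sum>j\<le>2 ^ n. \<Sum>i\<le>2 ^ m. (hat' n j t * hat' m i t) * (incr m i x * incr n j x)) \<partial>M)"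
    proof (rule Bochner_Integration.integral_cong[OF refl])
      fix x
      have "interp' m (x, t) * interp' n (x, t) = (\<Sum>i\<le>2 ^ m. \<Sum>j\<le>2 ^ n. (hat' n j t * hat' m i t) * (incr m i x * incr n j x))"
        by (simp only: interp'_def sum_product fst_conv snd_conv mult_ac)
      then show "interp' m (x, t) * interp' n (x, t) = (\<Sum>j\<le>2 ^ n. \<Sum>i\<le>2 ^ m. (hat' n j t * hat' m i t) * (incr m i x * incr n j x))"
        by (rule trans[OF _ sum.swap])
    qed
    also have "\<dots> = (\<Sum>j\<le>2 ^ n. \<Sum>i\<le>2 ^ m. (hat' n j t * hat' m i t) * ?a i j)"
      using sq_int_prod[OF incr_sq_int incr_sq_int] by (simp add: Bochner_Integration.integral_sum)
    also have "\<dots> = (\<Sum>j\<le>2 ^ n. hat' n j t * H j t)"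
      by (simp only: H_def sum_distrib_left mult_ac)
    finally show ?thesis .
  qed
  have int: "integrable lebesgue (\<lambda>t. ?i t * (hat' n j t * H j t))" for j
  proof -
    obtain B where B: "0 \<le> B" "\<And>t. \<bar>hat' n j t\<bar> \<le> B" using pwC1_bound[OF pwC1_hat] by metis
    obtain B' where B': "\<And>t. \<bar>H j t\<bar> \<le> B'" using pwC1_bound[OF QH] by metis
    show ?thesis
    proof (rule integrable_bounded_on_interval[where B="B * B'"])
      show "(\<lambda>t. hat' n j t * H j t) \<in> borel_measurable lebesgue"
        by (intro borel_imp_lebesgue_measurable borel_measurable_times pwC1_measurable(2)[OF pwC1_hat] pwC1_measurable(2)[OF QH])
      show "\<bar>hat' n j t * H j t\<bar> \<le> B * B'" for t
        unfolding abs_mult using B B' by (intro mult_mono) auto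
    qed
  qed
  have cell: "(\<integral>t. ?i t * (hat' n (Suc j) t * H (Suc j) t) \<partial>lebesgue) = (dst (u (real (Suc j) * mesh n)) (u (real j * mesh n)))\<^sup>2 / mesh n"
    if j: "j < 2 ^ n" for j
  proof -
    let ?p = "real j * mesh n" and ?q = "real (Suc j) * mesh n"
    have pq: "?q = ?p + mesh n" by (simp add: algebra_simps)
    have qT: "?q \<le> T"
      using j mesh_pos[of n] by (subst mesh_top[of n, symmetric], intro mult_right_mono) (simp_all del: of_nat_Suc of_nat_power)
    have p0: "0 \<le> ?p" using mesh_pos[of n] by simp
    have "?i t * (hat' n (Suc j) t * H (Suc j) t) = 1 / mesh n * (indicator {?p<..<?q} t * H (Suc j) t)" for t
      using qT p0 pq by (auto simp: hat'_def indicator_def)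
    then have "(\<integral>t. ?i t * (hat' n (Suc j) t * H (Suc j) t) \<partial>lebesgue) = 1 / mesh n * (\<integral>t. indicator {?p<..<?q} t * H (Suc j) t \<partial>lebesgue)"
      by simp
    also have "(\<integral>t. indicator {?p<..<?q} t * H (Suc j) t \<partial>lebesgue) = Q (Suc j) ?q - Q (Suc j) ?p"
      by (rule pwC1_FTC[OF QH]) (use pq mesh_pos[of n] in simp)
    also have "\<dots> = (\<integral>x. u ?q x * incr n (Suc j) x \<partial>M) - (\<integral>x. u ?p x * incr n (Suc j) x \<partial>M)"
      using Qgrid[of "Suc j" "Suc j"] Qgrid[of j "Suc j"] j by simp
    also have "\<dots> = (\<integral>x. u ?q x * incr n (Suc j) x - u ?p x * incr n (Suc j) x \<partial>M)"
      using p0 pq mesh_pos[of n]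
      by (intro Bochner_Integration.integral_diff[symmetric] sq_int_prod incr_sq_int state_sq_int state_u) auto
    also have "\<dots> = (dst (u ?q) (u ?p))\<^sup>2"
      unfolding nrm2_sq by (simp add: incr_def power2_eq_square left_diff_distrib)
    finally show ?thesis by simp
  qed
  have "(\<integral>p. interp' m p * interp' n p \<partial>MT T) = (\<integral>t. ?i t * (\<Sum>j\<le>2 ^ n. hat' n j t * H j t) \<partial>lebesgue)"
    unfolding cylinder_Fubini[OF sq_int_prod[OF interp'_sq_int interp'_sq_int]] sec ..
  also have "\<dots> = (\<Sum>j\<le>2 ^ n. \<integral>t. ?i t * (hat' n j t * H j t) \<partial>lebesgue)"
    unfolding sum_distrib_left by (rule Bochner_Integration.integral_sum[OF int])
  also have "\<dots> = (\<Sum>j<2 ^ n. \<integral>t. ?i t * (hat' n (Suc j) t * H (Suc j) t) \<partial>lebesgue)"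
    unfolding sum.atMost_shift by (simp add: hat'_def)
  also have "\<dots> = kin n"
    unfolding kin_def sum_divide_distrib by (rule sum.cong[OF refl cell]) simp
  finally show ?thesis .
qed

lemma interp'_nrm2: "(nrm2 (MT T) (interp' n))\<^sup>2 = kin n"
  unfolding nrm2_sq using interp'_inner[of n n] by (simp add: power2_eq_square)

lemma interp'_dist: "n \<le> m \<Longrightarrow> (nrm2 (MT T) (\<lambda>p. interp' m p - interp' n p))\<^sup>2 = kin m - kin n"
  unfolding nrm2_diff_sq[OF interp'_sq_int interp'_sq_int] interp'_inner interp'_nrm2 by simp

lemma kin_le: "kin n \<le> F0"
proof -
  have "(\<Sum>j<2 ^ n. (dst (u (real (Suc j) * mesh n)) (u (real j * mesh n)))\<^sup>2) \<le> mesh n * F0"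
    using energy_bound[of 0 T "2 ^ n"] T by (simp add: mesh_def)
  then show ?thesis unfolding kin_def using mesh_pos[of n] by (simp add: field_simps)
qed

lemma kin_mono: "n \<le> m \<Longrightarrow> kin n \<le> kin m"
  using interp'_dist[of n m] zero_le_power2[of "nrm2 (MT T) (\<lambda>p. interp' m p - interp' n p)"] by linarith

text \<open>By orthogonality \<open>kin\<close> is increasing, and the quadratic variation bounds it
  by F0. It is therefore a Cauchy sequence, and its differences are the squared distances of the
  slopes, so completeness applies. The norm bound passes to the limit by the triangle
  inequality.\<close>

lemma interp'_converges:
  obtains g where "sq_int (MT T) g" "(\<lambda>n. nrm2 (MT T) (\<lambda>p. interp' n p - g p)) \<longlonglongrightarrow> 0" "nrm2 (MT T) g \<le> sqrt F0"
proof -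
  interpret finite_measure "MT T" by (rule finite_MT)
  have "convergent kin"
  proof (rule Bseq_mono_convergent)
    have "0 \<le> kin n" for n using interp'_nrm2[of n] zero_le_power2[of "nrm2 (MT T) (interp' n)"] by linarith
    then show "Bseq kin" by (intro BseqI'[of _ F0]) (simp add: kin_le)
  qed (simp add: kin_mono)
  then have C: "Cauchy kin" by (rule convergent_Cauchy)
  have "\<exists>N. \<forall>m\<ge>N. \<forall>n\<ge>N. nrm2 (MT T) (\<lambda>p. interp' m p - interp' n p) \<le> e" if e: "0 < e" for e
  proof -
    from CauchyD[OF C, of "e\<^sup>2"] e obtain N where N: "\<forall>m\<ge>N. \<forall>n\<ge>N. norm (kin m - kin n) < e\<^sup>2" by auto
    have le: "nrm2 (MT T) (\<lambda>p. interp' m p - interp' n p) \<le> e" if "N \<le> n" "n \<le> m" for m n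
    proof (rule power2_le_imp_le)
      have "norm (kin m - kin n) < e\<^sup>2" using N that by auto
      then show "(nrm2 (MT T) (\<lambda>p. interp' m p - interp' n p))\<^sup>2 \<le> e\<^sup>2"
        unfolding interp'_dist[OF that(2)] by simp
    qed (use e in simp)
    have "nrm2 (MT T) (\<lambda>p. interp' m p - interp' n p) \<le> e" if "N \<le> n" "N \<le> m" for m n
      using le[of n m] le[of m n] that nrm2_minus[of "MT T" "interp' m" "interp' n"] by (cases "n \<le> m") auto
    then show ?thesis by blast
  qed
  from L2_complete[OF interp'_sq_int this] obtain g where
    g: "sq_int (MT T) g" "(\<lambda>n. nrm2 (MT T) (\<lambda>p. interp' n p - g p)) \<longlonglongrightarrow> 0" by blast
  have "nrm2 (MT T) g \<le> sqrt F0 + nrm2 (MT T) (\<lambda>p. interp' n p - g p)" for n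
  proof -
    have "nrm2 (MT T) (\<lambda>p. (g p - interp' n p) + interp' n p) \<le> nrm2 (MT T) (\<lambda>p. g p - interp' n p) + nrm2 (MT T) (interp' n)"
      by (intro nrm2_triangle sq_int_diff g interp'_sq_int)
    moreover have "nrm2 (MT T) (interp' n) \<le> sqrt F0"
      using kin_le[of n] by (intro real_le_rsqrt) (simp add: interp'_nrm2)
    ultimately show ?thesis using nrm2_minus[of "MT T" g "interp' n"] by simp
  qed
  moreover have "(\<lambda>n. sqrt F0 + nrm2 (MT T) (\<lambda>p. interp' n p - g p)) \<longlonglongrightarrow> sqrt F0 + 0"
    by (intro tendsto_add tendsto_const g(2))
  ultimately have "nrm2 (MT T) g \<le> sqrt F0" by (intro LIMSEQ_le_const) auto
  with g show thesis by (rule that)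
qed

lemma interp_converges: "(\<lambda>n. nrm2 (MT T) (\<lambda>p. interp n (snd p) (fst p) - u (snd p) (fst p))) \<longlonglongrightarrow> 0"
proof (rule Lim_null_comparison)
  have "(\<lambda>n. T / 2 ^ n) \<longlonglongrightarrow> 0"
    using LIMSEQ_divide_realpow_zero[of 2 T] by simp
  then have "mesh \<longlonglongrightarrow> 0" unfolding mesh_def[abs_def] .
  from tendsto_real_sqrt[OF this]
  have "(\<lambda>n. sqrt T * (2 * (sqrt F0 * sqrt (mesh n)))) \<longlonglongrightarrow> sqrt T * (2 * (sqrt F0 * sqrt 0))"
    by (intro tendsto_mult tendsto_const)
  then show "(\<lambda>n. sqrt T * (2 * (sqrt F0 * sqrt (mesh n)))) \<longlonglongrightarrow> 0" by simp
  show "\<forall>\<^sub>F n in sequentially. norm (nrm2 (MT T) (\<lambda>p. interp n (snd p) (fst p) - u (snd p) (fst p))) \<le> sqrt T * (2 * (sqrt F0 * sqrt (mesh n)))"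
  proof (intro always_eventually allI)
    fix n
    have sd: "sq_int (MT T) (\<lambda>p. interp n (snd p) (fst p) - u (snd p) (fst p))"
      by (intro sq_int_diff interp_sq_int u_joint_sq_int T)
    have "nrm2 (MT T) (\<lambda>p. interp n (snd p) (fst p) - u (snd p) (fst p)) \<le> sqrt T * (2 * (sqrt F0 * sqrt (mesh n)))"
    proof (rule bounded_time_sq_int(2)[OF T sq_int_measurable[OF sd]])
      fix t assume t: "t \<in> {0<..<T}"
      have "sq_int M (interp n t)"
        unfolding interp_def[abs_def] by (intro sq_int_sum sq_int_cmult incr_sq_int)
      moreover have "sq_int M (u t)" using t by (intro state_sq_int state_u) simp
      ultimately show "sq_int M (\<lambda>x. interp n (snd (x, t)) (fst (x, t)) - u (snd (x, t)) (fst (x, t)))"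
        by (simp add: sq_int_diff)
      show "nrm2 M (\<lambda>x. interp n (snd (x, t)) (fst (x, t)) - u (snd (x, t)) (fst (x, t))) \<le> 2 * (sqrt F0 * sqrt (mesh n))"
        using interp_dst[OF t] by simp
    qed
    then show "norm (nrm2 (MT T) (\<lambda>p. interp n (snd p) (fst p) - u (snd p) (fst p))) \<le> sqrt T * (2 * (sqrt F0 * sqrt (mesh n)))"
      by (simp add: nrm2_nonneg)
  qed
qed

section \<open>Existence, uniqueness and energy of the weak time derivative\<close>

lemma integrable_on_compact_subset:
  assumes f: "sq_int (MT T) f" and K: "compact K" "K \<subseteq> \<Omega> \<times> {0<..<T}"
  shows "integrable (lebesgue_on K) f"
proof -
  interpret finite_measure "MT T" by (rule finite_MT)
  have Ks: "K \<in> sets lebesgue" using K(1) by (simp add: lmeasurable_compact fmeasurableD)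
  have "integrable lebesgue (\<lambda>p. indicator (\<Omega> \<times> {0<..<T}) p *\<^sub>R f p)"
    using sq_int_integrable[OF f] by (simp add: integrable_restrict_space)
  from integrable_mult_indicator[OF Ks this]
  have "integrable lebesgue (\<lambda>p. indicator K p *\<^sub>R (indicator (\<Omega> \<times> {0<..<T}) p *\<^sub>R f p))" .
  moreover have "indicator K p *\<^sub>R (indicator (\<Omega> \<times> {0<..<T}) p *\<^sub>R f p) = indicator K p *\<^sub>R f p" for p
  proof (cases "p \<in> K")
    case True
    then have "p \<in> \<Omega> \<times> {0<..<T}" using K(2) by blast
    then show ?thesis by simp
  qed simp
  ultimately have "integrable lebesgue (\<lambda>p. indicator K p *\<^sub>R f p)" by (simp only:)
  then show ?thesis using Ks integrable_restrict_space[of K lebesgue f] by simp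
qed

lemma test_function_sq_int:
  assumes \<phi>: "Cinf_c \<phi>"
  shows "sq_int (MT T) \<phi>" "sq_int (MT T) (dtime \<phi>)"
proof -
  interpret finite_measure "MT T" by (rule finite_MT)
  note tf = test_function_time[OF Cinf_c_C1_c[OF \<phi>]]
  from tf(4) obtain B where B: "\<And>p. \<bar>\<phi> p\<bar> \<le> B" "\<And>p. \<bar>dtime \<phi> p\<bar> \<le> B" by blast
  have m: "f \<in> borel_measurable (MT T)" if "continuous_on UNIV f" for f :: "'a \<times> real \<Rightarrow> real"
    using that by (intro measurable_restrict_space1 borel_imp_lebesgue_measurable borel_measurable_continuous_onI)
  show "sq_int (MT T) \<phi>" by (rule sq_int_bounded[OF m[OF C1_c_continuous[OF Cinf_c_C1_c[OF \<phi>]]] B(1)])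
  show "sq_int (MT T) (dtime \<phi>)" by (rule sq_int_bounded[OF m[OF tf(1)] B(2)])
qed

text \<open>Both sides of the weak identity for the interpolations are L2 inner products with a
  fixed square integrable function on the cylinder, so strong convergence of the interpolations and
  of their slopes carries it to \<open>u\<close>.\<close>

lemma weak_derivative_exists:
  obtains g where "weak_dt \<Omega> T u g" "sq_int (MT T) g" "nrm2 (MT T) g \<le> sqrt F0"
proof -
  obtain g where g: "sq_int (MT T) g" "(\<lambda>n. nrm2 (MT T) (\<lambda>p. interp' n p - g p)) \<longlonglongrightarrow> 0" "nrm2 (MT T) g \<le> sqrt F0"
    by (rule interp'_converges)
  have "(\<integral>p. u (snd p) (fst p) * dtime \<phi> p \<partial>MT T) = - (\<integral>p. g p * \<phi> p \<partial>MT T)"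
    if \<phi>: "Cinf_c \<phi>" and sup: "supp \<phi> \<subseteq> \<Omega> \<times> {0<..<T}" for \<phi>
  proof -
    note s = test_function_sq_int[OF \<phi>]
    have "(\<lambda>n. \<integral>p. dtime \<phi> p * interp n (snd p) (fst p) \<partial>MT T) \<longlonglongrightarrow> (\<integral>p. dtime \<phi> p * u (snd p) (fst p) \<partial>MT T)"
      by (rule L2_inner_tendsto[OF interp_sq_int u_joint_sq_int[OF T] s(2) interp_converges])
    moreover have "(\<lambda>n. - (\<integral>p. \<phi> p * interp' n p \<partial>MT T)) \<longlonglongrightarrow> - (\<integral>p. \<phi> p * g p \<partial>MT T)"
      by (rule tendsto_minus[OF L2_inner_tendsto[OF interp'_sq_int g(1) s(1) g(2)]])
    moreover have "(\<integral>p. dtime \<phi> p * interp n (snd p) (fst p) \<partial>MT T) = - (\<integral>p. \<phi> p * interp' n p \<partial>MT T)" for n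
      using weak_dt_interp[of n] \<phi> sup unfolding weak_dt_def by (simp add: mult.commute)
    ultimately have "(\<integral>p. dtime \<phi> p * u (snd p) (fst p) \<partial>MT T) = - (\<integral>p. \<phi> p * g p \<partial>MT T)"
      using LIMSEQ_unique by simp
    then show ?thesis by (simp add: mult.commute)
  qed
  then have "weak_dt \<Omega> T u g"
    unfolding weak_dt_def using integrable_on_compact_subset[OF g(1)] integrable_on_compact_subset[OF u_joint_sq_int[OF T]] by blast
  with g show thesis by (intro that)
qed

text \<open>The energy bound is claimed for an arbitrary weak derivative, which is a priori only
  locally integrable; uniqueness transfers to it the bound for the one that was constructed.\<close>

lemma weak_derivative_unique:
  assumes g1: "weak_dt \<Omega> T u g1" and g2: "weak_dt \<Omega> T u g2"
  shows "AE p in lebesgue. p \<in> \<Omega> \<times> {0<..<T} \<longrightarrow> g1 p - g2 p = 0"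
proof (rule fundamental_lemma_calculus_variations)
  let ?S = "\<Omega> \<times> {0<..<T}"
  show "open ?S" using open_\<Omega> by (intro open_Times) auto
  have loc: "integrable (lebesgue_on K) g1" "integrable (lebesgue_on K) g2" if "compact K" "K \<subseteq> ?S" for K
    using g1 g2 that unfolding weak_dt_def by blast+
  then show "integrable (lebesgue_on K) (\<lambda>p. g1 p - g2 p)" if "compact K" "K \<subseteq> ?S" for K
    using that by (intro Bochner_Integration.integrable_diff) blast+
  fix \<phi> :: "'a \<times> real \<Rightarrow> real" assume \<phi>: "Cinf_c \<phi>" and sup: "supp \<phi> \<subseteq> ?S"
  note tf = test_function_time[OF Cinf_c_C1_c[OF \<phi>]]
  from tf(4) obtain B where B: "\<And>p. \<bar>\<phi> p\<bar> \<le> B" by blast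
  have K: "compact (supp \<phi>)" using \<phi> by (simp add: Cinf_c_def)
  have Ks: "supp \<phi> \<in> sets lebesgue" using K by (simp add: lmeasurable_compact fmeasurableD)
  \<comment> \<open>Integrability of \<open>g\<close> is available on compact subsets of the
    cylinder only, so the product is integrated over the support of the test function and extended
    by 0.\<close>
  have int: "integrable (MT T) (\<lambda>p. g p * \<phi> p)" if g: "integrable (lebesgue_on (supp \<phi>)) g" for g
  proof -
    have i: "integrable lebesgue (\<lambda>p. indicator (supp \<phi>) p *\<^sub>R g p)"
      using g Ks integrable_restrict_space[of "supp \<phi>" lebesgue g] by simp
    have "integrable lebesgue (\<lambda>p. (indicator (supp \<phi>) p *\<^sub>R g p) * \<phi> p)"
    proof (rule Bochner_Integration.integrable_bound)
      show "integrable lebesgue (\<lambda>p. B * (indicator (supp \<phi>) p *\<^sub>R g p))" by (rule integrable_mult_right[OF i])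
      have "\<phi> \<in> borel_measurable lebesgue"
        by (intro borel_imp_lebesgue_measurable borel_measurable_continuous_onI C1_c_continuous Cinf_c_C1_c \<phi>)
      then show "(\<lambda>p. (indicator (supp \<phi>) p *\<^sub>R g p) * \<phi> p) \<in> borel_measurable lebesgue"
        by (rule borel_measurable_times[OF borel_measurable_integrable[OF i]])
      have "\<bar>a\<bar> * \<bar>\<phi> p\<bar> \<le> \<bar>a\<bar> * \<bar>B\<bar>" for a p
        using B[of p] by (intro mult_left_mono) auto
      then show "AE p in lebesgue. norm ((indicator (supp \<phi>) p *\<^sub>R g p) * \<phi> p) \<le> norm (B * (indicator (supp \<phi>) p *\<^sub>R g p))"
        by (intro AE_I2) (simp only: real_norm_def abs_mult mult.commute[of "\<bar>B\<bar>"])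
    qed
    moreover have "(indicator (supp \<phi>) p *\<^sub>R g p) * \<phi> p = indicator ?S p *\<^sub>R (g p * \<phi> p)" for p
    proof (cases "p \<in> supp \<phi>")
      case True
      then have "p \<in> ?S" using sup by blast
      with True show ?thesis by simp
    next
      case False
      from tf(2)[OF this] show ?thesis by simp
    qed
    ultimately have "integrable lebesgue (\<lambda>p. indicator ?S p *\<^sub>R (g p * \<phi> p))" by (simp only:)
    then show ?thesis using integrable_restrict_space[of ?S lebesgue "\<lambda>p. g p * \<phi> p"] by simp
  qed
  have "(\<integral>p. (g1 p - g2 p) * \<phi> p \<partial>MT T) = (\<integral>p. g1 p * \<phi> p \<partial>MT T) - (\<integral>p. g2 p * \<phi> p \<partial>MT T)"
    using int[OF loc(1)[OF K sup]] int[OF loc(2)[OF K sup]] by (simp add: left_diff_distrib)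
  also have "\<dots> = 0"
    using g1 g2 \<phi> sup unfolding weak_dt_def by (simp add: neg_equal_iff_equal)
  finally show "(\<integral>p. (g1 p - g2 p) * \<phi> p \<partial>MT T) = 0" .
qed

lemma weak_derivative_energy:
  assumes "weak_dt \<Omega> T u g"
  shows "(\<integral>\<^sup>+ p\<in>\<Omega> \<times> {0<..<T}. ennreal ((g p)\<^sup>2) \<partial>lebesgue) \<le> F u0"
proof -
  obtain g0 where g0: "weak_dt \<Omega> T u g0" "sq_int (MT T) g0" "nrm2 (MT T) g0 \<le> sqrt F0"
    by (rule weak_derivative_exists)
  have "(\<integral>\<^sup>+ p\<in>\<Omega> \<times> {0<..<T}. ennreal ((g p)\<^sup>2) \<partial>lebesgue) = (\<integral>\<^sup>+ p\<in>\<Omega> \<times> {0<..<T}. ennreal ((g0 p)\<^sup>2) \<partial>lebesgue)"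
  proof (rule nn_integral_cong_AE, rule AE_mp[OF weak_derivative_unique[OF assms g0(1)]], intro AE_I2 impI)
    fix p assume "p \<in> \<Omega> \<times> {0<..<T} \<longrightarrow> g p - g0 p = 0"
    then show "ennreal ((g p)\<^sup>2) * indicator (\<Omega> \<times> {0<..<T}) p = ennreal ((g0 p)\<^sup>2) * indicator (\<Omega> \<times> {0<..<T}) p"
      by (cases "p \<in> \<Omega> \<times> {0<..<T}") simp_all
  qed
  also have "\<dots> = (\<integral>\<^sup>+ p. ennreal ((g0 p)\<^sup>2) \<partial>MT T)"
    by (subst nn_integral_restrict_space) auto
  also have "\<dots> = ennreal ((nrm2 (MT T) g0)\<^sup>2)" by (rule nn_integral_sq_eq_nrm2[OF g0(2)])
  also have "\<dots> \<le> ennreal ((sqrt F0)\<^sup>2)"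
    by (intro ennreal_leI power_mono g0(3) nrm2_nonneg)
  also have "\<dots> = F u0" using F_u0 by simp
  finally show ?thesis .
qed

end

end

theorem theorem2p9:
  fixes \<Omega> :: "'a::euclidean_space set"
    and \<alpha> :: real
    and R :: "'a \<Rightarrow> real \<Rightarrow> real"
    and u0 :: "'a \<Rightarrow> real"
    and u :: "real \<Rightarrow> 'a \<Rightarrow> real"
  assumes "open \<Omega>" and "bounded \<Omega>"
    and "0 < \<alpha>" and "\<alpha> < 1"
    and "caratheodory \<Omega> R"
    and "\<forall>x\<in>\<Omega>. \<forall>s. 0 \<le> R x s"
    and "AE x in lebesgue_on \<Omega>. convex_on UNIV (R x)"
    and "BVG \<alpha> u0" and "L2on \<Omega> u0"
    and "(\<integral>\<^sup>+ x\<in>\<Omega>. ennreal (R x (u0 x)) \<partial>lebesgue) < \<infinity>"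
    and "global_var_sol \<alpha> R \<Omega> u0 u"
  shows "(\<forall>T>0. (\<exists>g. weak_dt \<Omega> T u g \<and> L2on (\<Omega> \<times> {0<..<T}) g) \<and> C012L2 \<Omega> T u)
       \<and> (\<forall>T>0. \<forall>g. weak_dt \<Omega> T u g \<longrightarrow>
              (\<integral>\<^sup>+ p\<in>\<Omega> \<times> {0<..<T}. ennreal ((g p)\<^sup>2) \<partial>lebesgue) \<le> FG \<alpha> R \<Omega> u0)
       \<and> (\<forall>t1 t2. 0 \<le> t1 \<and> t1 < t2 \<longrightarrow>
              ennreal (1 / (t2 - t1)) * (\<integral>\<^sup>+ t\<in>{t1..t2}. FG \<alpha> R \<Omega> (u t) \<partial>lebesgue)
                \<le> FG \<alpha> R \<Omega> u0)"
proof -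
  interpret denoising_flow \<Omega> \<alpha> R u0 u
    using assms by unfold_locales blast+
  show ?thesis
  proof (intro conjI allI impI)
    fix T :: real assume T: "0 < T"
    show "\<exists>g. weak_dt \<Omega> T u g \<and> L2on (\<Omega> \<times> {0<..<T}) g"
      by (rule weak_derivative_exists[OF T]) (auto simp: L2on_def sq_int_def)
    show "C012L2 \<Omega> T u"
      unfolding C012L2_def
    proof (intro conjI ballI exI[of _ "sqrt F0"])
      show "L2on \<Omega> (u t)" if "t \<in> {0..T}" for t
        using that state_sq_int[OF state_u] by (simp add: L2on_sq_int)
      show "sqrt (L2dist2 \<Omega> (u s) (u t)) \<le> sqrt F0 * \<bar>s - t\<bar> powr (1 / 2)" if "s \<in> {0..T}" "t \<in> {0..T}" for s t
        using that Hoelder_half[of s t] by (simp add: L2dist2_dst nrm2_nonneg powr_half_sqrt)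
    qed
    show "(\<integral>\<^sup>+ p\<in>\<Omega> \<times> {0<..<T}. ennreal ((g p)\<^sup>2) \<partial>lebesgue) \<le> FG \<alpha> R \<Omega> u0" if "weak_dt \<Omega> T u g" for g
      by (rule weak_derivative_energy[OF T that])
  next
    fix t1 t2 :: real assume t: "0 \<le> t1 \<and> t1 < t2"
    have "ennreal (1 / (t2 - t1)) * (\<integral>\<^sup>+ t\<in>{t1..t2}. F (u t) \<partial>lebesgue) \<le> ennreal (1 / (t2 - t1)) * ennreal (F0 * (t2 - t1))"
      unfolding Fint_closed using t by (intro mult_left_mono time_average_bound) auto
    also have "\<dots> = F u0"
      using t F_u0 by (simp add: ennreal_mult[symmetric])
    finally show "ennreal (1 / (t2 - t1)) * (\<integral>\<^sup>+ t\<in>{t1..t2}. F (u t) \<partial>lebesgue) \<le> F u0" .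
  qed
qed

end
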